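(* The (exact) reverse-rank single-source problem has subcubic equivalence to the all-pairs shortest-paths problem (APSP): there is a truly subcubic algorithm for the reverse-rank single-source problem if and only if there is a truly subcubic algorithm for APSP.
   Context: Graphs $G=(V,E)$ are directed or undirected with positive edge lengths. $d_{ij}$ denotes shortest-path distance from $i$ to $j$. A subset $U\subseteq V$ of nodes (possibly all of $V$) is designated as rankees. For $i\in V$, $j\in U$, the rank $\pi_{ij}$ is the position of $j$ when rankees are ordered by increasing distance from $i$; concretely, with unique distances, it is the number of rankees (other than $i$ itself) at distance at most $d_{ij}$ from $i$; with non-unique distances, the rank may be taken as any fixed choice in the range from one plus the number of rankees strictly closer to $i$ than $j$, to the number of rankees at distance at most $d_{ij}$ from $i$. Reverse-rank single-source problem: given $G$ and a node $u\in U$, compute $\pi_{iu}$ exactly for all nodes $i\in V$. APSP: given $G$, compute $d_{ij}$ for all pairs $i,j$. Subcubic equivalence is in the sense of Vassilevska Williams and Williams: on $n$-node graphs with integer edge lengths of absolute value at most $M$, an algorithm is truly subcubic if it runs in time $O(n^{3-\delta}\,\mathrm{polylog}\,M)$ for some $\delta>0$; two problems are subcubic equivalent if there are subcubic reductions in both directions, so that a truly subcubic algorithm for either yields one for the other. *)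

theory Defs
  imports
    Complex_Main
    "HOL-Library.Log_Nat"
    "Graph_Theory.Pair_Digraph"
    "Graph_Theory.Shortest_Path"
begin

section \<open>Machine model: a random access machine with logarithmic cost\<close>

text \<open>
  A program works on integer variables and on finitely many integer arrays with random access.
  Every operation costs the bit lengths of the numbers it touches (indices included), so that big
  numbers cannot be used as a source of free parallelism. Compared with a word RAM whose words have
  \<open>O(log n + log M)\<close> bits the difference is a factor polynomial in \<open>log n\<close> and \<open>log M\<close>.
\<close>

type_synonym vname = string

record state =
  var :: "vname \<Rightarrow> int"
  arr :: "vname \<Rightarrow> int \<Rightarrow> int"

definition bits :: "int \<Rightarrow> nat" where
  "bits z = 1 + floorlog 2 (nat \<bar>z\<bar>)"

definition list_bits :: "int list \<Rightarrow> nat" where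
  "list_bits xs = sum_list (map bits xs)"

datatype aexp =
    Const int
  | Var vname
  | Elem vname aexp
  | Plus aexp aexp
  | Minus aexp aexp
  | Times aexp aexp
  | Div aexp aexp
  | Mod aexp aexp

primrec aval :: "aexp \<Rightarrow> state \<Rightarrow> int" where
  "aval (Const z) s = z"
| "aval (Var x) s = var s x"
| "aval (Elem a e) s = arr s a (aval e s)"
| "aval (Plus e1 e2) s = aval e1 s + aval e2 s"
| "aval (Minus e1 e2) s = aval e1 s - aval e2 s"
| "aval (Times e1 e2) s = aval e1 s * aval e2 s"
| "aval (Div e1 e2) s = aval e1 s div aval e2 s"
| "aval (Mod e1 e2) s = aval e1 s mod aval e2 s"

primrec acost :: "aexp \<Rightarrow> state \<Rightarrow> nat" where
  "acost (Const z) s = bits z"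
| "acost (Var x) s = bits (var s x)"
| "acost (Elem a e) s = acost e s + bits (aval (Elem a e) s)"
| "acost (Plus e1 e2) s = acost e1 s + acost e2 s + bits (aval (Plus e1 e2) s)"
| "acost (Minus e1 e2) s = acost e1 s + acost e2 s + bits (aval (Minus e1 e2) s)"
| "acost (Times e1 e2) s = acost e1 s + acost e2 s + bits (aval (Times e1 e2) s)"
| "acost (Div e1 e2) s = acost e1 s + acost e2 s + bits (aval (Div e1 e2) s)"
| "acost (Mod e1 e2) s = acost e1 s + acost e2 s + bits (aval (Mod e1 e2) s)"

datatype bexp = Less aexp aexp | Neg bexp | Conj bexp bexp

primrec bval :: "bexp \<Rightarrow> state \<Rightarrow> bool" where
  "bval (Less e1 e2) s = (aval e1 s < aval e2 s)"
| "bval (Neg b) s = (\<not> bval b s)"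
| "bval (Conj b1 b2) s = (bval b1 s \<and> bval b2 s)"

primrec bcost :: "bexp \<Rightarrow> state \<Rightarrow> nat" where
  "bcost (Less e1 e2) s = 1 + acost e1 s + acost e2 s"
| "bcost (Neg b) s = 1 + bcost b s"
| "bcost (Conj b1 b2) s = 1 + bcost b1 s + bcost b2 s"

text \<open>
  \<open>Call c b e a\<close> runs \<open>c\<close> as a subroutine with its own, initially zero, variables and arrays;
  its input consists of the first \<open>e\<close> cells of the array \<open>b\<close>, and its output is copied to
  the array \<open>a\<close>. As programs are finite terms, there is no recursion. \<open>Query b e a\<close> is the same for
  the oracle.
\<close>

datatype com =
    Skip
  | Assign vname aexp
  | Store vname aexp aexp
  | Seq com com
  | Cond bexp com com
  | While bexp com
  | Call com vname aexp vname
  | Query vname aexp vname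

primrec oracle_free :: "com \<Rightarrow> bool" where
  "oracle_free Skip = True"
| "oracle_free (Assign x e) = True"
| "oracle_free (Store a i e) = True"
| "oracle_free (Seq c1 c2) = (oracle_free c1 \<and> oracle_free c2)"
| "oracle_free (Cond b c1 c2) = (oracle_free c1 \<and> oracle_free c2)"
| "oracle_free (While b c) = oracle_free c"
| "oracle_free (Call c b e a) = oracle_free c"
| "oracle_free (Query b e a) = False"

definition load :: "vname \<Rightarrow> int list \<Rightarrow> state \<Rightarrow> state" where
  "load a xs s = s\<lparr>arr := (arr s)
     (a := (\<lambda>i. if 0 \<le> i \<and> i < int (length xs) then xs ! nat i else arr s a i))\<rparr>"

definition read :: "vname \<Rightarrow> int \<Rightarrow> state \<Rightarrow> int list" where
  "read a k s = map (\<lambda>i. arr s a (int i)) [0..<nat k]"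

definition initial :: "int list \<Rightarrow> state" where
  "initial xs = load ''in'' xs
     \<lparr>var = (\<lambda>_. 0)(''len'' := int (length xs)), arr = (\<lambda>_ _. 0)\<rparr>"

definition result :: "state \<Rightarrow> int list" where
  "result s = read ''out'' (var s ''len'') s"

text \<open>
  \<open>exec Q c s s' t qs\<close>: with the oracle \<open>Q\<close>, program \<open>c\<close> started in \<open>s\<close> halts in \<open>s'\<close>
  after time \<open>t\<close>, having asked the oracle the queries \<open>qs\<close>. A query is charged for its length and
  for the length of the answer, but not for the work of the oracle.
\<close>

inductive exec ::
  "(int list \<Rightarrow> int list) \<Rightarrow> com \<Rightarrow> state \<Rightarrow> state \<Rightarrow> nat \<Rightarrow> int list list \<Rightarrow> bool"
  for Q :: "int list \<Rightarrow> int list" where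
  Skip: "exec Q Skip s s 1 []"
| Assign: "exec Q (Assign x e) s (s\<lparr>var := (var s)(x := aval e s)\<rparr>) (1 + acost e s) []"
| Store: "exec Q (Store a i e) s
     (s\<lparr>arr := (arr s)(a := (arr s a)(aval i s := aval e s))\<rparr>) (1 + acost i s + acost e s) []"
| Seq: "exec Q c1 s s1 t1 qs1 \<Longrightarrow> exec Q c2 s1 s2 t2 qs2 \<Longrightarrow>
     exec Q (Seq c1 c2) s s2 (t1 + t2) (qs1 @ qs2)"
| CondTrue: "bval b s \<Longrightarrow> exec Q c1 s s' t qs \<Longrightarrow> exec Q (Cond b c1 c2) s s' (bcost b s + t) qs"
| CondFalse: "\<not> bval b s \<Longrightarrow> exec Q c2 s s' t qs \<Longrightarrow> exec Q (Cond b c1 c2) s s' (bcost b s + t) qs"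
| WhileFalse: "\<not> bval b s \<Longrightarrow> exec Q (While b c) s s (bcost b s) []"
| WhileTrue: "bval b s \<Longrightarrow> exec Q c s s1 t1 qs1 \<Longrightarrow> exec Q (While b c) s1 s2 t2 qs2 \<Longrightarrow>
     exec Q (While b c) s s2 (bcost b s + t1 + t2) (qs1 @ qs2)"
| Call: "xs = read b (aval e s) s \<Longrightarrow> exec Q c (initial xs) s1 t qs \<Longrightarrow> ys = result s1 \<Longrightarrow>
     exec Q (Call c b e a) s (load a ys s) (1 + acost e s + list_bits xs + t + list_bits ys) qs"
| Query: "xs = read b (aval e s) s \<Longrightarrow> ys = Q xs \<Longrightarrow>
     exec Q (Query b e a) s (load a ys s) (1 + acost e s + list_bits xs + list_bits ys) [xs]"

text \<open>Execution is deterministic, so running time and queries are well defined.\<close>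

inductive_cases SkipE: "exec Q Skip s s' t qs"
inductive_cases AssignE: "exec Q (Assign x e) s s' t qs"
inductive_cases StoreE: "exec Q (Store a i e) s s' t qs"
inductive_cases SeqE: "exec Q (Seq c1 c2) s s' t qs"
inductive_cases CondE: "exec Q (Cond b c1 c2) s s' t qs"
inductive_cases WhileE: "exec Q (While b c) s s' t qs"
inductive_cases CallE: "exec Q (Call c b e a) s s' t qs"
inductive_cases QueryE: "exec Q (Query b e a) s s' t qs"

lemma exec_deterministic:
  "exec Q c s s1 t1 qs1 \<Longrightarrow> exec Q c s s2 t2 qs2 \<Longrightarrow> s1 = s2 \<and> t1 = t2 \<and> qs1 = qs2"
proof (induction arbitrary: s2 t2 qs2 rule: exec.induct)
  case (Skip s)
  then show ?case by (elim SkipE) simp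
next
  case (Assign x e s)
  then show ?case by (elim AssignE) simp
next
  case (Store a i e s)
  then show ?case by (elim StoreE) simp
next
  case (Seq c1 s s1 t1 qs1 c2 s' t' qs')
  from Seq.prems obtain r u p u' p' where
    "exec Q c1 s r u p" "exec Q c2 r s2 u' p'" "t2 = u + u'" "qs2 = p @ p'"
    by (rule SeqE)
  with Seq.IH(1)[of r u p] Seq.IH(2)[of s2 u' p'] show ?case by simp
next
  case (CondTrue b s c1 s' t qs c2)
  from CondTrue.prems show ?case
  proof (rule CondE)
    fix u assume "t2 = bcost b s + u" "exec Q c1 s s2 u qs2"
    with CondTrue.IH[of s2 u qs2] show ?thesis by simp
  qed (use CondTrue.hyps(1) in contradiction)
next
  case (CondFalse b s c2 s' t qs c1)
  from CondFalse.prems show ?case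
  proof (rule CondE)
    fix u assume "t2 = bcost b s + u" "exec Q c2 s s2 u qs2"
    with CondFalse.IH[of s2 u qs2] show ?thesis by simp
  qed (use CondFalse.hyps(1) in contradiction)
next
  case (WhileFalse b s c)
  from WhileFalse.prems show ?case
  proof (rule WhileE)
    assume "s2 = s" "t2 = bcost b s" "qs2 = []"
    then show ?thesis by simp
  qed (use WhileFalse.hyps in contradiction)
next
  case (WhileTrue b s c s1 t1 qs1 s' t' qs')
  from WhileTrue.prems show ?case
  proof (rule WhileE)
    fix r u p u' p'
    assume "exec Q c s r u p" "exec Q (While b c) r s2 u' p'"
      "t2 = bcost b s + u + u'" "qs2 = p @ p'"
    with WhileTrue.IH(1)[of r u p] WhileTrue.IH(2)[of s2 u' p'] show ?thesis by simp
  qed (use WhileTrue.hyps(1) in contradiction)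
next
  case (Call xs b e s c s1 t qs ys a)
  from Call.prems show ?case
  proof (rule CallE)
    fix r u
    assume "exec Q c (initial (read b (aval e s) s)) r u qs2" "s2 = load a (result r) s"
      "t2 = Suc (acost e s + list_bits (read b (aval e s) s) + u + list_bits (result r))"
    with Call.IH[of r u qs2] Call.hyps(1,3) show ?thesis by simp
  qed
next
  case (Query xs b e s ys a)
  from Query.prems show ?case
    by (rule QueryE) (simp add: Query.hyps)
qed

definition computes ::
  "(int list \<Rightarrow> int list) \<Rightarrow> com \<Rightarrow> int list \<Rightarrow> int list \<Rightarrow> nat \<Rightarrow> int list list \<Rightarrow> bool" where
  "computes Q c xs ys t qs \<longleftrightarrow> (\<exists>s. exec Q c (initial xs) s t qs \<and> ys = result s)"


section \<open>Truly subcubic algorithms and subcubic reductions\<close>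

text \<open>
  A problem on graphs with integer lengths. An instance has two size parameters: the number \<open>n\<close>
  of nodes and the bound \<open>M\<close> on the lengths. There may be several correct answers.
\<close>

record 'x problem =
  instances :: "'x set"
  encode :: "'x \<Rightarrow> int list"
  nodes :: "'x \<Rightarrow> nat"
  max_len :: "'x \<Rightarrow> nat"
  solution :: "'x \<Rightarrow> int list \<Rightarrow> bool"

definition cost_bound :: "('x, 'z) problem_scheme \<Rightarrow> real \<Rightarrow> nat \<Rightarrow> 'x \<Rightarrow> real" where
  "cost_bound P \<alpha> k x = real (nodes P x) powr \<alpha> * (1 + log 2 (real (max_len P x))) ^ k"

definition has_truly_subcubic_algorithm :: "'x problem \<Rightarrow> bool" where
  "has_truly_subcubic_algorithm P \<longleftrightarrow>
     (\<exists>c. oracle_free c \<and> (\<exists>\<delta>>0. \<exists>C k. \<forall>x\<in>instances P.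
        \<exists>ys t. computes (\<lambda>_. []) c (encode P x) ys t [] \<and> solution P x ys \<and>
               real t \<le> C * cost_bound P (3 - \<delta>) k x))"

definition oracle_for :: "'y problem \<Rightarrow> (int list \<Rightarrow> int list) \<Rightarrow> bool" where
  "oracle_for B Q \<longleftrightarrow> (\<forall>y\<in>instances B. solution B y (Q (encode B y)))"

text \<open>
  The definition of Vassilevska Williams and Williams: one oracle program such that for all
  \<open>\<epsilon> > 0\<close> there is \<open>\<delta> > 0\<close> such that the program runs in time \<open>O(n\<^sup>3\<^sup>-\<^sup>\<delta>)\<close> and the sizes \<open>n\<^sub>i\<close>
  of its queries satisfy \<open>(\<Sum>i. n\<^sub>i\<^sup>3\<^sup>-\<^sup>\<epsilon>) = O(n\<^sup>3\<^sup>-\<^sup>\<delta>)\<close>. To account for the polylogarithmic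
  dependence on the lengths, both right-hand sides carry a factor \<open>polylog M\<close>, and the \<open>i\<close>-th
  summand a factor \<open>(1 + log M\<^sub>i)\<^sup>k\<close> where \<open>k\<close> is arbitrary.
\<close>

definition subcubic_reducible :: "'x problem \<Rightarrow> 'y problem \<Rightarrow> bool" where
  "subcubic_reducible A B \<longleftrightarrow>
     (\<exists>c. \<forall>\<epsilon>>0. \<exists>\<delta>>0. \<forall>k. \<exists>C k'. \<forall>Q. oracle_for B Q \<longrightarrow>
        (\<forall>x\<in>instances A. \<exists>ys t qs.
           set qs \<subseteq> instances B \<and>
           computes Q c (encode A x) ys t (map (encode B) qs) \<and> solution A x ys \<and>
           real t \<le> C * cost_bound A (3 - \<delta>) k' x \<and>
           (\<Sum>q\<leftarrow>qs. cost_bound B (3 - \<epsilon>) k q) \<le> C * cost_bound A (3 - \<delta>) k' x))"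

definition subcubic_equivalent :: "'x problem \<Rightarrow> 'y problem \<Rightarrow> bool" where
  "subcubic_equivalent A B \<longleftrightarrow> subcubic_reducible A B \<and> subcubic_reducible B A"


section \<open>Graphs with positive integer lengths\<close>

record lgraph =
  graph :: "nat pair_pre_digraph"
  len :: "nat \<times> nat \<Rightarrow> nat"

datatype kind = Directed | Undirected

definition lgraphs :: "kind \<Rightarrow> lgraph set" where
  "lgraphs \<kappa> = {G. pair_fin_digraph (graph G) \<and>
     (\<exists>n\<ge>1. pverts (graph G) = {..<n}) \<and>
     (\<forall>e\<in>parcs (graph G). len G e > 0) \<and>
     (\<kappa> = Undirected \<longrightarrow> symmetric (with_proj (graph G)) \<and>
        (\<forall>(i, j)\<in>parcs (graph G). len G (j, i) = len G (i, j)))}"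

abbreviation node_count :: "lgraph \<Rightarrow> nat" where
  "node_count G \<equiv> card (pverts (graph G))"

definition length_bound :: "lgraph \<Rightarrow> nat" where
  "length_bound G = Max (insert 1 (len G ` parcs (graph G)))"

text \<open>The distance is \<open>\<infinity>\<close> if there is no walk.\<close>

definition distance :: "lgraph \<Rightarrow> nat \<Rightarrow> nat \<Rightarrow> ereal" where
  "distance G i j = wf_digraph.\<mu> (with_proj (graph G)) (\<lambda>e. real (len G e)) i j"

text \<open>Adjacency matrix, row by row; as lengths are positive, \<open>0\<close> can stand for a missing edge.\<close>

definition encode_graph :: "lgraph \<Rightarrow> int list" where
  "encode_graph G = int (node_count G) #
     concat (map (\<lambda>i. map (\<lambda>j. if (i, j) \<in> parcs (graph G) then int (len G (i, j)) else 0)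
       [0..<node_count G]) [0..<node_count G])"


section \<open>All-pairs shortest paths\<close>

definition codes_distance :: "int \<Rightarrow> ereal \<Rightarrow> bool" where
  "codes_distance z d \<longleftrightarrow> (if d = \<infinity> then z = -1 else ereal (real_of_int z) = d)"

definition APSP :: "kind \<Rightarrow> lgraph problem" where
  "APSP \<kappa> = \<lparr>instances = lgraphs \<kappa>,
     encode = encode_graph,
     nodes = node_count,
     max_len = length_bound,
     solution = (\<lambda>G ys. length ys = node_count G * node_count G \<and>
       (\<forall>i<node_count G. \<forall>j<node_count G.
          codes_distance (ys ! (i * node_count G + j)) (distance G i j)))\<rparr>"


section \<open>Reverse ranks from a single source\<close>

text \<open>
  The admissible ranks of \<open>j\<close> with respect to \<open>i\<close>, where \<open>i\<close> itself is never counted. For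
  \<open>i \<noteq> j\<close> they form an interval, which is a single number if there are no ties. The rank of \<open>i\<close>
  with respect to itself is the number of other rankees at distance at most \<open>0\<close>, i.e. \<open>0\<close>.
\<close>

definition is_rank :: "lgraph \<Rightarrow> nat set \<Rightarrow> nat \<Rightarrow> nat \<Rightarrow> nat \<Rightarrow> bool" where
  "is_rank G U i j r \<longleftrightarrow>
     (let lower = card {h \<in> U - {i}. distance G i h < distance G i j};
          upper = card {h \<in> U - {i}. distance G i h \<le> distance G i j}
      in if i = j then r = upper else 1 + lower \<le> r \<and> r \<le> upper)"

text \<open>An instance consists of a graph, the set of rankees and the rankee asked for.\<close>

definition reverse_rank_single_source :: "kind \<Rightarrow> (lgraph \<times> nat set \<times> nat) problem" where
  "reverse_rank_single_source \<kappa> =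
    \<lparr>instances = {(G, U, u). G \<in> lgraphs \<kappa> \<and> U \<subseteq> pverts (graph G) \<and> u \<in> U},
     encode = (\<lambda>(G, U, u). encode_graph G @
       map (\<lambda>i. if i \<in> U then 1 else 0) [0..<node_count G] @ [int u]),
     nodes = (\<lambda>(G, U, u). node_count G),
     max_len = (\<lambda>(G, U, u). length_bound G),
     solution = (\<lambda>(G, U, u) ys. length ys = node_count G \<and>
       (\<forall>i<node_count G. \<exists>r. ys ! i = int r \<and> is_rank G U i u r))\<rparr>"

end

theory Submission
  imports Defs
begin

text \<open>
  Reverse ranks reduce to APSP by one query and a scan over the distance matrix.

  For the converse, distances are computed by repeated min-plus squaring, and the entries of a
  min-plus square are found bit by bit. Deciding one bit of all entries amounts to marking all pairs
  \<open>(i, j)\<close> with \<open>a i k + a k j < c i j\<close> for some \<open>k\<close>, where \<open>c\<close> is a matrix of thresholds. The index set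
  is cut into blocks of size \<open>s\<close>, the cube root of \<open>n\<close>. For each triple of blocks a single query to the
  reverse rank oracle, on a graph with \<open>O(s)\<close> nodes, tells which rows \<open>i\<close> contain a pair to be marked, and
  only these rows are searched exhaustively. A pair is marked only once, so that the searches cost
  \<open>O(n\<^sup>2 s\<^sup>2)\<close> altogether, and the \<open>(n / s)\<^sup>3\<close> queries are subcubic in total if the oracle is.
\<close>

section \<open>Unit costs\<close>

text \<open>The reduction is a single program for all \<open>\<epsilon>\<close>, so the block size
  cannot depend on the exponent of the oracle. The cube root balances the two costs of the program
  itself: the searches take about \<open>n^2 s^2\<close> steps and writing the queries about
  \<open>(n / s)^3 s^2 = n^3 / s\<close>, both \<open>n^(8/3)\<close>. For an oracle of exponent
  \<open>3 - \<epsilon>\<close> the queries count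
  \<open>n^3 / s^\<epsilon> = n^(3 - \<epsilon>/3)\<close>. An answer consists of one rank per node,
  all for the same rankee. It thus carries one bit about each row \<open>i\<close> and cannot name
  the column of a pair, which is why rows have to be searched. With ties the oracle may return any
  admissible rank, so a useful query must place that bit beyond this freedom. Costs are logarithmic
  and the bounds grant powers of \<open>log M\<close> only. Hence infinity is represented by
  \<open>n M + 1\<close>, above all finite distances, every number stays polynomial in
  \<open>n\<close> and \<open>M\<close>, and all powers of \<open>log n\<close> have to be paid for
  with a part of the exponent saved.\<close>

lemma bits_mono: "\<bar>a\<bar> \<le> \<bar>b\<bar> \<Longrightarrow> bits a \<le> bits b"
  unfolding bits_def by (auto intro!: floorlog_mono)

lemma bits_pos: "0 < bits z" 
  by (simp add: bits_def)

text \<open>From \<open>m < 2 ^ floorlog 2 m\<close>. The \<open>max 1\<close> is for exponent 0,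
  where the power is 1 and has one bit.\<close>

lemma floorlog_power_le: "floorlog 2 (m ^ p) \<le> max 1 (p * floorlog 2 m)"
proof (cases "m = 0")
  case True
  then show ?thesis by (cases p) (auto simp: floorlog_def)
next
  case False
  have "m < 2 ^ floorlog 2 m"
    using floorlog_le_iff[of 2 m "floorlog 2 m"] by simp
  then have *: "m ^ p < (2 ^ floorlog 2 m) ^ p" if "p \<noteq> 0"
    using that by (intro power_strict_mono) auto
  show ?thesis
  proof (cases "p = 0")
    case True then show ?thesis by (simp add: floorlog_def)
  next
    case p: False
    have "floorlog 2 (m ^ p) \<le> p * floorlog 2 m"
      using *[OF p] by (subst floorlog_le_iff) (simp add: power_mult[symmetric] mult.commute)
    then show ?thesis by simp
  qed
qed

lemma bits_power_le:
  assumes "2 \<le> X" "1 \<le> p" shows "bits (X ^ p) \<le> p * bits X"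
proof -
  have "1 \<le> floorlog 2 (nat \<bar>X\<bar>)"
    using assms by (auto simp: floorlog_def)
  then have "1 * 1 \<le> p * floorlog 2 (nat \<bar>X\<bar>)"
    using assms by (intro mult_le_mono) auto
  then show ?thesis
    using floorlog_power_le[of "nat \<bar>X\<bar>" p] assms
    by (auto simp: bits_def power_abs nat_power_eq)
qed

primrec asize :: "aexp \<Rightarrow> nat" where
  "asize (Const z) = 1"
| "asize (Var x) = 1"
| "asize (Elem a e) = asize e + 1"
| "asize (Plus e1 e2) = asize e1 + asize e2 + 1"
| "asize (Minus e1 e2) = asize e1 + asize e2 + 1"
| "asize (Times e1 e2) = asize e1 + asize e2 + 1"
| "asize (Div e1 e2) = asize e1 + asize e2 + 1"
| "asize (Mod e1 e2) = asize e1 + asize e2 + 1"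

primrec bsize :: "bexp \<Rightarrow> nat" where
  "bsize (Less e1 e2) = asize e1 + asize e2 + 1"
| "bsize (Neg b) = bsize b + 1"
| "bsize (Conj b1 b2) = bsize b1 + bsize b2 + 1"

text \<open>16 is the largest constant occurring in either program, the factor of \<open>P\<close>
  in \<open>H\<close>; with \<open>16 \<le> X\<close> a constant is bounded like a variable.\<close>

primrec asmall :: "aexp \<Rightarrow> bool" where
  "asmall (Const z) = (\<bar>z\<bar> \<le> 16)"
| "asmall (Var x) = True"
| "asmall (Elem a e) = asmall e"
| "asmall (Plus e1 e2) = (asmall e1 \<and> asmall e2)"
| "asmall (Minus e1 e2) = (asmall e1 \<and> asmall e2)"
| "asmall (Times e1 e2) = (asmall e1 \<and> asmall e2)"
| "asmall (Div e1 e2) = (asmall e1 \<and> asmall e2)"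
| "asmall (Mod e1 e2) = (asmall e1 \<and> asmall e2)"

primrec bsmall :: "bexp \<Rightarrow> bool" where
  "bsmall (Less e1 e2) = (asmall e1 \<and> asmall e2)"
| "bsmall (Neg b) = bsmall b"
| "bsmall (Conj b1 b2) = (bsmall b1 \<and> bsmall b2)"

definition bounded :: "int \<Rightarrow> state \<Rightarrow> bool" where
  "bounded X s \<longleftrightarrow> (\<forall>x. \<bar>var s x\<bar> \<le> X) \<and> (\<forall>a i. \<bar>arr s a i\<bar> \<le> X)"

lemma bounded_var: "bounded X s \<Longrightarrow> \<bar>var s x\<bar> \<le> X"
  and bounded_arr: "bounded X s \<Longrightarrow> \<bar>arr s a i\<bar> \<le> X"
  by (auto simp: bounded_def)

lemma asize_pos: "1 \<le> asize e"
  by (induction e) auto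

text \<open>The \<open>+ 1\<close> that \<open>asize\<close> counts for an operator pays for the
  factor 2 in \<open>X ^ p + X ^ q \<le> 2 * X ^ (p + q)\<close>.\<close>

lemma add_le_power:
  fixes X :: int assumes "2 \<le> X" "1 \<le> p" "1 \<le> q" shows "X ^ p + X ^ q \<le> X ^ (p + q + 1)"
proof -
  have "X ^ p \<le> X ^ (p + q)" "X ^ q \<le> X ^ (p + q)"
    using assms by (auto intro!: power_increasing)
  then have "X ^ p + X ^ q \<le> 2 * X ^ (p + q)" by simp
  also have "\<dots> \<le> X * X ^ (p + q)" using assms by (intro mult_right_mono) auto
  finally show ?thesis by simp
qed

lemma abs_div_int_le: "\<bar>(a::int) div b\<bar> \<le> \<bar>a\<bar>"
proof -
  have pos: "\<bar>a div b\<bar> \<le> \<bar>a\<bar>" if "0 < b" for a b :: int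
  proof (cases "0 \<le> a")
    case True
    with that have "a div b \<le> a div 1" by (intro zdiv_mono2) auto
    with True that show ?thesis by (simp add: pos_imp_zdiv_nonneg_iff)
  next
    case False
    with that have "a div 1 \<le> a div b" by (intro zdiv_mono2_neg) auto
    moreover have "a div b < 0" using False that by (simp add: div_neg_pos_less0)
    ultimately show ?thesis by simp
  qed
  show ?thesis
    using pos[of b a] pos[of "-b" "-a"] by (cases "b = 0"; cases "0 < b") auto
qed

text \<open>For a nonzero divisor the remainder is bounded by the divisor;
  \<open>a mod 0 = a\<close> accounts for the summand \<open>\<bar>a\<bar>\<close>.\<close>

lemma abs_mod_int_le: "\<bar>(a::int) mod b\<bar> \<le> \<bar>a\<bar> + \<bar>b\<bar>"
proof (cases b "0::int" rule: linorder_cases)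
  case less
  then show ?thesis using neg_mod_bound[of b a] neg_mod_sign[of b a] by linarith
next
  case greater
  then show ?thesis using pos_mod_bound[of b a] pos_mod_sign[of b a] by linarith
qed simp

text \<open>Every node of the expression contributes at most one factor \<open>X\<close>. An array
  access falls back to \<open>X\<close> itself, since contents are bounded whatever the
  index.\<close>

lemma aval_bound:
  assumes X: "16 \<le> X" and b: "bounded X s"
  shows "asmall e \<Longrightarrow> \<bar>aval e s\<bar> \<le> X ^ asize e"
proof (induction e)
  case (Elem a e)
  have "\<bar>arr s a (aval e s)\<bar> \<le> X ^ 1" using b by (simp add: bounded_def)
  also have "\<dots> \<le> X ^ (asize e + 1)" using X by (intro power_increasing) auto
  finally show ?case by simp
next
  case (Plus e1 e2)
  then show ?case using add_le_power[of X "asize e1" "asize e2"] asize_pos[of e1] asize_pos[of e2] X by simp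
next
  case (Minus e1 e2)
  then show ?case using add_le_power[of X "asize e1" "asize e2"] asize_pos[of e1] asize_pos[of e2] X by simp
next
  case (Times e1 e2)
  have "\<bar>aval e1 s * aval e2 s\<bar> \<le> X ^ asize e1 * X ^ asize e2"
    using Times X by (auto simp: abs_mult intro!: mult_mono)
  also have "\<dots> \<le> X ^ (asize e1 + asize e2 + 1)"
    using X unfolding power_add[symmetric] by (intro power_increasing) auto
  finally show ?case by simp
next
  case (Div e1 e2)
  have "\<bar>aval e1 s div aval e2 s\<bar> \<le> X ^ asize e1"
    using Div abs_div_int_le[of "aval e1 s" "aval e2 s"] by simp
  also have "\<dots> \<le> X ^ (asize e1 + asize e2 + 1)"
    using X by (intro power_increasing) auto
  finally show ?case by simp
next
  case (Mod e1 e2)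
  then show ?case using add_le_power[of X "asize e1" "asize e2"] asize_pos[of e1] asize_pos[of e2] X 
    abs_mod_int_le[of "aval e1 s" "aval e2 s"] by simp
qed (use X b in \<open>auto simp: bounded_def\<close>)

lemma sum_sq_le: "(a::nat) * a * B + b * b * B + (a + b + 1) * B \<le> (a + b + 1) * (a + b + 1) * B"
  by (simp add: algebra_simps)

lemma bits_aval:
  assumes X: "16 \<le> X" and b: "bounded X s" and "asmall e"
  shows "bits (aval e s) \<le> asize e * bits X"
proof -
  have "bits (aval e s) \<le> bits (X ^ asize e)"
    using aval_bound[OF assms] by (intro bits_mono) auto
  also have "\<dots> \<le> asize e * bits X" using X by (intro bits_power_le asize_pos) auto
  finally show ?thesis .
qed

text \<open>At most \<open>asize e\<close> nodes are evaluated, and each is charged the bit length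
  of its value, at most \<open>asize e * bits X\<close>; hence the square.\<close>

lemma acost_bound:
  assumes X: "16 \<le> X" and b: "bounded X s"
  shows "asmall e \<Longrightarrow> acost e s \<le> asize e * asize e * bits X"
proof (induction e)
  case (Elem a e)
  then show ?case using bits_aval[OF X b, of "Elem a e"] by (simp add: algebra_simps)
next
  case (Plus e1 e2)
  then show ?case using bits_aval[OF X b, of "Plus e1 e2"] sum_sq_le[of "asize e1" "bits X" "asize e2"] by simp
next
  case (Minus e1 e2)
  then show ?case using bits_aval[OF X b, of "Minus e1 e2"] sum_sq_le[of "asize e1" "bits X" "asize e2"] by simp
next
  case (Times e1 e2)
  then show ?case using bits_aval[OF X b, of "Times e1 e2"] sum_sq_le[of "asize e1" "bits X" "asize e2"] by simp
next
  case (Div e1 e2)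
  then show ?case using bits_aval[OF X b, of "Div e1 e2"] sum_sq_le[of "asize e1" "bits X" "asize e2"] by simp
next
  case (Mod e1 e2)
  then show ?case using bits_aval[OF X b, of "Mod e1 e2"] sum_sq_le[of "asize e1" "bits X" "asize e2"] by simp
qed (use bits_aval[OF X b, of "Const _"] bits_aval[OF X b, of "Var _"] in auto)

lemma bcost_bound:
  assumes X: "16 \<le> X" and b: "bounded X s"
  shows "bsmall e \<Longrightarrow> bcost e s \<le> bsize e * bsize e * bits X"
proof (induction e)
  case (Less e1 e2)
  have "bits X \<le> (asize e1 + asize e2 + 1) * bits X" by simp
  then have "1 \<le> (asize e1 + asize e2 + 1) * bits X" using bits_pos[of X] by linarith
  then show ?case
    using acost_bound[OF X b, of e1] acost_bound[OF X b, of e2] Less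
      sum_sq_le[of "asize e1" "bits X" "asize e2"] by simp
next
  case (Neg e)
  then have "Suc (bcost e s) \<le> bits X + bsize e * bsize e * bits X" using bits_pos[of X] by simp
  then show ?case by (simp add: algebra_simps)
next
  case (Conj e1 e2)
  have "bits X \<le> (bsize e1 + bsize e2 + 1) * bits X" by simp
  then have "1 \<le> (bsize e1 + bsize e2 + 1) * bits X" using bits_pos[of X] by linarith
  with Conj sum_sq_le[of "bsize e1" "bits X" "bsize e2"] show ?case by simp
qed

text \<open>Charging every basic command this much, independently of the state, turns running times into
  step counts. The constant is tied to the bound 50 on the size of expressions.\<close>

definition unit_cost :: "int \<Rightarrow> nat" where
  "unit_cost X = 5001 * bits X"

lemma unit_cost_aexp:
  assumes "16 \<le> X" "bounded X s" "asmall e" "asize e \<le> 50"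
  shows "acost e s \<le> 2500 * bits X"
proof -
  have "asize e * asize e * bits X \<le> 50 * 50 * bits X"
    using assms by (intro mult_le_mono) auto
  with acost_bound[OF assms(1-3)] show ?thesis by linarith
qed

lemma unit_cost_bexp:
  assumes "16 \<le> X" "bounded X s" "bsmall e" "bsize e \<le> 50"
  shows "bcost e s \<le> unit_cost X"
proof -
  have "bsize e * bsize e * bits X \<le> 50 * 50 * bits X"
    using assms by (intro mult_le_mono) auto
  with bcost_bound[OF assms(1-3)] show ?thesis unfolding unit_cost_def by linarith
qed

section \<open>Weakest preconditions\<close>

primrec mod_vars :: "com \<Rightarrow> vname set" where
  "mod_vars Skip = {}"
| "mod_vars (Assign x e) = {x}"
| "mod_vars (Store a i e) = {}"
| "mod_vars (Seq c1 c2) = mod_vars c1 \<union> mod_vars c2"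
| "mod_vars (Cond b c1 c2) = mod_vars c1 \<union> mod_vars c2"
| "mod_vars (While b c) = mod_vars c"
| "mod_vars (Call c b e a) = {}"
| "mod_vars (Query b e a) = {}"

primrec mod_arrs :: "com \<Rightarrow> vname set" where
  "mod_arrs Skip = {}"
| "mod_arrs (Assign x e) = {}"
| "mod_arrs (Store a i e) = {a}"
| "mod_arrs (Seq c1 c2) = mod_arrs c1 \<union> mod_arrs c2"
| "mod_arrs (Cond b c1 c2) = mod_arrs c1 \<union> mod_arrs c2"
| "mod_arrs (While b c) = mod_arrs c"
| "mod_arrs (Call c b e a) = {a}"
| "mod_arrs (Query b e a) = {a}"

definition agree :: "vname set \<Rightarrow> vname set \<Rightarrow> state \<Rightarrow> state \<Rightarrow> bool" where
  "agree V A s s' \<longleftrightarrow> (\<forall>x. x \<notin> V \<longrightarrow> var s' x = var s x) \<and> (\<forall>a. a \<notin> A \<longrightarrow> arr s' a = arr s a)"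

lemma agree_var: "agree V A s s' \<Longrightarrow> x \<notin> V \<Longrightarrow> var s' x = var s x"
  and agree_arr: "agree V A s s' \<Longrightarrow> a \<notin> A \<Longrightarrow> arr s' a = arr s a"
  by (auto simp: agree_def)

lemma agree_refl [simp]: "agree V A s s"
  by (simp add: agree_def)

lemma agree_trans: "agree V A s s' \<Longrightarrow> agree V A s' s'' \<Longrightarrow> agree V A s s''"
  by (simp add: agree_def)

lemma agree_mono: "agree V A s s' \<Longrightarrow> V \<subseteq> V' \<Longrightarrow> A \<subseteq> A' \<Longrightarrow> agree V' A' s s'"
  unfolding agree_def by blast

lemma exec_agree: "exec Q c s s' t qs \<Longrightarrow> agree (mod_vars c) (mod_arrs c) s s'"
  by (induction rule: exec.induct) (auto simp: agree_def load_def)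

locale bounded_machine =
  fixes X :: int and Q :: "int list \<Rightarrow> int list"
  assumes X_ge: "16 \<le> X"
begin

text \<open>The postcondition speaks about the total of units and queries since the start of the whole
  program, so that amortised bounds can be stated as loop invariants.\<close>

definition wp :: "com \<Rightarrow> state \<Rightarrow> nat \<Rightarrow> int list list \<Rightarrow>
    (state \<Rightarrow> nat \<Rightarrow> int list list \<Rightarrow> bool) \<Rightarrow> bool" where
  "wp c s t qs R \<longleftrightarrow> (bounded X s \<longrightarrow> (\<exists>s' t' qs' u. exec Q c s s' t' qs' \<and> t' \<le> unit_cost X * u \<and>
     bounded X s' \<and> R s' (t + u) (qs @ qs')))"

text \<open>A postcondition can leave out everything that the program text does not touch: the frame
  given by \<open>mod_vars\<close> and \<open>mod_arrs\<close> is added here once and for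
  all.\<close>

lemma wp_frame:
  assumes "wp c s t qs R"
  shows "wp c s t qs (\<lambda>s' t' qs'. R s' t' qs' \<and> agree (mod_vars c) (mod_arrs c) s s' \<and> bounded X s')"
  using assms exec_agree unfolding wp_def by blast

lemma wp_conseq:
  assumes "wp c s t qs R" and "\<And>s' t' qs'. R s' t' qs' \<Longrightarrow> agree (mod_vars c) (mod_arrs c) s s' \<Longrightarrow>
     bounded X s' \<Longrightarrow> R' s' t' qs'"
  shows "wp c s t qs R'"
  using wp_frame[OF assms(1)] assms(2) unfolding wp_def by blast

lemma wpE:
  assumes "wp c s 0 [] R" "bounded X s"
  obtains s' t u qs where "exec Q c s s' t qs" "t \<le> unit_cost X * u" "R s' u qs"
  using assms unfolding wp_def by auto

text \<open>In an unbounded state \<open>wp\<close> holds vacuously, so boundedness may be assumed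
  at any point of a proof without being carried through invariants.\<close>

lemma wp_bounded: "(bounded X s \<Longrightarrow> wp c s t qs R) \<Longrightarrow> wp c s t qs R"
  by (auto simp: wp_def)

lemma unit_cost_pos: "1 \<le> unit_cost X"
  using bits_pos[of X] by (simp add: unit_cost_def)

lemma wp_Skip: "R s (t + 1) qs \<Longrightarrow> wp Skip s t qs R"
  unfolding wp_def using unit_cost_pos by (force intro!: exI[of _ 1] intro: exec.Skip)

lemma wp_Assign:
  assumes "asmall e" "asize e \<le> 50" "bounded X s \<Longrightarrow> \<bar>aval e s\<bar> \<le> X"
    and "R (s\<lparr>var := (var s)(x := aval e s)\<rparr>) (t + 1) qs"
  shows "wp (Assign x e) s t qs R"
  unfolding wp_def
proof (intro impI exI conjI)
  assume b: "bounded X s"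
  show "exec Q (Assign x e) s (s\<lparr>var := (var s)(x := aval e s)\<rparr>) (1 + acost e s) []"
    by (rule exec.Assign)
  show "1 + acost e s \<le> unit_cost X * 1"
    using unit_cost_aexp[OF X_ge b assms(1,2)] bits_pos[of X] by (simp add: unit_cost_def)
qed (use assms(3,4) in \<open>auto simp: bounded_def\<close>)

text \<open>No bound on the new value has to be checked, because it already sits in a cell of a
  bounded state.\<close>

lemma wp_Assign_Elem:
  assumes "asmall e" "asize e \<le> 49"
    and "R (s\<lparr>var := (var s)(x := arr s a (aval e s))\<rparr>) (t + 1) qs"
  shows "wp (Assign x (Elem a e)) s t qs R"
  using assms by (intro wp_Assign) (auto simp: bounded_def)

lemma wp_Assign_val:
  assumes "asmall e" "asize e \<le> 50" "aval e s = v" "\<bar>v\<bar> \<le> X"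
    and "R (s\<lparr>var := (var s)(x := v)\<rparr>) (t + 1) qs"
  shows "wp (Assign x e) s t qs R"
  using assms by (intro wp_Assign) auto

lemma wp_Store:
  assumes "asmall i" "asize i \<le> 50" "asmall e" "asize e \<le> 50" "bounded X s \<Longrightarrow> \<bar>aval e s\<bar> \<le> X"
    and "R (s\<lparr>arr := (arr s)(a := (arr s a)(aval i s := aval e s))\<rparr>) (t + 1) qs"
  shows "wp (Store a i e) s t qs R"
  unfolding wp_def
proof (intro impI exI conjI)
  assume b: "bounded X s"
  show "exec Q (Store a i e) s (s\<lparr>arr := (arr s)(a := (arr s a)(aval i s := aval e s))\<rparr>)
      (1 + acost i s + acost e s) []"
    by (rule exec.Store)
  \<comment> \<open>Two expressions of size at most 50 are evaluated, which explains
    \<open>5001 = 2 * 50 ^ 2 + 1\<close>.\<close>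
  show "1 + acost i s + acost e s \<le> unit_cost X * 1"
    using unit_cost_aexp[OF X_ge b assms(1,2)] unit_cost_aexp[OF X_ge b assms(3,4)] bits_pos[of X]
    by (simp add: unit_cost_def)
qed (use assms(5,6) in \<open>auto simp: bounded_def\<close>)

lemma wp_Seq:
  assumes "wp c1 s t qs (\<lambda>s t qs. wp c2 s t qs R)"
  shows "wp (Seq c1 c2) s t qs R"
  unfolding wp_def
proof
  assume "bounded X s"
  with assms obtain s1 t1 qs1 u1 where 1: "exec Q c1 s s1 t1 qs1" "t1 \<le> unit_cost X * u1"
    "bounded X s1" "wp c2 s1 (t + u1) (qs @ qs1) R"
    unfolding wp_def[of c1] by blast
  from 1(3,4) obtain s2 t2 qs2 u2 where 2: "exec Q c2 s1 s2 t2 qs2" "t2 \<le> unit_cost X * u2"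
    "bounded X s2" "R s2 (t + u1 + u2) ((qs @ qs1) @ qs2)"
    unfolding wp_def[of c2] by blast
  have "exec Q (Seq c1 c2) s s2 (t1 + t2) (qs1 @ qs2)"
    using 1 2 by (intro exec.Seq)
  moreover have "t1 + t2 \<le> unit_cost X * (u1 + u2)"
    using 1(2) 2(2) by (simp add: algebra_simps)
  ultimately show "\<exists>s' t' qs' u. exec Q (Seq c1 c2) s s' t' qs' \<and> t' \<le> unit_cost X * u \<and>
     bounded X s' \<and> R s' (t + u) (qs @ qs')"
    using 2(3,4) by (intro exI[of _ s2] exI[of _ "t1+t2"] exI[of _ "qs1 @ qs2"] exI[of _ "u1+u2"])
      (simp add: add.assoc)
qed

lemma wp_Cond:
  assumes "bsmall b" "bsize b \<le> 50"
    and "bval b s \<Longrightarrow> wp c1 s (t + 1) qs R" and "\<not> bval b s \<Longrightarrow> wp c2 s (t + 1) qs R"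
  shows "wp (Cond b c1 c2) s t qs R"
  unfolding wp_def
proof
  assume bd: "bounded X s"
  note b = unit_cost_bexp[OF X_ge bd assms(1,2)]
  show "\<exists>s' t' qs' u. exec Q (Cond b c1 c2) s s' t' qs' \<and> t' \<le> unit_cost X * u \<and>
     bounded X s' \<and> R s' (t + u) (qs @ qs')"
  proof (cases "bval b s")
    case True
    with assms(3) bd obtain s1 t1 qs1 u1 where 1: "exec Q c1 s s1 t1 qs1" "t1 \<le> unit_cost X * u1"
      "bounded X s1" "R s1 (t + 1 + u1) (qs @ qs1)"
      unfolding wp_def by blast
    with True b show ?thesis
      by (intro exI[of _ s1] exI[of _ "bcost b s + t1"] exI[of _ qs1] exI[of _ "1 + u1"])
        (auto intro: exec.CondTrue)
  next
    case False
    with assms(4) bd obtain s1 t1 qs1 u1 where 1: "exec Q c2 s s1 t1 qs1" "t1 \<le> unit_cost X * u1"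
      "bounded X s1" "R s1 (t + 1 + u1) (qs @ qs1)"
      unfolding wp_def by blast
    with False b show ?thesis
      by (intro exI[of _ s1] exI[of _ "bcost b s + t1"] exI[of _ qs1] exI[of _ "1 + u1"])
        (auto intro: exec.CondFalse)
  qed
qed

text \<open>The invariant describes the moment before a test, and each test costs one unit.
  Unchanged variables are available through \<open>agree\<close>, always relative to the state
  before the loop; \<open>f\<close> only serves termination, running times are part of
  \<open>I\<close>.\<close>

lemma wp_While:
  fixes f :: "state \<Rightarrow> nat"
  assumes b: "bsmall b" "bsize b \<le> 50" and init: "I s t qs"
    and body: "\<And>s' t' qs'. I s' t' qs' \<Longrightarrow> bval b s' \<Longrightarrow> bounded X s' \<Longrightarrow>
      agree (mod_vars c) (mod_arrs c) s s' \<Longrightarrow>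
      wp c s' (t' + 1) qs' (\<lambda>s'' t'' qs''. I s'' t'' qs'' \<and> f s'' < f s')"
    and exit: "\<And>s' t' qs'. I s' t' qs' \<Longrightarrow> \<not> bval b s' \<Longrightarrow> bounded X s' \<Longrightarrow>
      agree (mod_vars c) (mod_arrs c) s s' \<Longrightarrow> R s' (t' + 1) qs'"
  shows "wp (While b c) s t qs R"
proof -
  have "wp (While b c) s' t' qs' R" if "I s' t' qs'" "agree (mod_vars c) (mod_arrs c) s s'" for s' t' qs'
    using that
  proof (induction "f s'" arbitrary: s' t' qs' rule: less_induct)
    case less
    show ?case unfolding wp_def
    proof
      assume bd: "bounded X s'"
      note cost = unit_cost_bexp[OF X_ge bd b]
      show "\<exists>s'' t'' qs'' u. exec Q (While b c) s' s'' t'' qs'' \<and> t'' \<le> unit_cost X * u \<and>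
        bounded X s'' \<and> R s'' (t' + u) (qs' @ qs'')"
      proof (cases "bval b s'")
        case False
        with exit[OF less.prems(1) _ bd less.prems(2)] bd cost show ?thesis
          by (intro exI[of _ s'] exI[of _ "bcost b s'"] exI[of _ "[]"] exI[of _ 1])
            (auto intro: exec.WhileFalse)
      next
        case True
        from wp_frame[OF body[OF less.prems(1) True bd less.prems(2)]] bd
        obtain s1 t1 qs1 u1 where 1: "exec Q c s' s1 t1 qs1" "t1 \<le> unit_cost X * u1"
          "bounded X s1" "I s1 (t' + 1 + u1) (qs' @ qs1)" "f s1 < f s'"
          "agree (mod_vars c) (mod_arrs c) s' s1"
          unfolding wp_def by blast
        from less.hyps[OF 1(5,4) agree_trans[OF less.prems(2) 1(6)]] 1(3)
        obtain s2 t2 qs2 u2 where 2: "exec Q (While b c) s1 s2 t2 qs2" "t2 \<le> unit_cost X * u2"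
          "bounded X s2" "R s2 (t' + 1 + u1 + u2) ((qs' @ qs1) @ qs2)"
          unfolding wp_def by blast
        have "exec Q (While b c) s' s2 (bcost b s' + t1 + t2) (qs1 @ qs2)"
          using True 1(1) 2(1) by (rule exec.WhileTrue)
        moreover have "bcost b s' + t1 + t2 \<le> unit_cost X * (1 + u1 + u2)"
          using cost 1(2) 2(2) by (simp add: algebra_simps)
        ultimately show ?thesis
          using 2(3,4) by (intro exI[of _ s2] exI[of _ "bcost b s' + t1 + t2"] exI[of _ "qs1 @ qs2"]
              exI[of _ "1 + u1 + u2"]) (simp add: add.assoc)
      qed
    qed
  qed
  with init show ?thesis by simp
qed

lemma list_bits_le: "(\<And>x. x \<in> set xs \<Longrightarrow> \<bar>x\<bar> \<le> X) \<Longrightarrow> list_bits xs \<le> length xs * bits X"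
proof (induction xs)
  case (Cons x xs)
  have "bits x \<le> bits X" using Cons.prems[of x] by (intro bits_mono) auto
  with Cons show ?case by (simp add: list_bits_def)
qed (simp add: list_bits_def)

text \<open>The units charged are the two lengths and one more. The oracle enters only through the
  size of the numbers in its answer, which have to fit into a bounded state.\<close>

lemma wp_Query:
  assumes "asmall e" "asize e \<le> 50" "xs = read b (aval e s) s"
    and "\<And>y. y \<in> set (Q xs) \<Longrightarrow> \<bar>y\<bar> \<le> X"
    and "R (load a (Q xs) s) (t + 1 + length xs + length (Q xs)) (qs @ [xs])"
  shows "wp (Query b e a) s t qs R"
  unfolding wp_def
proof (intro impI exI conjI)
  assume bd: "bounded X s"
  show "exec Q (Query b e a) s (load a (Q xs) s) (1 + acost e s + list_bits xs + list_bits (Q xs)) [xs]"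
    by (rule exec.Query[OF assms(3) refl])
  have "\<bar>x\<bar> \<le> X" if "x \<in> set xs" for x
    using that assms(3) bd by (auto simp: read_def bounded_def)
  then have "list_bits xs \<le> length xs * bits X" "list_bits (Q xs) \<le> length (Q xs) * bits X"
    using assms(4) by (auto intro!: list_bits_le)
  moreover have "length xs * bits X \<le> length xs * unit_cost X" "length (Q xs) * bits X \<le> length (Q xs) * unit_cost X"
    by (auto intro!: mult_le_mono simp: unit_cost_def)
  ultimately have le: "list_bits xs \<le> length xs * unit_cost X" "list_bits (Q xs) \<le> length (Q xs) * unit_cost X"
    by linarith+
  have "unit_cost X * (1 + length xs + length (Q xs)) = unit_cost X + length xs * unit_cost X + length (Q xs) * unit_cost X"
    by (simp add: algebra_simps)
  then show "1 + acost e s + list_bits xs + list_bits (Q xs) \<le> unit_cost X * (1 + length xs + length (Q xs))"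
    using unit_cost_aexp[OF X_ge bd assms(1,2)] bits_pos[of X] le
    unfolding unit_cost_def by linarith
  show "bounded X (load a (Q xs) s)"
    using bd assms(4) by (auto simp: bounded_def load_def)
  show "R (load a (Q xs) s) (t + (1 + length xs + length (Q xs))) (qs @ [xs])"
    using assms(5) by (simp add: add.assoc)
qed

end

section \<open>Counting loops\<close>

definition For :: "vname \<Rightarrow> vname \<Rightarrow> com \<Rightarrow> com" where
  "For x y c = Seq (Assign x (Const 0)) (While (Less (Var x) (Var y)) (Seq c (Assign x (Plus (Var x) (Const 1)))))"

lemma mod_vars_For [simp]: "mod_vars (For x y c) = insert x (mod_vars c)"
  by (auto simp: For_def)

lemma mod_arrs_For [simp]: "mod_arrs (For x y c) = mod_arrs c"
  by (auto simp: For_def)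

context bounded_machine
begin

text \<open>Two units per round pay for the test and the increment, two more at the exit for the
  initial assignment and the last test. The increment is built into the invariant of the next round,
  so that the body is treated alone.\<close>

lemma wp_For:
  assumes x: "x \<noteq> y" "x \<notin> mod_vars c" "y \<notin> mod_vars c" and n: "n = var s y" "0 \<le> n"
    and init: "I 0 (s\<lparr>var := (var s)(x := 0)\<rparr>) t qs"
    and body: "\<And>k s' t' qs'. 0 \<le> k \<Longrightarrow> k < n \<Longrightarrow> var s' x = k \<Longrightarrow> bounded X s' \<Longrightarrow>
       agree (insert x (mod_vars c)) (mod_arrs c) s s' \<Longrightarrow> I k s' t' qs' \<Longrightarrow>
       wp c s' t' qs' (\<lambda>s'' t'' qs''. I (k + 1) (s''\<lparr>var := (var s'')(x := k + 1)\<rparr>) (t'' + 2) qs'')"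
    and exit: "\<And>s' t' qs'. var s' x = n \<Longrightarrow> bounded X s' \<Longrightarrow>
       agree (insert x (mod_vars c)) (mod_arrs c) s s' \<Longrightarrow> I n s' t' qs' \<Longrightarrow> R s' (t' + 2) qs'"
  shows "wp (For x y c) s t qs R"
proof (rule wp_bounded)
  assume bd: "bounded X s"
  let ?s0 = "s\<lparr>var := (var s)(x := 0)\<rparr>"
  let ?c = "Seq c (Assign x (Plus (Var x) (Const 1)))"
  \<comment> \<open>The clock of \<open>I\<close> lags one unit behind: the initial assignment is
    charged only at the exit.\<close>
  let ?I = "\<lambda>s t qs. 0 \<le> var s x \<and> var s x \<le> n \<and> (\<exists>t0. t = t0 + 1 \<and> I (var s x) s t0 qs)"
  have ag: "agree (insert x (mod_vars c)) (mod_arrs c) s s'"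
    if "agree (mod_vars ?c) (mod_arrs ?c) ?s0 s'" for s'
    using that by (auto simp: agree_def split: if_splits)
  have ny: "var s' y = n" if "agree (mod_vars ?c) (mod_arrs ?c) ?s0 s'" for s'
    using that x n by (auto simp: agree_def)
  have nX: "n \<le> X" using bd n by (auto simp: bounded_def intro: order_trans[OF abs_ge_self])
  show ?thesis
    unfolding For_def
  proof (intro wp_Seq wp_Assign)
    show "wp (While (Less (Var x) (Var y)) ?c) (s\<lparr>var := (var s)(x := aval (Const 0) s)\<rparr>) (t + 1) qs R"
    proof (rule wp_While[where I = ?I and f = "\<lambda>s. nat (n - var s x)"])
      fix s' t' qs'
      assume I: "?I s' t' qs'" and "bval (Less (Var x) (Var y)) s'" and bd': "bounded X s'"
        and "agree (mod_vars ?c) (mod_arrs ?c) (s\<lparr>var := (var s)(x := aval (Const 0) s)\<rparr>) s'"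
      then have a: "agree (mod_vars ?c) (mod_arrs ?c) ?s0 s'" and less: "var s' x < n"
        using ny by auto
      obtain t0 where t0: "t' = t0 + 1" "I (var s' x) s' t0 qs'" using I by blast
      have "wp c s' t0 qs' (\<lambda>s'' t'' qs''. I (var s' x + 1) (s''\<lparr>var := (var s'')(x := var s' x + 1)\<rparr>) (t'' + 2) qs'')"
        using I less t0 by (intro body bd' ag[OF a]) auto
      note * = wp_frame[OF this]
      \<comment> \<open>Only the clock differs from the fact just obtained, as
        \<open>t' = t0 + 1\<close>; the run itself is reused.\<close>
      have "wp c s' (t' + 1) qs' (\<lambda>s'' t'' qs''. I (var s' x + 1) (s''\<lparr>var := (var s'')(x := var s' x + 1)\<rparr>) t'' qs''
         \<and> agree (mod_vars c) (mod_arrs c) s' s'')"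
        unfolding wp_def
      proof
        assume "bounded X s'"
        with * obtain s1 t1 q1 u where 1: "exec Q c s' s1 t1 q1" "t1 \<le> unit_cost X * u" "bounded X s1"
          "I (var s' x + 1) (s1\<lparr>var := (var s1)(x := var s' x + 1)\<rparr>) (t0 + u + 2) (qs' @ q1)"
          "agree (mod_vars c) (mod_arrs c) s' s1"
          unfolding wp_def by blast
        have "t0 + u + 2 = t' + 1 + u" using t0 by simp
        with 1 show "\<exists>s'' t'' qs'' u. exec Q c s' s'' t'' qs'' \<and> t'' \<le> unit_cost X * u \<and> bounded X s'' \<and>
           I (var s' x + 1) (s''\<lparr>var := (var s'')(x := var s' x + 1)\<rparr>) (t' + 1 + u) (qs' @ qs'')
           \<and> agree (mod_vars c) (mod_arrs c) s' s''" by metis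
      qed
      then show "wp ?c s' (t' + 1) qs' (\<lambda>s'' t'' qs''. ?I s'' t'' qs'' \<and> nat (n - var s'' x) < nat (n - var s' x))"
        using x less I nX
        by (auto intro!: wp_Seq wp_Assign elim!: wp_conseq simp: agree_def)
    next
      fix s' t' qs'
      assume I: "?I s' t' qs'" and "\<not> bval (Less (Var x) (Var y)) s'" and bd': "bounded X s'"
        and "agree (mod_vars ?c) (mod_arrs ?c) (s\<lparr>var := (var s)(x := aval (Const 0) s)\<rparr>) s'"
      then have a: "agree (mod_vars ?c) (mod_arrs ?c) ?s0 s'" and eq: "var s' x = n"
        using ny[of s'] by auto
      then obtain t0 where t0: "t' = t0 + 1" "I n s' t0 qs'" using I by blast
      show "R s' (t' + 1) qs'"
        using exit[OF eq bd' ag[OF a] t0(2)] t0(1) by simp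
    qed (use init n in auto)
  qed (use X_ge in auto)
qed

text \<open>For loops that rewrite the cells of one array independently. In round \<open>k\<close>
  cell \<open>k\<close> still has its original content, so the update may be in place or may leave
  the cell alone. The arbitrary continuation \<open>R'\<close> lets the body be verified without
  mentioning the invariant.\<close>

lemma wp_pointwise:
  assumes c: "mod_arrs c \<subseteq> {a}" "x \<noteq> y" "x \<notin> mod_vars c" "y \<notin> mod_vars c" and n: "var st y = n" "0 \<le> n"
    and body: "\<And>k st1 t1 R'. 0 \<le> k \<Longrightarrow> k < n \<Longrightarrow> var st1 x = k \<Longrightarrow> bounded X st1 \<Longrightarrow>
      agree (insert x (mod_vars c)) {a} st st1 \<Longrightarrow> arr st1 a k = arr st a k \<Longrightarrow>
      (\<And>st2 t2. arr st2 a = (arr st1 a)(k := f k) \<Longrightarrow> t2 \<le> t1 + d \<Longrightarrow> R' st2 t2 qs) \<Longrightarrow> wp c st1 t1 qs R'"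
    and R: "\<And>st' t'. arr st' a = (\<lambda>z. if 0 \<le> z \<and> z < n then f z else arr st a z) \<Longrightarrow> var st' x = n \<Longrightarrow>
      agree (insert x (mod_vars c)) {a} st st' \<Longrightarrow> t' \<le> t + (d + 2) * nat n + 2 \<Longrightarrow> R st' t' qs"
  shows "wp (For x y c) st t qs R"
proof -
  let ?I = "\<lambda>k st' t' qs'. arr st' a = (\<lambda>z. if 0 \<le> z \<and> z < k then f z else arr st a z) \<and> qs' = qs \<and> t' \<le> t + (d + 2) * nat k"
  have ag: "agree (insert x (mod_vars c)) {a} st st'" if "agree (insert x (mod_vars c)) (mod_arrs c) st st'" for st'
    by (rule agree_mono[OF that subset_refl c(1)])
  show ?thesis
  proof (rule wp_For[where I = ?I, OF c(2-4) n(1)[symmetric] n(2)])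
    fix k st1 t1 qs1
    assume k: "0 \<le> k" "k < n" "var st1 x = k" and bd: "bounded X st1"
      and ag1: "agree (insert x (mod_vars c)) (mod_arrs c) st st1" and I: "?I k st1 t1 qs1"
    have "wp c st1 t1 qs (\<lambda>st2 t2 qs2. ?I (k + 1) (st2\<lparr>var := (var st2)(x := k + 1)\<rparr>) (t2 + 2) qs2)"
    proof (rule body[OF k bd ag[OF ag1]])
      show "arr st1 a k = arr st a k" using I by simp
      fix st2 t2
      assume st2: "arr st2 a = (arr st1 a)(k := f k)" "t2 \<le> t1 + d"
      have "arr st2 a = (\<lambda>z. if 0 \<le> z \<and> z < k + 1 then f z else arr st a z)"
        using I k(1) unfolding st2 by (auto simp: fun_eq_iff)
      moreover have "t2 + 2 \<le> t + (d + 2) * nat (k + 1)"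
        using I st2(2) k(1) by (simp add: nat_add_distrib)
      ultimately show "?I (k + 1) (st2\<lparr>var := (var st2)(x := k + 1)\<rparr>) (t2 + 2) qs" by simp
    qed
    then show "wp c st1 t1 qs1 (\<lambda>st2 t2 qs2. ?I (k + 1) (st2\<lparr>var := (var st2)(x := k + 1)\<rparr>) (t2 + 2) qs2)"
      using I by simp
  next
    fix st1 t1 qs1
    assume "var st1 x = n" "agree (insert x (mod_vars c)) (mod_arrs c) st st1" "?I n st1 t1 qs1"
    then show "R st1 (t1 + 2) qs1" using R[of st1 "t1 + 2"] ag by simp
  qed (auto simp: fun_eq_iff)
qed

end

section \<open>Transferring algorithms along reductions\<close>

text \<open>A call runs \<open>d\<close> on its own zero-initialised state, so no variable of
  \<open>d\<close> can clash with those of the calling program.\<close>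

primrec subst_oracle :: "com \<Rightarrow> com \<Rightarrow> com" where
  "subst_oracle d Skip = Skip"
| "subst_oracle d (Assign x e) = Assign x e"
| "subst_oracle d (Store a i e) = Store a i e"
| "subst_oracle d (Seq c1 c2) = Seq (subst_oracle d c1) (subst_oracle d c2)"
| "subst_oracle d (Cond b c1 c2) = Cond b (subst_oracle d c1) (subst_oracle d c2)"
| "subst_oracle d (While b c) = While b (subst_oracle d c)"
| "subst_oracle d (Call c b e a) = Call (subst_oracle d c) b e a"
| "subst_oracle d (Query b e a) = Call d b e a"

lemma oracle_free_subst_oracle: "oracle_free d \<Longrightarrow> oracle_free (subst_oracle d c)"
  by (induction c) auto

text \<open>\<open>Call\<close> and \<open>Query\<close> charge the same for copying input and
  output, so that replacing the oracle by \<open>d\<close> adds exactly the running times of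
  \<open>d\<close>.\<close>

lemma exec_subst_oracle:
  assumes "exec Q c s s' t qs"
    and "\<And>q. q \<in> set qs \<Longrightarrow> computes R d q (Q q) (\<tau> q) []"
  shows "exec R (subst_oracle d c) s s' (t + (\<Sum>q\<leftarrow>qs. \<tau> q)) []"
  using assms
proof (induction rule: exec.induct)
  case (Seq c1 s s1 t1 qs1 c2 s2 t2 qs2)
  have "exec R (Seq (subst_oracle d c1) (subst_oracle d c2)) s s2
      ((t1 + (\<Sum>q\<leftarrow>qs1. \<tau> q)) + (t2 + (\<Sum>q\<leftarrow>qs2. \<tau> q))) ([] @ [])"
    using Seq by (intro exec.Seq[of R _ s s1]) auto
  then show ?case by (simp add: ac_simps)
next
  case (CondTrue b s c1 s' t qs c2)
  have "exec R (Cond b (subst_oracle d c1) (subst_oracle d c2)) s s' (bcost b s + (t + (\<Sum>q\<leftarrow>qs. \<tau> q))) []"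
    using CondTrue by (intro exec.CondTrue) auto
  then show ?case by (simp add: ac_simps)
next
  case (CondFalse b s c2 s' t qs c1)
  have "exec R (Cond b (subst_oracle d c1) (subst_oracle d c2)) s s' (bcost b s + (t + (\<Sum>q\<leftarrow>qs. \<tau> q))) []"
    using CondFalse by (intro exec.CondFalse) auto
  then show ?case by (simp add: ac_simps)
next
  case (WhileTrue b s c s1 t1 qs1 s2 t2 qs2)
  have "exec R (While b (subst_oracle d c)) s s2
      (bcost b s + (t1 + (\<Sum>q\<leftarrow>qs1. \<tau> q)) + (t2 + (\<Sum>q\<leftarrow>qs2. \<tau> q))) ([] @ [])"
    using WhileTrue by (intro exec.WhileTrue[of b s R _ s1]) auto
  then show ?case by (simp add: ac_simps)
next
  case (Call xs b e s c s1 t qs ys a)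
  have "exec R (Call (subst_oracle d c) b e a) s (load a ys s)
      (1 + acost e s + list_bits xs + (t + (\<Sum>q\<leftarrow>qs. \<tau> q)) + list_bits ys) []"
    using Call by (intro exec.Call[of xs b e s R _ s1]) auto
  then show ?case by (simp add: ac_simps)
next
  case (Query xs b e s ys a)
  from Query(3)[of xs] obtain s1 where s1: "exec R d (initial xs) s1 (\<tau> xs) []" "Q xs = result s1"
    by (auto simp: computes_def)
  have "exec R (Call d b e a) s (load a ys s) (1 + acost e s + list_bits xs + \<tau> xs + list_bits ys) []"
    using Query s1 by (intro exec.Call[of xs b e s R _ s1]) auto
  then show ?case by (simp add: ac_simps)
qed (use exec.Skip[of R] exec.Assign[of R] exec.Store[of R] exec.WhileFalse[where Q = R] in auto)

lemma cost_bound_nonneg: "0 \<le> cost_bound P \<alpha> k x"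
proof -
  \<comment> \<open>True also for \<open>max_len P x = 0\<close>, because
    \<open>ln 0 = 0\<close>.\<close>
  have "0 \<le> log 2 (real (max_len P x))"
    by (cases "max_len P x = 0") (auto simp: log_def intro!: divide_nonneg_nonneg)
  then show ?thesis by (simp add: cost_bound_def)
qed

lemma computes_deterministic:
  "computes Q c xs ys t qs \<Longrightarrow> computes Q c xs ys' t' qs' \<Longrightarrow> ys = ys' \<and> t = t' \<and> qs = qs'"
  unfolding computes_def using exec_deterministic by blast

text \<open>The saving \<open>\<epsilon>\<close> and the power \<open>k\<close> of the algorithm for
  \<open>B\<close> become known only here. This is why a reduction has to handle every
  \<open>\<epsilon>\<close> and every \<open>k\<close> with one program.\<close>

theorem truly_subcubic_transfer:
  assumes "subcubic_reducible A B" and "has_truly_subcubic_algorithm B"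
  shows "has_truly_subcubic_algorithm A"
proof -
  from assms(2) obtain d \<epsilon> C k where d: "oracle_free d" "\<epsilon> > 0" and
    alg: "\<And>y. y \<in> instances B \<Longrightarrow> \<exists>ys t. computes (\<lambda>_. []) d (encode B y) ys t [] \<and> solution B y ys \<and>
      real t \<le> C * cost_bound B (3 - \<epsilon>) k y"
    unfolding has_truly_subcubic_algorithm_def by blast
  from assms(1) obtain c where red: "\<And>\<epsilon>. \<epsilon> > 0 \<Longrightarrow> \<exists>\<delta>>0. \<forall>k. \<exists>C k'. \<forall>Q. oracle_for B Q \<longrightarrow>
        (\<forall>x\<in>instances A. \<exists>ys t qs.
           set qs \<subseteq> instances B \<and>
           computes Q c (encode A x) ys t (map (encode B) qs) \<and> solution A x ys \<and>
           real t \<le> C * cost_bound A (3 - \<delta>) k' x \<and>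
           (\<Sum>q\<leftarrow>qs. cost_bound B (3 - \<epsilon>) k q) \<le> C * cost_bound A (3 - \<delta>) k' x)"
    unfolding subcubic_reducible_def by blast
  obtain \<delta> C' k' where \<delta>: "\<delta> > 0" and run: "\<And>Q x. oracle_for B Q \<Longrightarrow> x \<in> instances A \<Longrightarrow> \<exists>ys t qs.
           set qs \<subseteq> instances B \<and>
           computes Q c (encode A x) ys t (map (encode B) qs) \<and> solution A x ys \<and>
           real t \<le> C' * cost_bound A (3 - \<delta>) k' x \<and>
           (\<Sum>q\<leftarrow>qs. cost_bound B (3 - \<epsilon>) k q) \<le> C' * cost_bound A (3 - \<delta>) k' x"
    using red[OF \<open>\<epsilon> > 0\<close>] by meson
  \<comment> \<open>The algorithm itself serves as the oracle: on an encoded instance, determinism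
    makes the choice pick the only possible output. Other inputs get an arbitrary answer.\<close>
  define Q where "Q xs = (SOME ys. \<exists>t. computes (\<lambda>_. []) d xs ys t [])" for xs
  define \<tau> where "\<tau> xs = (SOME t. computes (\<lambda>_. []) d xs (Q xs) t [])" for xs
  have Q: "computes (\<lambda>_. []) d (encode B y) (Q (encode B y)) (\<tau> (encode B y)) []" if "y \<in> instances B" for y
  proof -
    have "\<exists>t. computes (\<lambda>_. []) d (encode B y) (Q (encode B y)) t []"
      unfolding Q_def by (rule someI_ex) (use alg[OF that] in blast)
    then show ?thesis unfolding \<tau>_def by (rule someI_ex)
  qed
  \<comment> \<open>The absolute value keeps multiplication by the constant monotone, whatever the
    sign of \<open>C\<close>.\<close>
  have sol: "solution B y (Q (encode B y)) \<and> real (\<tau> (encode B y)) \<le> \<bar>C\<bar> * cost_bound B (3 - \<epsilon>) k y"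
    if y: "y \<in> instances B" for y
  proof -
    obtain ys t where 1: "computes (\<lambda>_. []) d (encode B y) ys t []" "solution B y ys"
      "real t \<le> C * cost_bound B (3 - \<epsilon>) k y"
      using alg[OF y] by blast
    have "ys = Q (encode B y)" "t = \<tau> (encode B y)"
      using computes_deterministic[OF 1(1) Q[OF y]] by auto
    moreover have "C * cost_bound B (3 - \<epsilon>) k y \<le> \<bar>C\<bar> * cost_bound B (3 - \<epsilon>) k y"
      by (intro mult_right_mono cost_bound_nonneg) simp
    ultimately show ?thesis using 1 by simp
  qed
  have orac: "oracle_for B Q"
    using sol by (simp add: oracle_for_def)
  have "\<exists>ys t. computes (\<lambda>_. []) (subst_oracle d c) (encode A x) ys t [] \<and> solution A x ys \<and>
      real t \<le> (C' + \<bar>C\<bar> * C') * cost_bound A (3 - \<delta>) k' x" if x: "x \<in> instances A" for x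
  proof -
    obtain ys t qs where qs: "set qs \<subseteq> instances B"
      and comp: "computes Q c (encode A x) ys t (map (encode B) qs)" and "solution A x ys"
      and t: "real t \<le> C' * cost_bound A (3 - \<delta>) k' x"
      and sum: "(\<Sum>q\<leftarrow>qs. cost_bound B (3 - \<epsilon>) k q) \<le> C' * cost_bound A (3 - \<delta>) k' x"
      using run[OF orac x] by blast
    let ?t = "t + (\<Sum>q\<leftarrow>map (encode B) qs. \<tau> q)"
    have "computes (\<lambda>_. []) (subst_oracle d c) (encode A x) ys ?t []"
      using comp exec_subst_oracle[of Q c _ _ t "map (encode B) qs" "\<lambda>_. []" d \<tau>] qs Q
      unfolding computes_def by fastforce
    moreover have "real (\<Sum>q\<leftarrow>map (encode B) qs. \<tau> q) \<le> (\<Sum>q\<leftarrow>qs. \<bar>C\<bar> * cost_bound B (3 - \<epsilon>) k q)"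
      using qs sol by (induction qs) (auto simp: add_mono)
    then have "real ?t \<le> C' * cost_bound A (3 - \<delta>) k' x + \<bar>C\<bar> * (C' * cost_bound A (3 - \<delta>) k' x)"
      using t mult_left_mono[OF sum, of "\<bar>C\<bar>"] by (simp add: sum_list_const_mult)
    then have "real ?t \<le> (C' + \<bar>C\<bar> * C') * cost_bound A (3 - \<delta>) k' x"
      by (simp add: algebra_simps)
    ultimately show ?thesis using \<open>solution A x ys\<close> by blast
  qed
  then show ?thesis
    unfolding has_truly_subcubic_algorithm_def
    using \<delta> oracle_free_subst_oracle[OF d(1)] by blast
qed

section \<open>Walks and distances\<close>

text \<open>Arcs are counted next to the length: repeated squaring controls the number of arcs,
  distances the length.\<close>

fun walk :: "lgraph \<Rightarrow> nat \<Rightarrow> nat \<Rightarrow> nat \<Rightarrow> nat \<Rightarrow> bool" where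
  "walk G 0 i j l \<longleftrightarrow> i = j \<and> i \<in> pverts (graph G) \<and> l = 0"
| "walk G (Suc k) i j l \<longleftrightarrow> (\<exists>v l'. (i, v) \<in> parcs (graph G) \<and> walk G k v j l' \<and> l = len G (i, v) + l')"

lemma walk_split: "walk G (k1 + k2) i j l \<Longrightarrow> wf_digraph (with_proj (graph G)) \<Longrightarrow>
  \<exists>v l1 l2. walk G k1 i v l1 \<and> walk G k2 v j l2 \<and> l = l1 + l2"
proof (induction k1 arbitrary: i l)
  case 0
  have "i \<in> pverts (graph G)"
    using 0 wf_digraph.tail_in_verts[of "with_proj (graph G)"] by (cases k2) force+
  with 0 show ?case by auto
next
  case (Suc k1)
  then obtain v l' where 1: "(i, v) \<in> parcs (graph G)" "walk G (k1 + k2) v j l'" "l = len G (i, v) + l'"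
    by auto
  obtain w l1 l2 where 2: "walk G k1 v w l1" "walk G k2 w j l2" "l' = l1 + l2"
    using Suc.IH[OF 1(2) Suc.prems(2)] by blast
  show ?case
    using 1 2 by (intro exI[of _ w] exI[of _ "len G (i, v) + l1"] exI[of _ l2]) auto
qed

lemma walk_append:
  "walk G c1 i v l1 \<Longrightarrow> walk G c2 v j l2 \<Longrightarrow> walk G (c1 + c2) i j (l1 + l2)"
proof (induction c1 arbitrary: i l1)
  case (Suc c1)
  then obtain w l' where 1: "(i, w) \<in> parcs (graph G)" "walk G c1 w v l'" "l1 = len G (i, w) + l'"
    by auto
  from Suc.IH[OF 1(2) Suc.prems(2)] 1 show ?case
    unfolding add_Suc walk.simps by (intro exI[of _ w] exI[of _ "l' + l2"]) simp
qed simp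

lemma walk_end: "walk G c i j l \<Longrightarrow> j \<in> pverts (graph G)"
  by (induction c arbitrary: i l) auto

lemma lgraph_wf: "G \<in> lgraphs \<kappa> \<Longrightarrow> pair_fin_digraph (graph G)"
  by (simp add: lgraphs_def)

lemma lgraph_verts: "G \<in> lgraphs \<kappa> \<Longrightarrow> pverts (graph G) = {..<node_count G}"
  by (auto simp: lgraphs_def)

lemma lgraph_verts_iff: "G \<in> lgraphs \<kappa> \<Longrightarrow> i \<in> pverts (graph G) \<longleftrightarrow> i < node_count G"
  using lgraph_verts[of G \<kappa>] by blast

lemma node_count_pos: "G \<in> lgraphs \<kappa> \<Longrightarrow> 1 \<le> node_count G"
  by (auto simp: lgraphs_def)

lemma lgraph_arc:
  assumes "G \<in> lgraphs \<kappa>" "(i, j) \<in> parcs (graph G)"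
  shows "i < node_count G" "j < node_count G" "0 < len G (i, j)" "len G (i, j) \<le> length_bound G"
proof -
  interpret pair_fin_digraph "graph G" by (rule lgraph_wf[OF assms(1)])
  show "i < node_count G" "j < node_count G"
    using in_arcsD1[OF assms(2)] in_arcsD2[OF assms(2)] lgraph_verts[OF assms(1)] by auto
  show "0 < len G (i, j)" using assms by (auto simp: lgraphs_def)
  show "len G (i, j) \<le> length_bound G"
    unfolding length_bound_def using pair_finite_arcs assms(2) by (intro Max_ge) auto
qed

lemma length_bound_pos: "G \<in> lgraphs \<kappa> \<Longrightarrow> 1 \<le> length_bound G"
  unfolding length_bound_def lgraphs_def pair_fin_digraph_def pair_fin_digraph_axioms_def
  by (auto intro!: Max_ge)

lemma awalk_walk:
  assumes "G \<in> lgraphs \<kappa>"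
  shows "wf_digraph.awalk_cost (\<lambda>e. real (len G e)) p = real (sum_list (map (len G) p))"
    and "pre_digraph.awalk (with_proj (graph G)) i p j \<Longrightarrow> walk G (length p) i j (sum_list (map (len G) p))"
    and "walk G k i j l \<Longrightarrow> \<exists>p. pre_digraph.awalk (with_proj (graph G)) i p j \<and> l = sum_list (map (len G) p)"
proof -
  interpret pair_fin_digraph "graph G" by (rule lgraph_wf[OF assms])
  show "awalk_cost (\<lambda>e. real (len G e)) p = real (sum_list (map (len G) p))"
    by (induction p) auto
  show "walk G (length p) i j (sum_list (map (len G) p))" if "awalk i p j"
    using that
  proof (induction p arbitrary: i)
    case Nil
    then show ?case by (auto simp: awalk_Nil_iff)
  next
    case (Cons e p)
    then show ?case by (cases e) (auto simp: awalk_Cons_iff)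
  qed
  show "\<exists>p. awalk i p j \<and> l = sum_list (map (len G) p)" if "walk G k i j l"
    using that
  proof (induction k arbitrary: i l)
    case 0
    then show ?case by (intro exI[of _ "[]"]) (auto simp: awalk_Nil_iff)
  next
    case (Suc k)
    then obtain v l' where 1: "(i, v) \<in> parcs (graph G)" "walk G k v j l'" "l = len G (i, v) + l'"
      by auto
    with Suc.IH obtain p where "awalk v p j" "l' = sum_list (map (len G) p)" by blast
    with 1 show ?case by (intro exI[of _ "(i, v) # p"]) (auto simp: awalk_Cons_iff)
  qed
qed

lemma distance_le_walk:
  assumes "G \<in> lgraphs \<kappa>" "walk G k i j l" shows "distance G i j \<le> ereal (real l)"
proof -
  interpret pair_fin_digraph "graph G" by (rule lgraph_wf[OF assms(1)])
  obtain p where "awalk i p j" "l = sum_list (map (len G) p)"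
    using awalk_walk(3)[OF assms] by blast
  then show ?thesis
    using min_cost_le_walk_cost[of i p j "\<lambda>e. real (len G e)"] awalk_walk(1)[OF assms(1), of p]
    by (simp add: distance_def)
qed

text \<open>Lengths being nonnegative, a shortest walk can be taken to be a simple path, hence with
  fewer arcs than nodes. This bounds both the number of squarings and the finite distances.\<close>

lemma distance_attained:
  assumes "G \<in> lgraphs \<kappa>" "distance G i j \<noteq> \<infinity>"
  shows "\<exists>k l. k < node_count G \<and> walk G k i j l \<and> distance G i j = ereal (real l)"
proof -
  interpret pair_fin_digraph "graph G" by (rule lgraph_wf[OF assms(1)])
  have "i \<rightarrow>\<^sup>*\<^bsub>with_proj (graph G)\<^esub> j" using assms(2) \<mu>_reach_conv[of "\<lambda>e. real (len G e)" i j] by (auto simp: distance_def)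
  then obtain p where p: "apath i p j" "\<mu> (\<lambda>e. real (len G e)) i j = awalk_cost (\<lambda>e. real (len G e)) p"
    using min_cost_awalk[of i j "\<lambda>e. real (len G e)"] by auto
  have "walk G (length p) i j (sum_list (map (len G) p))"
    using p(1) by (intro awalk_walk(2)[OF assms(1)]) (simp add: apath_def)
  then show ?thesis
    using p(2) length_apath_less[OF p(1)] awalk_walk(1)[OF assms(1), of p]
    by (intro exI[of _ "length p"] exI[of _ "sum_list (map (len G) p)"]) (auto simp: distance_def)
qed

lemma walk_length_le:
  assumes "G \<in> lgraphs \<kappa>" shows "walk G k i j l \<Longrightarrow> l \<le> k * length_bound G"
proof (induction k arbitrary: i l)
  case (Suc k)
  then obtain v l' where "(i, v) \<in> parcs (graph G)" "walk G k v j l'" "l = len G (i, v) + l'"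
    by auto
  with Suc.IH[of v l'] lgraph_arc(4)[OF assms] show ?case by fastforce
qed simp

text \<open>Weak duality: a potential that grows by at most the length along each arc certifies a
  lower bound on distances. The lower bounds for the gadget are obtained this way, without
  enumerating walks.\<close>

lemma distance_ge_potential:
  fixes \<phi> :: "nat \<Rightarrow> int"
  assumes G: "G \<in> lgraphs \<kappa>"
    and \<phi>: "\<And>x y. (x, y) \<in> parcs (graph G) \<Longrightarrow> \<phi> y \<le> \<phi> x + int (len G (x, y))"
  shows "ereal (real_of_int (\<phi> j - \<phi> i)) \<le> distance G i j"
proof (cases "distance G i j = \<infinity>")
  case False
  then obtain k l where kl: "walk G k i j l" "distance G i j = ereal (real l)"
    using distance_attained[OF G] by blast
  have "walk G k i j l \<Longrightarrow> \<phi> j - \<phi> i \<le> int l"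
  proof (induction k arbitrary: i l)
    case (Suc k)
    then obtain v l' where "(i, v) \<in> parcs (graph G)" "walk G k v j l'" "l = len G (i, v) + l'"
      by auto
    with Suc.IH[of v l'] \<phi>[of i v] show ?case by simp
  qed simp
  with kl(1) have "real_of_int (\<phi> j - \<phi> i) \<le> real_of_int (int l)" by (simp only: of_int_le_iff)
  with kl(2) show ?thesis by simp
qed simp

section \<open>Adjacency matrices in row-major order\<close>

lemma map_upt_div_mod:
  "concat (map (\<lambda>i. map (\<lambda>j. f i j) [0..<n]) [0..<m]) = map (\<lambda>z. f (z div n) (z mod n)) [0..<m * n]"
proof (induction m)
  case (Suc m)
  have "map (f m) [0..<n] = map (\<lambda>z. f (z div n) (z mod n)) (map (\<lambda>j. j + m * n) [0..<n])"
    by (cases "n = 0") (auto simp: div_mult_self3)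
  also have "map (\<lambda>j. j + m * n) [0..<n] = [m * n..<Suc m * n]"
    by (simp add: map_add_upt)
  finally have *: "map (\<lambda>z. f (z div n) (z mod n)) [m * n..<Suc m * n] = map (f m) [0..<n]" ..
  have "[0..<Suc m * n] = [0..<m * n] @ [m * n..<Suc m * n]"
    using upt_add_eq_append[of 0 "m * n" n] by (simp add: add.commute)
  then have "map (\<lambda>z. f (z div n) (z mod n)) [0..<Suc m * n] =
      map (\<lambda>z. f (z div n) (z mod n)) [0..<m * n] @ map (f m) [0..<n]"
    by (simp only: map_append *)
  with Suc show ?case by simp
qed simp

definition arc_length :: "lgraph \<Rightarrow> nat \<Rightarrow> nat \<Rightarrow> int" where
  "arc_length G i j = (if (i, j) \<in> parcs (graph G) then int (len G (i, j)) else 0)"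

lemma encode_graph_eq: "encode_graph G = int (node_count G) #
  map (\<lambda>z. arc_length G (z div node_count G) (z mod node_count G)) [0..<node_count G * node_count G]"
  unfolding encode_graph_def arc_length_def by (simp add: map_upt_div_mod)

section \<open>The negative triangle gadget\<close>

text \<open>Nodes \<open>0, \<dots>, 4s - 1\<close> form four layers \<open>I\<close>, \<open>K\<close>, \<open>J\<close>, \<open>I'\<close>, and node \<open>4s\<close> is the queried rankee. A path
  \<open>i, k, j, i'\<close> has length \<open>3 H + 2 (a i k + b k j - c i j)\<close>; the factor 2 avoids ties with the distance
  \<open>3 H - 1\<close> from \<open>i\<close> to \<open>4s\<close>. The edges of length \<open>2 H\<close> put all copies in \<open>I'\<close> but that of \<open>i\<close> closer to \<open>i\<close>
  than \<open>4s\<close>, so that only the position of its own copy affects the rank of \<open>4s\<close>.\<close>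

definition gadget_len :: "int \<Rightarrow> int \<Rightarrow> (int \<Rightarrow> int \<Rightarrow> int) \<Rightarrow> (int \<Rightarrow> int \<Rightarrow> int) \<Rightarrow> (int \<Rightarrow> int \<Rightarrow> int) \<Rightarrow>
    int \<Rightarrow> int \<Rightarrow> int" where
  "gadget_len s H a b c x y =
    (let l = min x y; h = max x y; p = l div s; q = h div s; i = l mod s; j = h mod s in
     if p = 0 \<and> q = 1 then H + 2 * a i j
     else if p = 1 \<and> q = 2 then H + 2 * b i j
     else if p = 2 \<and> q = 3 then H - 2 * c j i
     else if p = 0 \<and> q = 3 then if i = j then 0 else 2 * H
     else if p = 0 \<and> q = 4 then 3 * H - 1
     else 0)"

definition gadget :: "nat \<Rightarrow> int \<Rightarrow> (int \<Rightarrow> int \<Rightarrow> int) \<Rightarrow> (int \<Rightarrow> int \<Rightarrow> int) \<Rightarrow> (int \<Rightarrow> int \<Rightarrow> int) \<Rightarrow> lgraph" where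
  "gadget s H a b c =
    \<lparr>graph = \<lparr>pverts = {..<4 * s + 1},
       parcs = {(x, y). x < 4 * s + 1 \<and> y < 4 * s + 1 \<and> 0 < gadget_len (int s) H a b c (int x) (int y)}\<rparr>,
     len = (\<lambda>(x, y). nat (gadget_len (int s) H a b c (int x) (int y)))\<rparr>"

text \<open>Putting the smaller end first makes the lengths symmetric, so that one gadget serves
  directed and undirected graphs alike.\<close>

lemma gadget_len_commute: "gadget_len s H a b c x y = gadget_len s H a b c y x"
  unfolding gadget_len_def by (simp only: min.commute max.commute)

text \<open>Each kind of edge in both orientations. As the graph is symmetric, a potential has to be
  checked against exactly these ten cases.\<close>

lemma gadget_len_oriented:
  assumes "0 < s" "0 < gadget_len s H a b c x y"
  shows "x div s = 0 \<and> y div s = 1 \<and> gadget_len s H a b c x y = H + 2 * a (x mod s) (y mod s)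
    \<or> y div s = 0 \<and> x div s = 1 \<and> gadget_len s H a b c x y = H + 2 * a (y mod s) (x mod s)
    \<or> x div s = 1 \<and> y div s = 2 \<and> gadget_len s H a b c x y = H + 2 * b (x mod s) (y mod s)
    \<or> y div s = 1 \<and> x div s = 2 \<and> gadget_len s H a b c x y = H + 2 * b (y mod s) (x mod s)
    \<or> x div s = 2 \<and> y div s = 3 \<and> gadget_len s H a b c x y = H - 2 * c (y mod s) (x mod s)
    \<or> y div s = 2 \<and> x div s = 3 \<and> gadget_len s H a b c x y = H - 2 * c (x mod s) (y mod s)
    \<or> x div s = 0 \<and> y div s = 3 \<and> x mod s \<noteq> y mod s \<and> gadget_len s H a b c x y = 2 * H
    \<or> y div s = 0 \<and> x div s = 3 \<and> x mod s \<noteq> y mod s \<and> gadget_len s H a b c x y = 2 * H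
    \<or> x div s = 0 \<and> y div s = 4 \<and> gadget_len s H a b c x y = 3 * H - 1
    \<or> y div s = 0 \<and> x div s = 4 \<and> gadget_len s H a b c x y = 3 * H - 1"
proof (cases "x \<le> y")
  case True
  then have "min x y = x" "max x y = y" by auto
  with assms(2) show ?thesis
    unfolding gadget_len_def by (auto simp: Let_def split: if_splits)
next
  case False
  then have "min x y = y" "max x y = x" by auto
  with assms(2) show ?thesis
    unfolding gadget_len_def by (auto simp: Let_def split: if_splits)
qed

text \<open>The multiple 16 is generous: the perturbations \<open>2 * a\<close>,
  \<open>2 * b\<close> and \<open>2 * c\<close> are at most \<open>H / 8\<close>, so they cannot
  compensate for a step in the wrong direction.\<close>

locale triangle_gadget =
  fixes s :: nat and P H :: int and a b c :: "int \<Rightarrow> int \<Rightarrow> int"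
  assumes s: "1 \<le> s" and P: "1 \<le> P" and H: "H = 16 * P"
    and a: "\<And>i j. 0 \<le> i \<Longrightarrow> i < int s \<Longrightarrow> 0 \<le> j \<Longrightarrow> j < int s \<Longrightarrow> 0 \<le> a i j \<and> a i j < P"
    and b: "\<And>i j. 0 \<le> i \<Longrightarrow> i < int s \<Longrightarrow> 0 \<le> j \<Longrightarrow> j < int s \<Longrightarrow> 0 \<le> b i j \<and> b i j < P"
    and c: "\<And>i j. 0 \<le> i \<Longrightarrow> i < int s \<Longrightarrow> 0 \<le> j \<Longrightarrow> j < int s \<Longrightarrow> 0 \<le> c i j \<and> c i j \<le> P"
begin

abbreviation "T \<equiv> gadget s H a b c"
abbreviation "w \<equiv> gadget_len s H a b c"

lemma mod_bounds: "0 \<le> x mod int s" "x mod int s < int s"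
  using s by auto

lemmas abc = a[OF mod_bounds mod_bounds] b[OF mod_bounds mod_bounds] c[OF mod_bounds mod_bounds]

lemma w_bounds: "0 \<le> w x y" "w x y \<le> 4 * H"
proof -
  have *: "0 \<le> w x y \<and> w x y \<le> 4 * H"
    using abc[of "min x y" "max x y"] abc[of "max x y" "min x y"] P H
    unfolding gadget_len_def Let_def by (auto split: if_splits)
  then show "0 \<le> w x y" "w x y \<le> 4 * H" by auto
qed

lemma node_count_gadget: "node_count T = 4 * s + 1"
  by (simp add: gadget_def)

lemma arc_length_gadget: "x < 4 * s + 1 \<Longrightarrow> y < 4 * s + 1 \<Longrightarrow> arc_length T x y = w (int x) (int y)"
  using w_bounds(1)[of x y] by (auto simp: arc_length_def gadget_def)

lemma parcs_gadget: "(x, y) \<in> parcs (graph T) \<longleftrightarrow> x < 4 * s + 1 \<and> y < 4 * s + 1 \<and> 0 < w (int x) (int y)"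
  and len_gadget: "len T (x, y) = nat (w (int x) (int y))"
  by (auto simp: gadget_def)

lemma gadget_lgraphs: "T \<in> lgraphs \<kappa>"
proof -
  have "parcs (graph T) \<subseteq> {..<4 * s + 1} \<times> {..<4 * s + 1}"
    by (auto simp: gadget_def)
  then have "finite (parcs (graph T))" by (rule finite_subset) auto
  then have "pair_fin_digraph (graph T)"
    by unfold_locales (auto simp: gadget_def)
  moreover have "symmetric (with_proj (graph T))"
    by (auto simp: symmetric_def gadget_def sym_def gadget_len_commute)
  ultimately show ?thesis
    using gadget_len_commute[of s H a b c]
    by (auto simp: lgraphs_def gadget_def intro!: exI[of _ "4 * s + 1"])
qed

lemma length_bound_gadget: "length_bound T \<le> nat (4 * H)"
proof -
  have "finite (parcs (graph T))"
    using lgraph_wf[OF gadget_lgraphs] 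
    by (simp add: pair_fin_digraph_def pair_fin_digraph_axioms_def)
  then show ?thesis
    unfolding length_bound_def using w_bounds(2) P H
    by (subst Max_le_iff) (auto simp: gadget_def intro!: nat_mono)
qed

lemma distance_source:
  assumes i: "i < s"
  shows "distance T i (4 * s) = ereal (real_of_int (3 * H - 1))"
proof (rule antisym)
  have "w (int i) (int (4 * s)) = 3 * H - 1"
    using i s by (auto simp: gadget_len_def min_def max_def)
  then show "distance T i (4 * s) \<le> ereal (real_of_int (3 * H - 1))"
    using i P H distance_le_walk[OF gadget_lgraphs, of 1 i "4 * s" "nat (3 * H - 1)"]
    by (simp add: parcs_gadget len_gadget) (simp add: gadget_def)
  have "x = 4 * int s" if "x div int s = 4" "x < 4 * int s + 1" for x
  proof -
    have "4 * int s \<le> x" using that(1) s by (metis div_mult_mod_eq mod_bounds(1) add.commute le_add_same_cancel2 mult.commute)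
    with that show ?thesis by simp
  qed
  \<comment> \<open>All edges at node \<open>4 * s\<close> have length \<open>3 * H - 1\<close>, so
    its indicator with this height is a feasible potential.\<close>
  let ?\<phi> = "\<lambda>x. if int x div int s = 4 then 3 * H - 1 else 0"
  have "ereal (real_of_int (?\<phi> (4 * s) - ?\<phi> i)) \<le> distance T i (4 * s)"
  proof (rule distance_ge_potential[OF gadget_lgraphs])
    fix x y assume "(x, y) \<in> parcs (graph T)"
    then have w: "0 < w x y" by (simp add: parcs_gadget)
    then have "?\<phi> y \<le> ?\<phi> x + w x y"
      using gadget_len_oriented[of s H a b c x y] s P H by auto
    then show "?\<phi> y \<le> ?\<phi> x + int (len T (x, y))"
      using w by (simp add: len_gadget)
  qed
  then show "ereal (real_of_int (3 * H - 1)) \<le> distance T i (4 * s)"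
    using i s by auto
qed

lemma distance_other:
  assumes "i < s" "j < s" "i \<noteq> j"
  shows "distance T i (3 * s + j) < ereal (real_of_int (3 * H - 1))"
proof -
  have "int (3 * s + j) div int s = 3" "int (3 * s + j) mod int s = int j"
    using assms by auto
  then have "w (int i) (int (3 * s + j)) = 2 * H"
    using assms by (auto simp: gadget_len_def min_def max_def Let_def)
  then have "distance T i (3 * s + j) \<le> ereal (real (nat (2 * H)))"
    using assms P H by (intro distance_le_walk[OF gadget_lgraphs, of 1])
      (auto simp: parcs_gadget len_gadget gadget_def)
  also have "\<dots> < ereal (real_of_int (3 * H - 1))"
    using P H by simp
  finally show ?thesis .
qed

lemma distance_own_less:
  assumes "i < s" "j < s" "k < s" "a i k + b k j < c i j"
  shows "distance T i (3 * s + i) < ereal (real_of_int (3 * H - 1))"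
proof -
  have dm: "int (n * s + x) div int s = int n" "int (n * s + x) mod int s = int x" if "x < s" for n x
    using that by auto
  note d = dm[OF assms(1), of 3] dm[OF assms(3), of 1] dm[OF assms(2), of 2]
  have 1: "w (int i) (int (s + k)) = H + 2 * a i k"
    using d assms by (simp add: gadget_len_def min_def max_def Let_def)
  have 2: "w (int (s + k)) (int (2 * s + j)) = H + 2 * b k j"
    using d assms by (simp add: gadget_len_def min_def max_def Let_def)
  have 3: "w (int (2 * s + j)) (int (3 * s + i)) = H - 2 * c i j"
    using d assms by (simp add: gadget_len_def min_def max_def Let_def)
  have bnd: "0 \<le> a i k" "0 \<le> b k j" "0 < H - 2 * c i j"
    using a[of "int i" "int k"] b[of "int k" "int j"] c[of "int i" "int j"] assms P H by auto
  have "walk T (Suc (Suc (Suc 0))) i (3 * s + i)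
     (nat (H + 2 * a i k) + (nat (H + 2 * b k j) + (nat (H - 2 * c i j) + 0)))"
    unfolding walk.simps
    \<comment> \<open>The walk runs through \<open>s + k\<close>, \<open>2 * s + j\<close> and
      \<open>3 * s + i\<close>; each \<open>prefer 2\<close> treats the remaining walk before the
      other conjuncts.\<close>
    apply (rule exI[of _ "s + k"], rule exI, intro conjI)
      prefer 2
      apply (rule exI[of _ "2 * s + j"], rule exI, intro conjI)
        prefer 2
        apply (rule exI[of _ "3 * s + i"], rule exI, intro conjI)
          prefer 2
          apply (rule refl)
    using bnd assms P H 1 2 3
    by (auto simp: parcs_gadget len_gadget simp del: of_nat_add) (auto simp: gadget_def)
  then have "distance T i (3 * s + i) \<le> ereal (real (nat (H + 2 * a i k) + (nat (H + 2 * b k j) + (nat (H - 2 * c i j) + 0))))"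
    by (rule distance_le_walk[OF gadget_lgraphs])
  \<comment> \<open>By integrality \<open>a i k + b k j - c i j \<le> -1\<close>, so the length is
    at most \<open>3 * H - 2\<close>.\<close>
  also have "\<dots> < ereal (real_of_int (3 * H - 1))"
    using bnd assms(4) P H by simp
  finally show ?thesis .
qed

lemma distance_own_greater:
  assumes i: "i < s" and tri: "\<And>j k. 0 \<le> j \<Longrightarrow> j < int s \<Longrightarrow> 0 \<le> k \<Longrightarrow> k < int s \<Longrightarrow> c i j \<le> a i k + b k j"
  shows "ereal (real_of_int (3 * H - 1)) < distance T i (3 * s + i)"
proof -
  \<comment> \<open>A lower estimate of the distance from \<open>i\<close>. On layer
    \<open>J\<close> the threshold \<open>c i j\<close> replaces the minimum of
    \<open>a i k + b k j\<close> over \<open>k\<close>, which it does not exceed by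
    \<open>tri\<close>; from there the perturbation \<open>- 2 * c i j\<close> of the last edge
    leads to exactly \<open>3 * H\<close> at the own copy.\<close>
  define \<phi> :: "int \<Rightarrow> int" where "\<phi> x =
    (if x div s = 0 then if x mod s = i then 0 else 2 * H
     else if x div s = 1 then H + 2 * a i (x mod s)
     else if x div s = 2 then 2 * H + 2 * c i (x mod s)
     else if x div s = 3 then if x mod s = i then 3 * H else 2 * H
     else 3 * H - 1)" for x
  have own: "0 \<le> a i (x mod s) \<and> a i (x mod s) < P" "0 \<le> c i (x mod s) \<and> c i (x mod s) \<le> P" for x :: int
    using a[of "int i" "x mod int s"] c[of "int i" "x mod int s"] mod_bounds[of x] i by auto
  have "ereal (real_of_int (\<phi> (3 * s + i) - \<phi> i)) \<le> distance T i (3 * s + i)"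
  proof (rule distance_ge_potential[OF gadget_lgraphs])
    fix x y assume "(x, y) \<in> parcs (graph T)"
    then have w: "0 < w x y" by (simp add: parcs_gadget)
    have "0 < int s" using s by simp
    from gadget_len_oriented[OF this w] have "\<phi> y \<le> \<phi> x + w x y"
      by (elim disjE)
        (use s P H own[of x] own[of y] abc[of x y] abc[of y x]
          tri[OF mod_bounds(1)[of x] mod_bounds(2)[of x] mod_bounds(1)[of y] mod_bounds(2)[of y]]
          tri[OF mod_bounds(1)[of y] mod_bounds(2)[of y] mod_bounds(1)[of x] mod_bounds(2)[of x]]
        in \<open>auto simp: \<phi>_def\<close>)
    then show "\<phi> (int y) \<le> \<phi> (int x) + int (len T (x, y))"
      using w by (simp add: len_gadget)
  qed
  moreover have "\<phi> (3 * s + i) = 3 * H" "\<phi> i = 0"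
    using i by (auto simp: \<phi>_def)
  ultimately have "ereal (real_of_int (3 * H)) \<le> distance T i (3 * s + i)" by simp
  moreover have "ereal (real_of_int (3 * H - 1)) < ereal (real_of_int (3 * H))" by simp
  ultimately show ?thesis by (rule less_le_trans[rotated])
qed

abbreviation "instance_of \<equiv> (T, {3 * s..<4 * s + 1}, 4 * s)"

lemma instance_gadget: "instance_of \<in> instances (reverse_rank_single_source \<kappa>)"
  using gadget_lgraphs by (auto simp: reverse_rank_single_source_def gadget_def)

text \<open>Holds for every admissible rank: if there is a violation, all \<open>s\<close> copies
  are strictly closer than \<open>4 * s\<close> and already the lower end of the interval is
  \<open>s + 1\<close>. If there is none, the own copy is strictly farther away, and the upper end
  counts at most the \<open>s - 1\<close> foreign copies and \<open>4 * s\<close> itself.\<close>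

lemma gadget_rank:
  assumes i: "i < s" and r: "is_rank T {3 * s..<4 * s + 1} i (4 * s) r"
  shows "s < r \<longleftrightarrow> (\<exists>j k. 0 \<le> j \<and> j < int s \<and> 0 \<le> k \<and> k < int s \<and> a i k + b k j < c i j)"
    (is "_ \<longleftrightarrow> ?R")
proof -
  let ?U = "{3 * s..<4 * s + 1} - {i}" and ?D = "ereal (real_of_int (3 * H - 1))"
  have U: "?U = {3 * s..<4 * s + 1}" using i by auto
  have r: "1 + card {h \<in> ?U. distance T i h < ?D} \<le> r" "r \<le> card {h \<in> ?U. distance T i h \<le> ?D}"
    using r i unfolding is_rank_def Let_def by (auto simp: distance_source)
  show ?thesis
  proof
    assume ?R
    then obtain j k where jk: "0 \<le> j" "j < int s" "0 \<le> k" "k < int s" "a i k + b k j < c i j" by blast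
    then obtain j' k' where jk': "j = int j'" "k = int k'" by (metis zero_le_imp_eq_int)
    have "{3 * s..<4 * s} \<subseteq> {h \<in> ?U. distance T i h < ?D}"
    proof
      fix h assume h: "h \<in> {3 * s..<4 * s}"
      then obtain x where x: "h = 3 * s + x" "x < s" using le_iff_add[of "3 * s" h] by auto
      show "h \<in> {h \<in> ?U. distance T i h < ?D}"
        using distance_other[OF i x(2)] distance_own_less[OF i, of j' k'] jk jk' x h i
        by (cases "i = x") auto
    qed
    from card_mono[OF _ this] show "s < r" using r(1) by simp
  next
    assume "s < r"
    show ?R
    proof (rule ccontr)
      assume "\<not> ?R"
      then have "?D < distance T i (3 * s + i)"
        using distance_own_greater[OF i] by (meson not_le)
      then have "{h \<in> ?U. distance T i h \<le> ?D} \<subseteq> {3 * s..<4 * s + 1} - {3 * s + i}"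
        by auto
      from card_mono[OF _ this] have "card {h \<in> ?U. distance T i h \<le> ?D} \<le> s"
        using i by simp
      with r(2) \<open>s < r\<close> show False by simp
    qed
  qed
qed

end

section \<open>From reverse ranks to APSP\<close>

notation Seq (infixr ";;" 60)
notation Assign (infix "::=" 61)
notation Plus (infixl "\<oplus>" 65)
notation Minus (infixl "\<ominus>" 65)
notation Times (infixl "\<otimes>" 70)

abbreviation Equal :: "aexp \<Rightarrow> aexp \<Rightarrow> bexp" where
  "Equal a b \<equiv> Conj (Neg (Less a b)) (Neg (Less b a))"

text \<open>Tests have no disjunction; the negated conjunction expresses that \<open>v < 0\<close>
  or \<open>0 \<le> w \<le> v\<close>. As -1 codes the distance \<open>\<infinity>\<close>, a
  negative \<open>v\<close> lets every rankee count, and a negative \<open>w\<close> counts only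
  then.\<close>

definition count_test :: bexp where
  "count_test = Conj (Less (Const 0) (Elem ''in'' (Const 1 \<oplus> Var ''n'' \<otimes> Var ''n'' \<oplus> Var ''h'')))
     (Conj (Neg (Equal (Var ''h'') (Var ''i'')))
       (Neg (Conj (Neg (Less (Var ''v'') (Const 0)))
         (Neg (Conj (Neg (Less (Var ''w'') (Const 0))) (Neg (Less (Var ''v'') (Var ''w''))))))))"

definition count_step :: com where
  "count_step =
    ''w'' ::= Elem ''d'' (Var ''i'' \<otimes> Var ''n'' \<oplus> Var ''h'') ;;
    Cond count_test
      (''r'' ::= Var ''r'' \<oplus> Const 1) Skip"

definition rank_step :: com where
  "rank_step =
    ''v'' ::= Elem ''d'' (Var ''i'' \<otimes> Var ''n'' \<oplus> Var ''u'') ;;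
    ''r'' ::= Const 0 ;;
    For ''h'' ''n'' count_step ;;
    Store ''out'' (Var ''i'') (Var ''r'')"

text \<open>The encoding of an instance begins with the encoding of its graph, so the first
  \<open>1 + n * n\<close> cells of the input form the query and nothing has to be copied.\<close>

definition rank_prog :: com where
  "rank_prog =
    ''n'' ::= Elem ''in'' (Const 0) ;;
    ''u'' ::= Elem ''in'' (Const 1 \<oplus> Var ''n'' \<otimes> Var ''n'' \<oplus> Var ''n'') ;;
    Query ''in'' (Const 1 \<oplus> Var ''n'' \<otimes> Var ''n'') ''d'' ;;
    For ''i'' ''n'' rank_step ;;
    ''len'' ::= Var ''n''"

lemma mods_count_step [simp]: "mod_vars count_step = {''w'', ''r''}" "mod_arrs count_step = {}"
  by (auto simp: count_step_def)

lemma mods_rank_step [simp]: "mod_vars rank_step = {''v'', ''r'', ''h'', ''w''}" "mod_arrs rank_step = {''out''}"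
  by (auto simp: rank_step_def)

definition counted :: "(int \<Rightarrow> int) \<Rightarrow> (int \<Rightarrow> int) \<Rightarrow> int \<Rightarrow> int \<Rightarrow> int \<Rightarrow> nat \<Rightarrow> bool" where
  "counted f d n i v h \<longleftrightarrow> 0 < f (1 + n * n + int h) \<and> int h \<noteq> i \<and>
     (v < 0 \<or> 0 \<le> d (i * n + int h) \<and> d (i * n + int h) \<le> v)"

context bounded_machine
begin

lemma wp_count:
  assumes n: "var s ''n'' = int n" and r: "var s ''r'' = 0"
    and R: "\<And>s' t'. var s' ''r'' = int (card {h. h < n \<and> counted (arr s ''in'') (arr s ''d'') n (var s ''i'') (var s ''v'') h}) \<Longrightarrow>
       agree {''h'', ''w'', ''r''} {} s s' \<Longrightarrow> t' \<le> t + 5 * n + 2 \<Longrightarrow> R s' t' qs"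
  shows "wp (For ''h'' ''n'' count_step) s t qs R"
proof (rule wp_bounded)
  assume bd: "bounded X s"
  let ?c = "counted (arr s ''in'') (arr s ''d'') n (var s ''i'') (var s ''v'')"
  define cnt where "cnt k = int (card {h. h < nat k \<and> ?c h})" for k
  let ?I = "\<lambda>k s' t' qs'. var s' ''r'' = cnt k \<and> qs' = qs \<and> t' \<le> t + 5 * nat k"
  have nX: "int n \<le> X" using bounded_var[OF bd, of "''n''"] n by simp
  show ?thesis
  proof (rule wp_For[where I = ?I, OF _ _ _ n[symmetric]])
    fix k s' t' qs'
    assume k: "0 \<le> k" "k < int n" "var s' ''h'' = k" and bd': "bounded X s'"
      and ag: "agree (insert ''h'' (mod_vars count_step)) (mod_arrs count_step) s s'" and I: "?I k s' t' qs'"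
    have [simp]: "var s' ''n'' = int n" "var s' ''i'' = var s ''i''" "var s' ''v'' = var s ''v''"
      "arr s' ''d'' = arr s ''d''" "arr s' ''in'' = arr s ''in''"
      using agree_var[OF ag] agree_arr[OF ag] n by auto
    have [simp]: "bsmall count_test" "bsize count_test \<le> 50" by (simp_all add: count_test_def)
    have test: "bval count_test
      (s'\<lparr>var := (var s')(''w'' := arr s ''d'' (var s ''i'' * int n + k))\<rparr>) \<longleftrightarrow> ?c (nat k)"
      using k by (auto simp: counted_def count_test_def)
    have cnt: "cnt (k + 1) = (if ?c (nat k) then cnt k + 1 else cnt k)"
    proof -
      have "{h. h < nat (k + 1) \<and> ?c h} =
          (if ?c (nat k) then insert (nat k) {h. h < nat k \<and> ?c h} else {h. h < nat k \<and> ?c h})"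
        using k(1) by (auto simp: less_Suc_eq nat_add_distrib)
      then show ?thesis by (simp add: cnt_def)
    qed
    have "card {h. h < nat k \<and> ?c h} \<le> card {..<nat k}" by (intro card_mono) auto
    then have le: "0 \<le> cnt k" "cnt k < X" using k nX by (auto simp: cnt_def)
    show "wp count_step s' t' qs' (\<lambda>s'' t'' qs''. ?I (k + 1) (s''\<lparr>var := (var s'')(''h'' := k + 1)\<rparr>) (t'' + 2) qs'')"
      unfolding count_step_def
      apply (intro wp_Seq wp_Assign wp_Cond wp_Skip)
      using test bounded_arr[OF bd] I k le
      by (auto simp add: cnt nat_add_distrib)
  next
    fix s' t' qs'
    assume "agree (insert ''h'' (mod_vars count_step)) (mod_arrs count_step) s s'" "?I (int n) s' t' qs'"
    then show "R s' (t' + 2) qs'" using R[of s' "t' + 2"] by (simp add: cnt_def)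
  qed (use r in \<open>auto simp: cnt_def\<close>)
qed

lemma wp_ranks:
  assumes n: "var s ''n'' = int n"
    and R: "\<And>s' t'. (\<And>i. i < n \<Longrightarrow> arr s' ''out'' (int i) =
        int (card {h. h < n \<and> counted (arr s ''in'') (arr s ''d'') n i (arr s ''d'' (int i * int n + var s ''u'')) h})) \<Longrightarrow>
       agree {''i'', ''v'', ''r'', ''h'', ''w''} {''out''} s s' \<Longrightarrow> t' \<le> t + 14 * n * n + 2 \<Longrightarrow> R s' t' qs"
  shows "wp (For ''i'' ''n'' rank_step) s t qs R"
proof -
  let ?r = "\<lambda>i. int (card {h. h < n \<and> counted (arr s ''in'') (arr s ''d'') n i (arr s ''d'' (i * int n + var s ''u'')) h})"
  let ?I = "\<lambda>k s' t' qs'. (\<forall>i. 0 \<le> i \<and> i < k \<longrightarrow> arr s' ''out'' i = ?r i) \<and> qs' = qs \<and> t' \<le> t + nat k * (14 * n)"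
  show ?thesis
  proof (rule wp_For[where I = ?I, OF _ _ _ n[symmetric]])
    fix k s' t' qs'
    assume k: "0 \<le> k" "k < int n" "var s' ''i'' = k" and bd': "bounded X s'"
      and ag: "agree (insert ''i'' (mod_vars rank_step)) (mod_arrs rank_step) s s'" and I: "?I k s' t' qs'"
    have [simp]: "var s' ''n'' = int n" "var s' ''u'' = var s ''u''"
      "arr s' ''d'' = arr s ''d''" "arr s' ''in'' = arr s ''in''"
      using agree_var[OF ag] agree_arr[OF ag] n by auto
    have nk: "nat (k + 1) = Suc (nat k)" using k by auto
    have n1: "1 \<le> n" using k by auto
    show "wp rank_step s' t' qs' (\<lambda>s'' t'' qs''. ?I (k + 1) (s''\<lparr>var := (var s'')(''i'' := k + 1)\<rparr>) (t'' + 2) qs'')"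
      unfolding rank_step_def
      apply (intro wp_Seq wp_Assign_Elem wp_Assign)
           apply (use X_ge in simp_all)[5]
    proof (rule wp_count[where n = n], goal_cases)
      case (3 s1 t1)
      have r1: "var s1 ''r'' = ?r k" using 3(1) k by simp
      have [simp]: "var s1 ''i'' = k" "arr s1 ''out'' = arr s' ''out''"
        using agree_var[OF 3(2)] agree_arr[OF 3(2)] k by auto
      have t1: "t1 + 3 \<le> t + nat (k + 1) * (14 * n)" using 3(3) I n1 by (simp add: nk)
      have out: "\<forall>i. 0 \<le> i \<and> i < k + 1 \<longrightarrow> ((arr s' ''out'')(k := ?r k)) i = ?r i"
      proof (intro allI impI)
        fix i assume "0 \<le> i \<and> i < k + 1"
        then have "i = k \<or> 0 \<le> i \<and> i < k" by auto
        then show "((arr s' ''out'')(k := ?r k)) i = ?r i" using I by auto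
      qed
      show ?case
        apply (rule wp_Store)
             apply simp_all[4]
         apply (simp add: bounded_def)
        apply (simp del: fun_upd_apply add: r1)
        using out t1 I by (simp del: fun_upd_apply add: fun_upd_same)
    qed simp_all
  next
    fix s' t' qs'
    assume "agree (insert ''i'' (mod_vars rank_step)) (mod_arrs rank_step) s s'" "?I (int n) s' t' qs'"
    then show "R s' (t' + 2) qs'" using R[of s' "t' + 2"] by (auto simp: algebra_simps)
  qed simp_all
qed

end

lemma (in bounded_machine) wp_rank_prog:
  assumes n: "arr s ''in'' 0 = n" and u: "arr s ''in'' (1 + n * n + n) = u"
    and R: "wp (Query ''in'' (Const 1 \<oplus> Var ''n'' \<otimes> Var ''n'') ''d'' ;; For ''i'' ''n'' rank_step ;; ''len'' ::= Var ''n'')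
      (s\<lparr>var := (var s)(''n'' := n, ''u'' := u)\<rparr>) (t + 2) qs R"
  shows "wp rank_prog s t qs R"
  unfolding rank_prog_def
  apply (rule wp_Seq, rule wp_Assign_Elem, simp, simp, rule wp_Seq, rule wp_Assign_Elem, simp, simp)
  using R by (simp add: n u)

section \<open>Inputs, coded distances and the size of the numbers\<close>

lemma arr_initial: "arr (initial xs) ''in'' i = (if 0 \<le> i \<and> i < int (length xs) then xs ! nat i else 0)"
  "a \<noteq> ''in'' \<Longrightarrow> arr (initial xs) a i = 0"
  by (auto simp: initial_def load_def)

lemma bounded_initial:
  assumes "int (length xs) \<le> X" "\<And>x. x \<in> set xs \<Longrightarrow> \<bar>x\<bar> \<le> X" "0 \<le> X"
  shows "bounded X (initial xs)"
  using assms by (auto simp: bounded_def initial_def load_def)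

lemma length_encode_graph: "length (encode_graph G) = 1 + node_count G * node_count G"
  by (simp add: encode_graph_eq)

lemma encode_graph_nth:
  "encode_graph G ! 0 = int (node_count G)"
  "i < node_count G \<Longrightarrow> j < node_count G \<Longrightarrow> encode_graph G ! (1 + (i * node_count G + j)) = arc_length G i j"
proof -
  assume ij: "i < node_count G" "j < node_count G"
  then have "i * node_count G + j < node_count G * node_count G"
    using mult_le_mono1[of "Suc i" "node_count G" "node_count G"] by simp
  with ij show "encode_graph G ! (1 + (i * node_count G + j)) = arc_length G i j"
    by (simp add: encode_graph_eq)
qed (simp add: encode_graph_eq)

lemma arc_length_bounds:
  assumes "G \<in> lgraphs \<kappa>" shows "0 \<le> arc_length G i j" "arc_length G i j \<le> int (length_bound G)"
  using lgraph_arc[OF assms, of i j] by (auto simp: arc_length_def)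

lemma encode_graph_bounds:
  assumes "G \<in> lgraphs \<kappa>" "x \<in> set (encode_graph G)"
  shows "0 \<le> x \<and> x \<le> int (node_count G * length_bound G)"
proof -
  have 1: "1 \<le> node_count G" "1 \<le> length_bound G"
    using node_count_pos[OF assms(1)] length_bound_pos[OF assms(1)] by auto
  have "int (node_count G) * 1 \<le> int (node_count G) * int (length_bound G)"
    "1 * int (length_bound G) \<le> int (node_count G) * int (length_bound G)"
    using 1 by (intro mult_mono; simp)+
  then have le: "int (node_count G) \<le> int (node_count G * length_bound G)"
    "int (length_bound G) \<le> int (node_count G * length_bound G)"
    by (simp_all only: mult_1_right mult_1_left of_nat_mult)
  from assms(2) consider "x = int (node_count G)" | i j where "x = arc_length G i j"
    unfolding encode_graph_eq by auto
  then show ?thesis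
  proof cases
    case 1
    then show ?thesis using le(1) by simp
  next
    case (2 i j)
    then show ?thesis using arc_length_bounds[OF assms(1), of i j] le(2) by linarith
  qed
qed

lemma distance_cases:
  assumes "G \<in> lgraphs \<kappa>"
  obtains "distance G i j = \<infinity>"
  | l where "distance G i j = ereal (real l)" "l \<le> node_count G * length_bound G"
proof (cases "distance G i j = \<infinity>")
  case False
  then obtain k l where kl: "k < node_count G" "walk G k i j l" "distance G i j = ereal (real l)"
    using distance_attained[OF assms] by blast
  have "l \<le> k * length_bound G" by (rule walk_length_le[OF assms kl(2)])
  also have "\<dots> \<le> node_count G * length_bound G" using kl(1) by (intro mult_le_mono1) simp
  finally show ?thesis using that(2) kl(3) by blast
qed (use that(1) in blast)

text \<open>With -1 for \<open>\<infinity>\<close> the order of the codes is not the order of the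
  distances; the left-hand side is the corrected comparison.\<close>

lemma codes_distance_le_iff:
  assumes "G \<in> lgraphs \<kappa>" "codes_distance y (distance G i h)" "codes_distance v (distance G i j)"
  shows "(v < 0 \<or> 0 \<le> y \<and> y \<le> v) \<longleftrightarrow> distance G i h \<le> distance G i j"
proof -
  have eq: "y = int l" if "ereal (real_of_int y) = ereal (real l)" for y l
    using that by (simp add: of_int_eq_iff[symmetric, where 'a = real] del: of_int_eq_iff)
  show ?thesis
    by (rule distance_cases[OF assms(1), of i h]; rule distance_cases[OF assms(1), of i j])
      (use assms(2,3) eq in \<open>auto simp: codes_distance_def\<close>)
qed

lemma codes_distance_bound:
  assumes "G \<in> lgraphs \<kappa>" "codes_distance y (distance G i j)"
  shows "\<bar>y\<bar> \<le> int (node_count G * length_bound G)"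
proof -
  have "1 * 1 \<le> node_count G * length_bound G"
    using node_count_pos[OF assms(1)] length_bound_pos[OF assms(1)] by (intro mult_le_mono) auto
  then have 1: "1 \<le> int (node_count G * length_bound G)" by linarith
  show ?thesis
  proof (rule distance_cases[OF assms(1), of i j])
    fix l assume l: "distance G i j = ereal (real l)" "l \<le> node_count G * length_bound G"
    have "y = int l" using assms(2) l(1)
      by (simp add: codes_distance_def of_int_eq_iff[symmetric, where 'a = real] del: of_int_eq_iff)
    then show ?thesis using l(2) by (simp only: abs_of_nat of_nat_le_iff)
  qed (use assms(2) 1 in \<open>simp add: codes_distance_def\<close>)
qed

text \<open>The interval of admissible ranks is not empty: \<open>u\<close> itself is counted by its
  upper end but not among the strictly closer rankees.\<close>

lemma upper_is_rank:
  assumes "finite U" "u \<in> U"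
  shows "is_rank G U i u (card {h \<in> U - {i}. distance G i h \<le> distance G i u})"
proof (cases "i = u")
  case False
  let ?L = "{h \<in> U - {i}. distance G i h < distance G i u}"
  have "card (insert u ?L) \<le> card {h \<in> U - {i}. distance G i h \<le> distance G i u}"
    using assms False by (intro card_mono) auto
  moreover have "card (insert u ?L) = 1 + card ?L" using assms by simp
  ultimately show ?thesis using False by (simp add: is_rank_def Let_def)
qed (simp add: is_rank_def Let_def)

text \<open>All numbers in both reductions are at most this.\<close>

definition magnitude :: "nat \<Rightarrow> nat \<Rightarrow> int" where
  "magnitude n M = 4096 * int n ^ 3 * int M"

text \<open>The factor 4096 is room for the numerical constants of the programs. The largest one is
  256, from \<open>4 * H \<le> 256 * n * M\<close>.\<close>

lemma magnitude_ge:
  assumes "k \<le> 4096" "1 \<le> n" "1 \<le> M"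
  shows "int (n ^ 2) * k \<le> magnitude n M" "int (n * M) * k \<le> magnitude n M" "16 \<le> magnitude n M"
proof -
  have 1: "1 \<le> int n" "1 \<le> int M" using assms by auto
  then have 2: "1 * 1 \<le> int n * int M" "1 * 1 \<le> int n * int n" by (intro mult_mono; simp)+
  have "int n ^ 2 * 1 \<le> int n ^ 2 * (int n * int M)" using 2 by (intro mult_left_mono) auto
  then have a: "int n ^ 2 * 4096 \<le> magnitude n M"
    by (simp add: magnitude_def power2_eq_square power3_eq_cube algebra_simps)
  have "int n * int M * 1 \<le> int n * int M * (int n * int n)" using 2 by (intro mult_left_mono) auto
  then have b: "int n * int M * 4096 \<le> magnitude n M"
    by (simp add: magnitude_def power3_eq_cube algebra_simps)
  show "int (n ^ 2) * k \<le> magnitude n M"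
    using a mult_left_mono[OF assms(1), of "int n ^ 2"] by simp
  show "int (n * M) * k \<le> magnitude n M"
    using b mult_left_mono[OF assms(1), of "int n * int M"] by simp
  show "16 \<le> magnitude n M" using b 2 by simp
qed

lemma magnitude_ge_cube:
  assumes "k \<le> 4096" "1 \<le> M" shows "int (n ^ 3) * k \<le> magnitude n M"
proof -
  have "int (n ^ 3) * k \<le> int (n ^ 3) * 4096" using assms by (intro mult_left_mono) auto
  also have "\<dots> \<le> int (n ^ 3) * 4096 * int M" using assms(2) by (simp add: mult_le_cancel_left1)
  finally show ?thesis by (simp add: magnitude_def ac_simps)
qed

lemma result_eq: "var s ''len'' = int n \<Longrightarrow> length (result s) = n \<and> (\<forall>i<n. result s ! i = arr s ''out'' (int i))"
  by (simp add: result_def read_def)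

lemma rank_prog_correct:
  assumes inst: "(G, U, u) \<in> instances (reverse_rank_single_source \<kappa>)" and orac: "oracle_for (APSP \<kappa>) Q"
  shows "\<exists>ys t. computes Q rank_prog (encode (reverse_rank_single_source \<kappa>) (G, U, u)) ys t [encode_graph G] \<and>
    solution (reverse_rank_single_source \<kappa>) (G, U, u) ys \<and>
    t \<le> unit_cost (magnitude (node_count G) (length_bound G)) * (30 * node_count G * node_count G)"
proof -
  have G: "G \<in> lgraphs \<kappa>" and U: "U \<subseteq> pverts (graph G)" and u: "u \<in> U"
    using inst by (auto simp: reverse_rank_single_source_def)
  define n where "n = node_count G"
  define X where "X = magnitude n (length_bound G)"
  have lenE: "length (encode_graph G) = 1 + n * n" by (simp add: length_encode_graph n_def)
  define xs where "xs = encode_graph G @ map (\<lambda>i. if i \<in> U then 1 else 0) [0..<n] @ [int u]"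
  define ys where "ys = Q (encode_graph G)"
  have n: "1 \<le> n" and M: "1 \<le> length_bound G"
    using node_count_pos[OF G] length_bound_pos[OF G] by (auto simp: n_def)
  have un: "u < n" using u U lgraph_verts[OF G] by (auto simp: n_def)
  have len: "length xs = n * n + n + 2" by (simp add: xs_def lenE)
  have sol: "solution (APSP \<kappa>) G ys"
    using orac G by (auto simp: oracle_for_def APSP_def ys_def)
  then have lys: "length ys = n * n"
    and code: "\<And>i j. i < n \<Longrightarrow> j < n \<Longrightarrow> codes_distance (ys ! (i * n + j)) (distance G i j)"
    by (auto simp: APSP_def n_def)
  have ysX: "\<bar>y\<bar> \<le> X" if y: "y \<in> set ys" for y
  proof -
    obtain z where z: "z < n * n" "y = ys ! z" using y lys by (metis in_set_conv_nth)
    then have "z div n < n" "z mod n < n" using n by (auto simp: less_mult_imp_div_less)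
    with code[of "z div n" "z mod n"] z have "\<bar>y\<bar> \<le> int (n * length_bound G)"
      using codes_distance_bound[OF G] by (simp add: n_def)
    then show ?thesis using magnitude_ge(2)[OF _ n M, of 1] by (simp add: X_def)
  qed
  have lX: "int (n * n + n + 2) \<le> X"
  proof -
    have "n \<le> n * n" "1 \<le> n * n" using n by auto
    then have "n * n + n + 2 \<le> 4 * (n * n)" by linarith
    then have "int (n * n + n + 2) \<le> int (n ^ 2) * 4" unfolding power2_eq_square by linarith
    also have "\<dots> \<le> X" unfolding X_def by (rule magnitude_ge[OF _ n M]) simp
    finally show ?thesis .
  qed
  have "0 \<le> int (n * n)" by simp
  with lX have lX': "1 \<le> X" "int n \<le> X" unfolding of_nat_add by linarith+
  have bnd: "bounded X (initial xs)"
  proof (rule bounded_initial)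
    fix x assume "x \<in> set xs"
    then consider "x \<in> set (encode_graph G)" | "x \<in> {0, 1}" | "x = int u" by (auto simp: xs_def)
    then show "\<bar>x\<bar> \<le> X"
    proof cases
      case 1
      with encode_graph_bounds[OF G] have "\<bar>x\<bar> \<le> int (n * length_bound G) * 1" by (fastforce simp: n_def)
      also have "\<dots> \<le> X" unfolding X_def by (rule magnitude_ge[OF _ n M]) simp
      finally show ?thesis .
    qed (use lX' un in auto)
  qed (use len lX lX' in auto)
  interpret bounded_machine X Q
    using magnitude_ge(3)[OF _ n M, of 0] by unfold_locales (simp add: X_def)
  let ?s = "initial xs"
  have arr_in: "arr ?s ''in'' (int z) = xs ! z" if "z < n * n + n + 2" for z
    using that unfolding len[symmetric] by (simp add: arr_initial)
  have xs_nth: "z < 1 + n * n \<Longrightarrow> xs ! z = encode_graph G ! z"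
    "h < n \<Longrightarrow> xs ! (1 + n * n + h) = (if h \<in> U then 1 else 0)" "xs ! (1 + n * n + n) = int u" for z h
    by (auto simp: xs_def nth_append lenE)
  have in0: "arr ?s ''in'' 0 = int n"
    using arr_in[of 0] xs_nth(1)[of 0] encode_graph_nth(1)[of G] by (simp add: n_def)
  have "1 + int n * int n + int n = int (1 + n * n + n)" by simp
  then have inu: "arr ?s ''in'' (1 + int n * int n + int n) = int u"
    using arr_in[of "1 + n * n + n"] xs_nth(3) by (simp only:)
  have inf: "arr ?s ''in'' (1 + int n * int n + int h) = (if h \<in> U then 1 else 0)" if "h < n" for h
  proof -
    have 1: "1 + int n * int n + int h = int (1 + n * n + h)" by simp
    show ?thesis unfolding 1 using arr_in[of "1 + n * n + h"] xs_nth(2)[of h] that by linarith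
  qed
  have rd: "read ''in'' (1 + int n * int n) s = encode_graph G" if "arr s ''in'' = arr ?s ''in''" for s
  proof -
    have "1 + int n * int n = int (1 + n * n)" by simp
    then have k: "nat (1 + int n * int n) = 1 + n * n" by (simp only: nat_int)
    have "read ''in'' (1 + int n * int n) s = map (\<lambda>z. xs ! z) [0..<1 + n * n]"
      unfolding read_def k that by (intro map_cong[OF refl] arr_in) (simp del: upt_Suc)
    also have "\<dots> = encode_graph G"
      by (rule nth_equalityI) (simp_all add: lenE xs_nth(1) del: upt_Suc)
    finally show ?thesis .
  qed
  define post :: "state \<Rightarrow> nat \<Rightarrow> int list list \<Rightarrow> bool" where "post = (\<lambda>s t qs. qs = [encode_graph G] \<and> t \<le> 30 * n * n \<and> var s ''len'' = int n \<and>
    (\<forall>i<n. arr s ''out'' (int i) = int (card {h \<in> U - {i}. distance G i h \<le> distance G i u})))"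
  let ?s2 = "?s\<lparr>var := (var ?s)(''n'' := int n, ''u'' := int u)\<rparr>"
  let ?s3 = "load ''d'' ys ?s2"
  have arr3: "arr ?s3 ''in'' = arr ?s ''in''" "arr ?s3 ''d'' z = (if 0 \<le> z \<and> z < int (n * n) then ys ! nat z else 0)" for z
    using lys by (auto simp: load_def arr_initial)
  have cnt: "{h. h < n \<and> counted (arr ?s3 ''in'') (arr ?s3 ''d'') n i (arr ?s3 ''d'' (int i * int n + int u)) h} =
      {h \<in> U - {i}. distance G i h \<le> distance G i u}" if "i < n" for i
  proof -
    have d: "arr ?s3 ''d'' (int i * int n + int h) = ys ! (i * n + h)" if "h < n" for h
    proof -
      have "i * n + h < n * n" using \<open>i < n\<close> that mult_le_mono1[of "Suc i" n n] by simp
      then show ?thesis by (simp add: arr3 flip: of_nat_mult of_nat_add del: of_nat_mult of_nat_add)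
    qed
    have "counted (arr ?s3 ''in'') (arr ?s3 ''d'') n i (arr ?s3 ''d'' (int i * int n + int u)) h \<longleftrightarrow>
        h \<in> U - {i} \<and> distance G i h \<le> distance G i u" if "h < n" for h
      unfolding counted_def d[OF that] d[OF un] arr3(1) inf[OF that]
      using codes_distance_le_iff[OF G code[OF \<open>i < n\<close> that] code[OF \<open>i < n\<close> un]] by auto
    moreover have "U \<subseteq> {..<n}" using U lgraph_verts[OF G] by (simp add: n_def)
    ultimately show ?thesis by auto
  qed
  have "wp (For ''i'' ''n'' rank_step ;; ''len'' ::= Var ''n'') ?s3 (0 + 2 + 1 + length (encode_graph G) + length ys)
      [encode_graph G] post"
  proof (rule wp_Seq, rule wp_ranks[where n = n], goal_cases)
    case 1
    show ?case by (simp add: load_def)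
  next
    case (2 s t)
    have [simp]: "var s ''n'' = int n" using agree_var[OF 2(2), of "''n''"] by (simp add: load_def)
    have u3: "var ?s3 ''u'' = int u" by (simp add: load_def)
    have "1 \<le> n * n" using n by simp
    \<comment> \<open>The exact count is \<open>16 * n * n + 7\<close>: query and answer together
      contribute \<open>2 * n * n + 1\<close>, the loops \<open>14 * n * n + 2\<close>, and four
      single commands the rest.\<close>
    then have "t + 1 \<le> 30 * n * n"
      using 2(3) unfolding lys lenE by linarith
    moreover have "arr s ''out'' (int i) = int (card {h \<in> U - {i}. distance G i h \<le> distance G i u})" if "i < n" for i
      using 2(1)[OF that] unfolding u3 cnt[OF that] .
    ultimately have "post (s\<lparr>var := (var s)(''len'' := int n)\<rparr>) (t + 1) [encode_graph G]" by (simp add: post_def)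
    then show ?case using lX' by (intro wp_Assign) simp_all
  qed
  then have W: "wp (Query ''in'' (Const 1 \<oplus> Var ''n'' \<otimes> Var ''n'') ''d'' ;; For ''i'' ''n'' rank_step ;; ''len'' ::= Var ''n'')
      ?s2 (0 + 2) [] post"
    using rd[of ?s2] ysX
    by (intro wp_Seq[where ?c1.0 = "Query _ _ _"] wp_Query[where xs = "encode_graph G"])
      (simp_all add: ys_def)
  have "wp rank_prog ?s 0 [] post"
    by (rule wp_rank_prog[OF in0 inu W])
  then obtain s t qs v where run: "exec Q rank_prog ?s s t qs" "t \<le> unit_cost X * v" "post s v qs"
    by (rule wpE[OF _ bnd])
  let ?r = "\<lambda>i. card {h \<in> U - {i}. distance G i h \<le> distance G i u}"
  have res: "length (result s) = n" "\<And>i. i < n \<Longrightarrow> result s ! i = int (?r i)"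
    using run(3) result_eq[of s n] by (auto simp: post_def)
  have "finite U" using U lgraph_verts[OF G] by (auto intro: finite_subset)
  then have "solution (reverse_rank_single_source \<kappa>) (G, U, u) (result s)"
    using res upper_is_rank[OF _ u]
    by (simp add: reverse_rank_single_source_def flip: n_def)
  moreover have "t \<le> unit_cost X * (30 * n * n)"
    using order_trans[OF run(2) mult_le_mono2] run(3) unfolding post_def by blast
  moreover have "encode (reverse_rank_single_source \<kappa>) (G, U, u) = xs"
    by (simp add: reverse_rank_single_source_def xs_def n_def)
  moreover have "qs = [encode_graph G]" using run(3) unfolding post_def by blast
  ultimately show ?thesis
    using run(1) unfolding computes_def X_def n_def by blast
qed

section \<open>From APSP to reverse ranks\<close>

definition violated :: "(int \<Rightarrow> int) \<Rightarrow> (int \<Rightarrow> int) \<Rightarrow> int \<Rightarrow> int \<Rightarrow> int \<Rightarrow> int \<Rightarrow> bool" where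
  "violated A T N i j k \<longleftrightarrow> A (i * N + k) + A (k * N + j) < T (i * N + j)"

text \<open>Marking a pair means setting its threshold to 0, which no sum of nonnegative weights is below.\<close>

definition refines :: "(int \<Rightarrow> int) \<Rightarrow> int \<Rightarrow> (int \<Rightarrow> int) \<Rightarrow> (int \<Rightarrow> int) \<Rightarrow> bool" where
  "refines A N T T' \<longleftrightarrow> (\<forall>z. T' z = T z \<or> T' z = 0 \<and>
     (\<exists>i j k. i \<in> {0..<N} \<and> j \<in> {0..<N} \<and> k \<in> {0..<N} \<and> z = i * N + j \<and> violated A T N i j k))"

lemma refines_refl [simp]: "refines A N T T"
  by (simp add: refines_def)

lemma refinesD: "refines A N T T' \<Longrightarrow> T' z = T z \<or> T' z = 0"
  by (auto simp: refines_def)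

text \<open>Marking removes violations but never creates one, so whatever has been cleared in one
  block stays cleared while others are processed.\<close>

lemma violated_refines:
  assumes "refines A N T T'" "violated A T' N i j k" "\<And>z. 0 \<le> A z" shows "violated A T N i j k"
  using refinesD[OF assms(1), of "i * N + j"] assms(2) assms(3)[of "i * N + k"] assms(3)[of "k * N + j"]
  by (auto simp: violated_def)

lemma refines_trans:
  assumes 1: "refines A N T T'" and 2: "refines A N T' T''" and A: "\<And>z. 0 \<le> A z"
  shows "refines A N T T''"
  unfolding refines_def
proof
  fix z
  from 2 consider "T'' z = T' z" | i j k where "T'' z = 0" "i \<in> {0..<N}" "j \<in> {0..<N}" "k \<in> {0..<N}" "z = i * N + j" "violated A T' N i j k"
    unfolding refines_def by blast
  then show "T'' z = T z \<or> T'' z = 0 \<and>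
     (\<exists>i j k. i \<in> {0..<N} \<and> j \<in> {0..<N} \<and> k \<in> {0..<N} \<and> z = i * N + j \<and> violated A T N i j k)"
  proof cases
    case 1
    then show ?thesis using assms(1) by (auto simp: refines_def)
  next
    case 2
    then show ?thesis using violated_refines[OF 1 2(6) A] by blast
  qed
qed

lemma refines_update:
  assumes "violated A T N i j k" "i \<in> {0..<N}" "j \<in> {0..<N}" "k \<in> {0..<N}"
  shows "refines A N T (T(i * N + j := 0))"
  using assms by (auto simp: refines_def)

definition pending :: "int \<Rightarrow> (int \<Rightarrow> int) \<Rightarrow> nat" where
  "pending NN T = card {z \<in> {0..<NN}. T z \<noteq> 0}"

lemma pending_subset:
  assumes "refines A N T T'" shows "{z \<in> {0..<NN}. T' z \<noteq> 0} \<subseteq> {z \<in> {0..<NN}. T z \<noteq> 0}"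
proof
  fix z assume "z \<in> {z \<in> {0..<NN}. T' z \<noteq> 0}"
  then show "z \<in> {z \<in> {0..<NN}. T z \<noteq> 0}" using refinesD[OF assms, of z] by auto
qed

lemma finite_pending: "finite {z \<in> {0..<NN :: int}. T z \<noteq> (0::int)}"
  by (rule finite_subset[of _ "{0..<NN}"]) auto

lemma pending_less:
  assumes "refines A N T T'" "z \<in> {0..<NN}" "T z \<noteq> 0" "T' z = 0"
  shows "pending NN T' + 1 \<le> pending NN T"
proof -
  have "z \<in> {z \<in> {0..<NN}. T z \<noteq> 0}" "z \<notin> {z \<in> {0..<NN}. T' z \<noteq> 0}"
    using assms(2-4) by auto
  then have "{z \<in> {0..<NN}. T' z \<noteq> 0} \<subset> {z \<in> {0..<NN}. T z \<noteq> 0}"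
    using pending_subset[OF assms(1)] by blast
  then have "card {z \<in> {0..<NN}. T' z \<noteq> 0} < card {z \<in> {0..<NN}. T z \<noteq> 0}"
    by (rule psubset_card_mono[OF finite_pending])
  then show ?thesis by (simp add: pending_def)
qed

lemma pending_le: "pending NN T \<le> nat NN"
proof -
  have "card {z \<in> {0..<NN}. T z \<noteq> 0} \<le> card {0..<NN}" by (intro card_mono) auto
  then show ?thesis by (simp add: pending_def)
qed

section \<open>The program for APSP\<close>

definition order_ends :: com where
  "order_ends =
    ''l'' ::= Div (Var ''x'') (Var ''m'') ;;
    ''h'' ::= Mod (Var ''x'') (Var ''m'') ;;
    Cond (Less (Var ''h'') (Var ''l''))
      (''l'' ::= Mod (Var ''x'') (Var ''m'') ;; ''h'' ::= Div (Var ''x'') (Var ''m'')) Skip"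

definition split_ends :: com where
  "split_ends =
    ''p'' ::= Div (Var ''l'') (Var ''s'') ;;
    ''o'' ::= Div (Var ''h'') (Var ''s'') ;;
    ''i'' ::= Mod (Var ''l'') (Var ''s'') ;;
    ''j'' ::= Mod (Var ''h'') (Var ''s'')"

definition arc_value :: com where
  "arc_value =
    Cond (Conj (Equal (Var ''p'') (Const 0)) (Equal (Var ''o'') (Const 1)))
      (''v'' ::= Var ''H'' \<oplus> Const 2 \<otimes> Elem ''A'' ((Var ''I'' \<oplus> Var ''i'') \<otimes> Var ''N'' \<oplus> (Var ''K'' \<oplus> Var ''j'')))
    (Cond (Conj (Equal (Var ''p'') (Const 1)) (Equal (Var ''o'') (Const 2)))
      (''v'' ::= Var ''H'' \<oplus> Const 2 \<otimes> Elem ''A'' ((Var ''K'' \<oplus> Var ''i'') \<otimes> Var ''N'' \<oplus> (Var ''J'' \<oplus> Var ''j'')))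
    (Cond (Conj (Equal (Var ''p'') (Const 2)) (Equal (Var ''o'') (Const 3)))
      (''v'' ::= Var ''H'' \<ominus> Const 2 \<otimes> Elem ''T'' ((Var ''I'' \<oplus> Var ''j'') \<otimes> Var ''N'' \<oplus> (Var ''J'' \<oplus> Var ''i'')))
    (Cond (Conj (Equal (Var ''p'') (Const 0)) (Equal (Var ''o'') (Const 3)))
      (Cond (Equal (Var ''i'') (Var ''j'')) (''v'' ::= Const 0) (''v'' ::= Const 2 \<otimes> Var ''H''))
    (Cond (Conj (Equal (Var ''p'') (Const 0)) (Equal (Var ''o'') (Const 4)))
      (''v'' ::= Const 3 \<otimes> Var ''H'' \<ominus> Const 1)
      (''v'' ::= Const 0)))))"

definition arc_step :: com where
  "arc_step = order_ends ;; split_ends ;; arc_value ;; Store ''q'' (Const 1 \<oplus> Var ''x'') (Var ''v'')"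

definition flag_step :: com where
  "flag_step = Cond (Less (Var ''x'') (Const 3 \<otimes> Var ''s''))
     (Store ''q'' (Const 1 \<oplus> Var ''mm'' \<oplus> Var ''x'') (Const 0))
     (Store ''q'' (Const 1 \<oplus> Var ''mm'' \<oplus> Var ''x'') (Const 1))"

definition pair_step :: com where
  "pair_step =
    ''j'' ::= Div (Var ''z'') (Var ''s'') ;;
    ''k'' ::= Mod (Var ''z'') (Var ''s'') ;;
    Cond (Less (Elem ''A'' ((Var ''I'' \<oplus> Var ''i'') \<otimes> Var ''N'' \<oplus> (Var ''K'' \<oplus> Var ''k'')) \<oplus>
                Elem ''A'' ((Var ''K'' \<oplus> Var ''k'') \<otimes> Var ''N'' \<oplus> (Var ''J'' \<oplus> Var ''j'')))
               (Elem ''T'' ((Var ''I'' \<oplus> Var ''i'') \<otimes> Var ''N'' \<oplus> (Var ''J'' \<oplus> Var ''j''))))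
      (Store ''T'' ((Var ''I'' \<oplus> Var ''i'') \<otimes> Var ''N'' \<oplus> (Var ''J'' \<oplus> Var ''j'')) (Const 0)) Skip"

definition row_step :: com where
  "row_step = Cond (Less (Var ''s'') (Elem ''r'' (Var ''i''))) (For ''z'' ''ss'' pair_step) Skip"

definition build_query :: com where
  "build_query =
    For ''x'' ''mm'' arc_step ;;
    For ''x'' ''m'' flag_step ;;
    Store ''q'' (Const 0) (Var ''m'') ;;
    Store ''q'' (Const 1 \<oplus> Var ''mm'' \<oplus> Var ''m'') (Var ''m'' \<ominus> Const 1)"

text \<open>The base-\<open>g\<close> digits of the round number \<open>w\<close> are the three
  blocks; multiplied by \<open>s\<close> they become the offsets of their first indices.\<close>

definition triple_step :: com where
  "triple_step =
    ''I'' ::= Div (Var ''w'') (Var ''g'' \<otimes> Var ''g'') \<otimes> Var ''s'' ;;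
    ''J'' ::= Mod (Div (Var ''w'') (Var ''g'')) (Var ''g'') \<otimes> Var ''s'' ;;
    ''K'' ::= Mod (Var ''w'') (Var ''g'') \<otimes> Var ''s'' ;;
    build_query ;;
    Query ''q'' (Const 2 \<oplus> Var ''mm'' \<oplus> Var ''m'') ''r'' ;;
    For ''i'' ''s'' row_step"

text \<open>With the halved \<open>b\<close>, each minimum lies in \<open>{C..<C + 2 * b}\<close>
  beforehand. A threshold \<open>C + b\<close> that gets marked puts the minimum into the lower
  half; one that survives is positive, since \<open>b \<ge> 1\<close>, and becomes the new lower
  end.\<close>

definition bit_step :: com where
  "bit_step =
    ''b'' ::= Div (Var ''b'') (Const 2) ;;
    For ''z'' ''NN'' (Store ''T'' (Var ''z'') (Elem ''C'' (Var ''z'') \<oplus> Var ''b'')) ;;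
    For ''w'' ''ggg'' triple_step ;;
    For ''z'' ''NN'' (Cond (Less (Const 0) (Elem ''T'' (Var ''z''))) (Store ''C'' (Var ''z'') (Elem ''T'' (Var ''z''))) Skip)"

definition min_plus_square :: com where
  "min_plus_square =
    For ''z'' ''NN'' (Store ''C'' (Var ''z'') (Const 0)) ;;
    ''b'' ::= Var ''P'' ;;
    While (Less (Const 1) (Var ''b'')) bit_step ;;
    For ''z'' ''NN'' (Store ''A'' (Var ''z'') (Elem ''C'' (Var ''z'')))"

text \<open>The diagonal is treated before the edges, as a loop must not hide the distance 0.
  \<open>F\<close> stands for infinity and also fills the off-diagonal cells of the padding indices
  from \<open>n\<close> to \<open>N - 1\<close>.\<close>

definition init_cell :: com where
  "init_cell =
    Cond (Equal (Var ''i'') (Var ''j'')) (Store ''A'' (Var ''z'') (Const 0))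
      (Cond (Conj (Less (Var ''i'') (Var ''n'')) (Conj (Less (Var ''j'') (Var ''n''))
          (Less (Const 0) (Elem ''in'' (Const 1 \<oplus> (Var ''i'' \<otimes> Var ''n'' \<oplus> Var ''j''))))))
        (Store ''A'' (Var ''z'') (Elem ''in'' (Const 1 \<oplus> (Var ''i'' \<otimes> Var ''n'' \<oplus> Var ''j''))))
        (Store ''A'' (Var ''z'') (Var ''F'')))"

definition init_step :: com where
  "init_step =
    ''i'' ::= Div (Var ''z'') (Var ''N'') ;;
    ''j'' ::= Mod (Var ''z'') (Var ''N'') ;;
    init_cell"

definition output_step :: com where
  "output_step =
    ''i'' ::= Div (Var ''z'') (Var ''n'') ;;
    ''j'' ::= Mod (Var ''z'') (Var ''n'') ;;
    ''w'' ::= Elem ''A'' (Var ''i'' \<otimes> Var ''N'' \<oplus> Var ''j'') ;;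
    Cond (Less (Var ''w'') (Var ''F'')) (Store ''out'' (Var ''z'') (Var ''w''))
      (Store ''out'' (Var ''z'') (Const (-1)))"

definition max_loop :: com where
  "max_loop = For ''z'' ''nn'' (Cond (Less (Var ''M'') (Elem ''in'' (Const 1 \<oplus> Var ''z'')))
    (''M'' ::= Elem ''in'' (Const 1 \<oplus> Var ''z'')) Skip)"

definition root_loop :: com where
  "root_loop = While (Neg (Less (Var ''n'')
      ((Var ''s'' \<oplus> Const 1) \<otimes> (Var ''s'' \<oplus> Const 1) \<otimes> (Var ''s'' \<oplus> Const 1))))
    (''s'' ::= Var ''s'' \<oplus> Const 1)"

text \<open>The index set is padded from \<open>n\<close> to \<open>N = g * s\<close>, so that all
  blocks are full; \<open>n div s + 1\<close> blocks spare a ceiling, at the price of a whole block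
  of padding when \<open>s\<close> divides \<open>n\<close>. The bound \<open>M\<close> is not part
  of the input and is read off the matrix. \<open>P\<close> is a power of two so that halving ends
  at 1.\<close>

definition prepare :: com where
  "prepare =
    ''n'' ::= Elem ''in'' (Const 0) ;;
    ''nn'' ::= Var ''n'' \<otimes> Var ''n'' ;;
    ''s'' ::= Const 1 ;;
    root_loop ;;
    ''M'' ::= Const 1 ;;
    max_loop ;;
    ''g'' ::= Div (Var ''n'') (Var ''s'') \<oplus> Const 1 ;;
    ''ggg'' ::= Var ''g'' \<otimes> Var ''g'' \<otimes> Var ''g'' ;;
    ''N'' ::= Var ''g'' \<otimes> Var ''s'' ;;
    ''NN'' ::= Var ''N'' \<otimes> Var ''N'' ;;
    ''m'' ::= Const 4 \<otimes> Var ''s'' \<oplus> Const 1 ;;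
    ''mm'' ::= Var ''m'' \<otimes> Var ''m'' ;;
    ''ss'' ::= Var ''s'' \<otimes> Var ''s'' ;;
    ''F'' ::= Var ''n'' \<otimes> Var ''M'' \<oplus> Const 1 ;;
    ''P'' ::= Const 1 ;;
    While (Neg (Less (Var ''F'') (Var ''P''))) (''P'' ::= Var ''P'' \<oplus> Var ''P'') ;;
    ''H'' ::= Const 16 \<otimes> Var ''P''"

definition apsp_prog :: com where
  "apsp_prog =
    prepare ;;
    For ''z'' ''NN'' init_step ;;
    ''e'' ::= Const 1 ;;
    While (Less (Var ''e'') (Var ''n'')) (min_plus_square ;; ''e'' ::= Var ''e'' \<oplus> Var ''e'') ;;
    For ''z'' ''nn'' output_step ;;
    ''len'' ::= Var ''nn''"

lemma mods:
  "mod_vars order_ends = {''l'', ''h''}" "mod_arrs order_ends = {}"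
  "mod_vars split_ends = {''p'', ''o'', ''i'', ''j''}" "mod_arrs split_ends = {}"
  "mod_vars arc_value = {''v''}" "mod_arrs arc_value = {}"
  by (auto simp: order_ends_def split_ends_def arc_value_def)

lemma mods_arc_step [simp]:
  "mod_vars arc_step = {''l'', ''h'', ''p'', ''o'', ''i'', ''j'', ''v''}" "mod_arrs arc_step = {''q''}"
  by (auto simp: arc_step_def mods)

lemma mods_flag_step [simp]: "mod_vars flag_step = {}" "mod_arrs flag_step = {''q''}"
  by (auto simp: flag_step_def)

lemma mods_pair_step [simp]: "mod_vars pair_step = {''j'', ''k''}" "mod_arrs pair_step = {''T''}"
  by (auto simp: pair_step_def)

lemma mods_row_step [simp]: "mod_vars row_step = {''z'', ''j'', ''k''}" "mod_arrs row_step = {''T''}"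
  by (auto simp: row_step_def)

lemma mods_build_query [simp]:
  "mod_vars build_query = {''x'', ''l'', ''h'', ''p'', ''o'', ''i'', ''j'', ''v''}" "mod_arrs build_query = {''q''}"
  by (auto simp: build_query_def)

lemma mods_triple_step [simp]:
  "mod_vars triple_step = {''I'', ''J'', ''K'', ''x'', ''l'', ''h'', ''p'', ''o'', ''i'', ''j'', ''v'', ''z'', ''k''}"
  "mod_arrs triple_step = {''q'', ''r'', ''T''}"
  by (auto simp: triple_step_def)

lemma mods_bit_step [simp]:
  "mod_vars bit_step = {''b'', ''w'', ''I'', ''J'', ''K'', ''x'', ''l'', ''h'', ''p'', ''o'', ''i'', ''j'', ''v'', ''z'', ''k''}"
  "mod_arrs bit_step = {''q'', ''r'', ''T'', ''C''}"
  by (auto simp: bit_step_def)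

lemma mods_min_plus_square [simp]:
  "mod_vars min_plus_square =
     {''b'', ''w'', ''I'', ''J'', ''K'', ''x'', ''l'', ''h'', ''p'', ''o'', ''i'', ''j'', ''v'', ''z'', ''k''}"
  "mod_arrs min_plus_square = {''q'', ''r'', ''T'', ''C'', ''A''}"
  by (auto simp: min_plus_square_def)

lemma mods_init_step [simp]: "mod_vars init_step = {''i'', ''j''}" "mod_arrs init_step = {''A''}"
  by (auto simp: init_step_def init_cell_def)

lemma mods_output_step [simp]: "mod_vars output_step = {''i'', ''j'', ''w''}" "mod_arrs output_step = {''out''}"
  by (auto simp: output_step_def)

lemma mods_max_loop [simp]: "mod_vars max_loop = {''z'', ''M''}" "mod_arrs max_loop = {}"
  by (auto simp: max_loop_def)

lemma mods_root_loop [simp]: "mod_vars root_loop = {''s''}" "mod_arrs root_loop = {}"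
  by (auto simp: root_loop_def)

lemma mod_arrs_prepare [simp]: "mod_arrs prepare = {}"
  by (simp add: prepare_def)

lemma div_mod_unique:
  assumes "(0::int) \<le> c" "c < g" shows "(a * g + c) div g = a" "(a * g + c) mod g = c"
  using assms by auto

lemma div_less_of_less_mult:
  assumes "z < a * b" "(0::int) < b" shows "z div b < a"
proof (rule ccontr)
  assume "\<not> z div b < a"
  then have "a * b \<le> z div b * b" using assms by (intro mult_right_mono) auto
  moreover have "z div b * b \<le> z" using assms by (simp add: minus_mod_eq_div_mult[symmetric])
  ultimately show False using assms(1) by linarith
qed

section \<open>Writing a query for a triple of blocks\<close>

locale apsp_machine = bounded_machine +
  fixes \<kappa> :: kind and n g N F P H :: int and s :: nat
  assumes orac: "oracle_for (reverse_rank_single_source \<kappa>) Q"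
    and s: "1 \<le> s" and g: "1 \<le> g" and n: "1 \<le> n" and N: "N = g * int s" "n \<le> N"
    and F: "1 \<le> F" "F < P" and H: "H = 16 * P"
    and X: "4 * H \<le> X" "N * N \<le> X" "g * g * g \<le> X"
      "2 + (4 * int s + 1) * (4 * int s + 1) + (4 * int s + 1) \<le> X"
begin

definition m :: nat where "m = 4 * s + 1"

definition env :: "state \<Rightarrow> bool" where
  "env st \<longleftrightarrow> var st ''n'' = n \<and> var st ''nn'' = n * n \<and> var st ''s'' = int s \<and> var st ''ss'' = int s * int s \<and>
     var st ''g'' = g \<and> var st ''ggg'' = g * g * g \<and> var st ''N'' = N \<and> var st ''NN'' = N * N \<and>
     var st ''m'' = int m \<and> var st ''mm'' = int m * int m \<and> var st ''F'' = F \<and> var st ''P'' = P \<and>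
     var st ''H'' = H"

text \<open>The variables that stay fixed once \<open>prepare\<close> is done. Disjointness of the
  written variables from this set preserves all of \<open>env\<close> at once.\<close>

definition params :: "vname set" where
  "params = {''n'', ''nn'', ''s'', ''ss'', ''g'', ''ggg'', ''N'', ''NN'', ''m'', ''mm'', ''F'', ''P'', ''H''}"

lemma env_agree:
  assumes "agree V A st st'" "env st" and "V \<inter> params = {}"
  shows "env st'"
proof -
  have *: "var st' x = var st x" if "x \<in> params" for x
    using agree_var[OF assms(1), of x] that assms(3) by blast
  show ?thesis
    using assms(2) unfolding env_def
    by (simp only: *[unfolded params_def] insert_iff simp_thms)
qed

text \<open>The bounds are required at every index, also outside the matrix, so that entries can be
  passed to the gadget without index checks.\<close>

definition weights_ok :: "(int \<Rightarrow> int) \<Rightarrow> bool" where "weights_ok A \<longleftrightarrow> (\<forall>z. 0 \<le> A z \<and> A z \<le> F)"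
definition thresholds_ok :: "(int \<Rightarrow> int) \<Rightarrow> bool" where "thresholds_ok T \<longleftrightarrow> (\<forall>z. 0 \<le> T z \<and> T z \<le> P)"

abbreviation arc_of :: "(int \<Rightarrow> int) \<Rightarrow> (int \<Rightarrow> int) \<Rightarrow> int \<Rightarrow> int \<Rightarrow> int \<Rightarrow> int \<Rightarrow> int \<Rightarrow> int" where
  "arc_of A T I J K \<equiv> gadget_len (int s) H
     (\<lambda>i k. A ((I + i) * N + (K + k))) (\<lambda>k j. A ((K + k) * N + (J + j))) (\<lambda>i j. T ((I + i) * N + (J + j)))"

lemma wp_order_ends:
  assumes m: "var st ''m'' = int m" and x: "var st ''x'' = x"
    and R: "\<And>st' t'. var st' ''l'' = min (x div int m) (x mod int m) \<Longrightarrow> var st' ''h'' = max (x div int m) (x mod int m) \<Longrightarrow>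
      agree {''l'', ''h''} {} st st' \<Longrightarrow> t' \<le> t + 5 \<Longrightarrow> R st' t' qs"
  shows "wp order_ends st t qs R"
proof (rule wp_bounded)
  assume bd: "bounded X st"
  have mp: "0 < int m" by (simp add: m_def)
  have b: "\<bar>x div int m\<bar> \<le> X" "\<bar>x mod int m\<bar> \<le> X"
    using abs_div_int_le[of x "int m"] bounded_var[OF bd, of "''x''"] x
      pos_mod_sign[OF mp, of x] pos_mod_bound[OF mp, of x] bounded_var[OF bd, of "''m''"] m by auto
  show ?thesis
    unfolding order_ends_def
    apply (intro wp_Seq wp_Assign wp_Cond wp_Skip)
    using b m x by (auto intro!: R simp: agree_def)
qed

lemma wp_split_ends:
  assumes st: "var st ''s'' = int s" "var st ''l'' = l" "var st ''h'' = h"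
    and R: "\<And>st' t'. var st' ''p'' = l div int s \<Longrightarrow> var st' ''o'' = h div int s \<Longrightarrow>
      var st' ''i'' = l mod int s \<Longrightarrow> var st' ''j'' = h mod int s \<Longrightarrow>
      agree {''p'', ''o'', ''i'', ''j''} {} st st' \<Longrightarrow> t' \<le> t + 4 \<Longrightarrow> R st' t' qs"
  shows "wp split_ends st t qs R"
proof (rule wp_bounded)
  assume bd: "bounded X st"
  have mp: "0 < int s" using s by simp
  have b: "\<bar>y div int s\<bar> \<le> X" "\<bar>y mod int s\<bar> \<le> X" if "\<bar>y\<bar> \<le> X" for y
    using abs_div_int_le[of y "int s"] that
      pos_mod_sign[OF mp, of y] pos_mod_bound[OF mp, of y] bounded_var[OF bd, of "''s''"] st by auto
  have "\<bar>l\<bar> \<le> X" "\<bar>h\<bar> \<le> X" using bounded_var[OF bd] st by metis+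
  note b = this[THEN b(1)] this[THEN b(2)]
  show ?thesis
    unfolding split_ends_def
    apply (intro wp_Seq wp_Assign)
    using b st by (auto intro!: R simp: agree_def)
qed

lemma wp_arc_value:
  assumes env: "env st" and st: "var st ''I'' = I" "var st ''J'' = J" "var st ''K'' = K" "arr st ''A'' = A" "arr st ''T'' = T"
    and ok: "weights_ok A" "thresholds_ok T"
    and lh: "l = min x y" "h = max x y" "var st ''p'' = l div int s" "var st ''o'' = h div int s"
      "var st ''i'' = l mod int s" "var st ''j'' = h mod int s"
    and R: "\<And>st' t'. var st' ''v'' = arc_of A T I J K x y \<Longrightarrow>
      agree {''v''} {} st st' \<Longrightarrow> t' \<le> t + 7 \<Longrightarrow> R st' t' qs"
  shows "wp arc_value st t qs R"
proof -
  have A: "0 \<le> A z" "A z \<le> F" and T: "0 \<le> T z" "T z \<le> P" for z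
    using ok by (auto simp: weights_ok_def thresholds_ok_def)
  have b: "\<bar>H + 2 * A z\<bar> \<le> X" "\<bar>H - 2 * T z\<bar> \<le> X" "\<bar>2 * H\<bar> \<le> X" "\<bar>3 * H - 1\<bar> \<le> X" "\<bar>0\<bar> \<le> X" for z
    using A[of z] T[of z] F H X by auto
  have V: "R (st\<lparr>var := (var st)(''v'' := arc_of A T I J K x y)\<rparr>) t' qs" if "t' \<le> t + 7" for t'
    using that by (intro R) (auto simp: agree_def)
  have [simp]: "var st ''H'' = H" "var st ''N'' = N" using env by (auto simp: env_def)
  define p q i j where "p = l div int s" "q = h div int s" "i = l mod int s" "j = h mod int s"
  have [simp]: "var st ''p'' = p" "var st ''o'' = q" "var st ''i'' = i" "var st ''j'' = j"
    using lh by (simp_all add: p_q_i_j_def)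
  have arc: "arc_of A T I J K x y = (if p = 0 \<and> q = 1 then H + 2 * A ((I + i) * N + (K + j))
     else if p = 1 \<and> q = 2 then H + 2 * A ((K + i) * N + (J + j))
     else if p = 2 \<and> q = 3 then H - 2 * T ((I + j) * N + (J + i))
     else if p = 0 \<and> q = 3 then if i = j then 0 else 2 * H
     else if p = 0 \<and> q = 4 then 3 * H - 1
     else 0)"
    unfolding gadget_len_def Let_def p_q_i_j_def lh(1,2) by simp
  show ?thesis
  proof (cases "p = 0 \<and> q = 1")
    case True
    then show ?thesis unfolding arc_value_def
      using V[of "t + 1 + 1"] b(1) by (intro wp_Cond wp_Assign) (simp_all add: arc st)
  next
    case n1: False
    show ?thesis
    proof (cases "p = 1 \<and> q = 2")
      case True
      then show ?thesis unfolding arc_value_def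
        using V[of "t + 1 + 1 + 1"] b(1) by (intro wp_Cond wp_Assign) (simp_all add: arc st)
    next
      case n2: False
      show ?thesis
      proof (cases "p = 2 \<and> q = 3")
        case True
        then show ?thesis unfolding arc_value_def
          using V[of "t + 1 + 1 + 1 + 1"] b(2) by (intro wp_Cond wp_Assign) (simp_all add: arc st)
      next
        case n3: False
        show ?thesis
        proof (cases "p = 0 \<and> q = 3")
          case True
          then show ?thesis unfolding arc_value_def
            using V[of "t + 1 + 1 + 1 + 1 + 1 + 1"] b(3,5) by (intro wp_Cond wp_Assign) (simp_all add: arc st split: if_splits)
        next
          case n4: False
          have eq: "bval (Conj (Equal (Var y) (Const c)) (Equal (Var y') (Const c'))) st \<longleftrightarrow> var st y = c \<and> var st y' = c'" for y c y' c'
            by auto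
          show ?thesis unfolding arc_value_def
            using V[of "t + 1 + 1 + 1 + 1 + 1 + 1"] b(4,5) n1 n2 n3 n4
            by (intro wp_Cond wp_Assign) (simp_all only: eq, simp_all add: arc st split: if_splits)
        qed
      qed
    qed
  qed
qed

lemma wp_arc_step:
  assumes env: "env st" and st: "var st ''I'' = I" "var st ''J'' = J" "var st ''K'' = K" "arr st ''A'' = A" "arr st ''T'' = T"
    and ok: "weights_ok A" "thresholds_ok T" and x: "var st ''x'' = x"
    and R: "\<And>st' t'. arr st' ''q'' = (arr st ''q'')(1 + x := arc_of A T I J K (x div int m) (x mod int m)) \<Longrightarrow>
      agree {''l'', ''h'', ''p'', ''o'', ''i'', ''j'', ''v''} {''q''} st st' \<Longrightarrow> t' \<le> t + 17 \<Longrightarrow> R st' t' qs"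
  shows "wp arc_step st t qs R"
proof -
  let ?V = "{''l'', ''h'', ''p'', ''o'', ''i'', ''j'', ''v''}"
  have m: "var st ''m'' = int m" using env by (simp add: env_def)
  show ?thesis
    unfolding arc_step_def
  proof (rule wp_Seq, rule wp_order_ends[OF m x])
    fix st1 t1
    assume 1: "var st1 ''l'' = min (x div int m) (x mod int m)" "var st1 ''h'' = max (x div int m) (x mod int m)"
      and ag1: "agree {''l'', ''h''} {} st st1" and t1: "t1 \<le> t + 5"
    have env1: "env st1" using env_agree[OF ag1 env] by (simp add: params_def)
    then have s1: "var st1 ''s'' = int s" by (simp add: env_def)
    show "wp (split_ends ;; arc_value ;; Store ''q'' (Const 1 \<oplus> Var ''x'') (Var ''v'')) st1 t1 qs R"
    proof (rule wp_Seq, rule wp_split_ends[OF s1 1])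
      fix st2 t2
      assume 2: "var st2 ''p'' = min (x div int m) (x mod int m) div int s"
        "var st2 ''o'' = max (x div int m) (x mod int m) div int s"
        "var st2 ''i'' = min (x div int m) (x mod int m) mod int s"
        "var st2 ''j'' = max (x div int m) (x mod int m) mod int s"
        and ag2: "agree {''p'', ''o'', ''i'', ''j''} {} st1 st2" and t2: "t2 \<le> t1 + 4"
      have env2: "env st2" using env_agree[OF ag2 env1] by (simp add: params_def)
      have st2: "var st2 ''I'' = I" "var st2 ''J'' = J" "var st2 ''K'' = K" "arr st2 ''A'' = A" "arr st2 ''T'' = T"
        using agree_var[OF ag1] agree_var[OF ag2] agree_arr[OF ag1] agree_arr[OF ag2] st by simp_all
      show "wp (arc_value ;; Store ''q'' (Const 1 \<oplus> Var ''x'') (Var ''v'')) st2 t2 qs R"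
      proof (rule wp_Seq, rule wp_arc_value[OF env2 st2 ok refl refl 2])
        fix st3 t3
        assume 3: "var st3 ''v'' = arc_of A T I J K (x div int m) (x mod int m)"
          and ag3: "agree {''v''} {} st2 st3" and t3: "t3 \<le> t2 + 7"
        have ag: "agree ?V {''q''} st st3"
          by (rule agree_trans[OF agree_trans[OF agree_mono[OF ag1] agree_mono[OF ag2]] agree_mono[OF ag3]]) auto
        have x3: "var st3 ''x'' = x" using agree_var[OF ag, of "''x''"] x by simp
        have q3: "arr st3 ''q'' = arr st ''q''"
          using agree_arr[OF ag1] agree_arr[OF ag2] agree_arr[OF ag3] by simp
        show "wp (Store ''q'' (Const 1 \<oplus> Var ''x'') (Var ''v'')) st3 t3 qs R"
        proof (rule wp_Store)
          show "\<bar>aval (Var ''v'') st3\<bar> \<le> X" if "bounded X st3" using bounded_var[OF that] by simp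
          show "R (st3\<lparr>arr := (arr st3)(''q'' := (arr st3 ''q'')(aval (Const 1 \<oplus> Var ''x'') st3 := aval (Var ''v'') st3))\<rparr>) (t3 + 1) qs"
          proof (rule R)
            show "agree ?V {''q''} st (st3\<lparr>arr := (arr st3)(''q'' := (arr st3 ''q'')(aval (Const 1 \<oplus> Var ''x'') st3 := aval (Var ''v'') st3))\<rparr>)"
              using ag by (simp add: agree_def)
          qed (use t1 t2 t3 in \<open>auto simp: x3 q3 3\<close>)
        qed simp_all
      qed
    qed
  qed
qed

text \<open>A flat list, to be compared with the array cell by cell; \<open>query_answer\<close>
  identifies it with the encoding of the gadget instance.\<close>

definition query_of :: "(int \<Rightarrow> int) \<Rightarrow> (int \<Rightarrow> int) \<Rightarrow> int \<Rightarrow> int \<Rightarrow> int \<Rightarrow> int list" where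
  "query_of A T I J K = int m # map (\<lambda>z. arc_of A T I J K (int (z div m)) (int (z mod m))) [0..<m * m] @
     map (\<lambda>z. if z < 3 * s then 0 else 1) [0..<m] @ [int (4 * s)]"

lemma length_query_of: "length (query_of A T I J K) = 2 + m * m + m"
  by (simp add: query_of_def)

lemma query_of_nth:
  "query_of A T I J K ! 0 = int m"
  "z < m * m \<Longrightarrow> query_of A T I J K ! (1 + z) = arc_of A T I J K (int (z div m)) (int (z mod m))"
  "z < m \<Longrightarrow> query_of A T I J K ! (1 + m * m + z) = (if z < 3 * s then 0 else 1)"
  "query_of A T I J K ! (1 + m * m + m) = int (4 * s)"
  by (auto simp: query_of_def nth_append)

lemma wp_arcs:
  assumes env: "env st" and st: "var st ''I'' = I" "var st ''J'' = J" "var st ''K'' = K" "arr st ''A'' = A" "arr st ''T'' = T"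
    and ok: "weights_ok A" "thresholds_ok T"
    and R: "\<And>st' t'. (\<And>z. z < m * m \<Longrightarrow> arr st' ''q'' (1 + int z) = query_of A T I J K ! (1 + z)) \<Longrightarrow>
      agree {''x'', ''l'', ''h'', ''p'', ''o'', ''i'', ''j'', ''v''} {''q''} st st' \<Longrightarrow> t' \<le> t + 19 * (m * m) + 2 \<Longrightarrow> R st' t' qs"
  shows "wp (For ''x'' ''mm'' arc_step) st t qs R"
proof -
  have mm: "int (m * m) = var st ''mm''" using env by (simp add: env_def)
  let ?I = "\<lambda>k st' t' qs'. (\<forall>z. 0 \<le> z \<and> z < k \<longrightarrow> arr st' ''q'' (1 + z) = arc_of A T I J K (z div int m) (z mod int m))
    \<and> qs' = qs \<and> t' \<le> t + 19 * nat k"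
  show ?thesis
  proof (rule wp_For[where I = ?I, OF _ _ _ mm])
    fix k st1 t1 qs1
    assume k: "0 \<le> k" "k < int (m * m)" "var st1 ''x'' = k" and ag: "agree (insert ''x'' (mod_vars arc_step)) (mod_arrs arc_step) st st1"
      and I: "?I k st1 t1 qs1"
    have env1: "env st1" using env_agree[OF ag env] by (simp add: params_def)
    have st1: "var st1 ''I'' = I" "var st1 ''J'' = J" "var st1 ''K'' = K" "arr st1 ''A'' = A" "arr st1 ''T'' = T"
      using agree_var[OF ag] agree_arr[OF ag] st by simp_all
    show "wp arc_step st1 t1 qs1 (\<lambda>st2 t2 qs2. ?I (k + 1) (st2\<lparr>var := (var st2)(''x'' := k + 1)\<rparr>) (t2 + 2) qs2)"
    proof (rule wp_arc_step[OF env1 st1 ok k(3)])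
      fix st2 t2
      assume q: "arr st2 ''q'' = (arr st1 ''q'')(1 + k := arc_of A T I J K (k div int m) (k mod int m))"
        and t2: "t2 \<le> t1 + 17"
      have "arr st2 ''q'' (1 + z) = arc_of A T I J K (z div int m) (z mod int m)" if "0 \<le> z \<and> z < k + 1" for z
        using I that unfolding q by (cases "z = k") auto
      moreover have "t2 + 2 \<le> t + 19 * nat (k + 1)" using I t2 k(1) by (simp add: nat_add_distrib)
      ultimately show "?I (k + 1) (st2\<lparr>var := (var st2)(''x'' := k + 1)\<rparr>) (t2 + 2) qs1"
        using I by simp
    qed
  next
    fix st1 t1 qs1
    assume ag: "agree (insert ''x'' (mod_vars arc_step)) (mod_arrs arc_step) st st1" and I: "?I (int (m * m)) st1 t1 qs1"
    have "arr st1 ''q'' (1 + int z) = query_of A T I J K ! (1 + z)" if "z < m * m" for z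
    proof -
      have "arr st1 ''q'' (1 + int z) = arc_of A T I J K (int z div int m) (int z mod int m)"
        using I that by (simp del: of_nat_mult)
      then show ?thesis unfolding query_of_nth(2)[OF that] by (simp add: zdiv_int zmod_int)
    qed
    moreover have "t1 + 2 \<le> t + 19 * (m * m) + 2" using I by (simp add: nat_mult_distrib)
    ultimately show "R st1 (t1 + 2) qs1" using R ag I by simp
  qed simp_all
qed

lemma wp_flags:
  assumes env: "env st"
    and R: "\<And>st' t'. (\<And>z. z < m \<Longrightarrow> arr st' ''q'' (1 + int (m * m) + int z) = (if z < 3 * s then 0 else 1)) \<Longrightarrow>
      (\<And>z. z < 1 + int (m * m) \<Longrightarrow> arr st' ''q'' z = arr st ''q'' z) \<Longrightarrow>
      agree {''x''} {''q''} st st' \<Longrightarrow> t' \<le> t + 4 * m + 2 \<Longrightarrow> R st' t' qs"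
  shows "wp (For ''x'' ''m'' flag_step) st t qs R"
proof -
  have mm: "int m = var st ''m''" using env by (simp add: env_def)
  let ?I = "\<lambda>k st' t' qs'. (\<forall>z. 0 \<le> z \<and> z < k \<longrightarrow> arr st' ''q'' (1 + int (m * m) + z) = (if z < int (3 * s) then 0 else 1))
    \<and> (\<forall>z. z < 1 + int (m * m) \<longrightarrow> arr st' ''q'' z = arr st ''q'' z) \<and> qs' = qs \<and> t' \<le> t + 4 * nat k"
  show ?thesis
  proof (rule wp_For[where I = ?I, OF _ _ _ mm])
    fix k st1 t1 qs1
    assume k: "0 \<le> k" "k < int m" "var st1 ''x'' = k" and ag: "agree (insert ''x'' (mod_vars flag_step)) (mod_arrs flag_step) st st1"
      and I: "?I k st1 t1 qs1"
    have env1: "env st1" using env_agree[OF ag env] by (simp add: params_def)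
    then have v1: "var st1 ''mm'' = int (m * m)" "var st1 ''s'' = int s" by (simp_all add: env_def)
    let ?f = "if k < int (3 * s) then 0 else 1"
    have "arr st1 ''q'' (1 + int (m * m) + z) = (if z < int (3 * s) then 0 else 1)" if "0 \<le> z" "z < k" for z
      using I that by blast
    then have 1: "((arr st1 ''q'')(1 + int (m * m) + k := ?f)) (1 + int (m * m) + z) = (if z < int (3 * s) then 0 else 1)"
      if "0 \<le> z \<and> z < k + 1" for z using that by (cases "z = k") auto
    have 2: "((arr st1 ''q'')(1 + int (m * m) + k := ?f)) z = arr st ''q'' z" if "z < 1 + int (m * m)" for z
      using that k(1) I by simp
    have t: "t1 + 1 + 1 + 2 \<le> t + 4 * nat (k + 1)" using I k(1) by (simp add: nat_add_distrib)
    have post: "?I (k + 1) (st1\<lparr>arr := (arr st1)(''q'' := (arr st1 ''q'')(1 + int (m * m) + k := ?f)), var := (var st1)(''x'' := k + 1)\<rparr>) (t1 + 1 + 1 + 2) qs1"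
      using 1 2 t I by (simp del: fun_upd_apply add: fun_upd_same)
    show "wp flag_step st1 t1 qs1 (\<lambda>st2 t2 qs2. ?I (k + 1) (st2\<lparr>var := (var st2)(''x'' := k + 1)\<rparr>) (t2 + 2) qs2)"
      unfolding flag_step_def
      by (intro wp_Cond wp_Store) (use post X_ge v1 k(3) in \<open>simp_all del: fun_upd_apply\<close>)
  next
    fix st1 t1 qs1
    assume ag: "agree (insert ''x'' (mod_vars flag_step)) (mod_arrs flag_step) st st1" and I: "?I (int m) st1 t1 qs1"
    have "arr st1 ''q'' (1 + int (m * m) + int z) = (if z < 3 * s then 0 else 1)" if "z < m" for z
      using I that by simp
    then show "R st1 (t1 + 2) qs1" using R[of st1 "t1 + 2"] ag I by simp
  qed simp_all
qed

lemma read_eqI: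
  assumes "k = int (length xs)" "\<And>z. z < length xs \<Longrightarrow> arr st a (int z) = xs ! z"
  shows "read a k st = xs"
  by (rule nth_equalityI) (use assms in \<open>simp_all add: read_def\<close>)

lemma query_nth_cases:
  assumes "z < 2 + m * m + m"
  obtains "z = 0" | y where "z = 1 + y" "y < m * m" | y where "z = 1 + m * m + y" "y < m" | "z = 1 + m * m + m"
proof -
  consider "z = 0" | "1 \<le> z" "z < 1 + m * m" | "1 + m * m \<le> z" "z < 1 + m * m + m" | "z = 1 + m * m + m"
    using assms by linarith
  then show ?thesis
  proof cases
    case 2
    with that(2)[of "z - 1"] show ?thesis by simp
  next
    case 3
    with that(3)[of "z - (1 + m * m)"] show ?thesis by simp
  qed (use that in auto)
qed

lemma wp_build_query:
  assumes env: "env st" and st: "var st ''I'' = I" "var st ''J'' = J" "var st ''K'' = K" "arr st ''A'' = A" "arr st ''T'' = T"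
    and ok: "weights_ok A" "thresholds_ok T"
    and R: "\<And>st' t'. read ''q'' (2 + int m * int m + int m) st' = query_of A T I J K \<Longrightarrow>
      agree {''x'', ''l'', ''h'', ''p'', ''o'', ''i'', ''j'', ''v''} {''q''} st st' \<Longrightarrow>
      t' \<le> t + 19 * (m * m) + 4 * m + 6 \<Longrightarrow> R st' t' qs"
  shows "wp build_query st t qs R"
  unfolding build_query_def
proof (rule wp_Seq, rule wp_arcs[OF env st ok])
  fix st1 t1
  assume q1: "\<And>z. z < m * m \<Longrightarrow> arr st1 ''q'' (1 + int z) = query_of A T I J K ! (1 + z)"
    and ag1: "agree {''x'', ''l'', ''h'', ''p'', ''o'', ''i'', ''j'', ''v''} {''q''} st st1" and t1: "t1 \<le> t + 19 * (m * m) + 2"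
  have env1: "env st1" using env_agree[OF ag1 env] by (simp add: params_def)
  show "wp (For ''x'' ''m'' flag_step ;; Store ''q'' (Const 0) (Var ''m'') ;;
      Store ''q'' (Const 1 \<oplus> Var ''mm'' \<oplus> Var ''m'') (Var ''m'' \<ominus> Const 1)) st1 t1 qs R"
  proof (rule wp_Seq, rule wp_flags[OF env1])
    fix st2 t2
    assume q2: "\<And>z. z < m \<Longrightarrow> arr st2 ''q'' (1 + int (m * m) + int z) = (if z < 3 * s then 0 else 1)"
      "\<And>z. z < 1 + int (m * m) \<Longrightarrow> arr st2 ''q'' z = arr st1 ''q'' z"
      and ag2: "agree {''x''} {''q''} st1 st2" and t2: "t2 \<le> t1 + 4 * m + 2"
    have env2: "env st2" using env_agree[OF ag2 env1] by (simp add: params_def)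
    have v2: "var st2 ''mm'' = int (m * m)" "var st2 ''m'' = int m" using env2 by (simp_all add: env_def)
    let ?q = "(arr st2 ''q'')(0 := int m, 1 + int (m * m) + int m := int m - 1)"
    let ?st = "st2\<lparr>arr := (arr st2)(''q'' := ?q)\<rparr>"
    have "?q (int z) = query_of A T I J K ! z" if "z < 2 + m * m + m" for z
      using that
    proof (cases rule: query_nth_cases)
      case 1
      have "0 \<noteq> 1 + int (m * m) + int m" by linarith
      with 1 show ?thesis by (simp add: query_of_nth(1) del: of_nat_mult)
    next
      case (2 y)
      have "int y < int (m * m)" "int z = 1 + int y" using 2 by (simp_all only: of_nat_less_iff of_nat_add of_nat_1)
      then have "int z \<noteq> 0" "int z \<noteq> 1 + int (m * m) + int m" "int z < 1 + int (m * m)" "int z = 1 + int y" by linarith+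
      then show ?thesis using q1[OF 2(2)] q2(2)[of "int z"] 2 by (simp del: of_nat_mult)
    next
      case (3 y)
      have "int y < int m" "int z = 1 + int (m * m) + int y" using 3 by (simp_all only: of_nat_less_iff of_nat_add of_nat_1)
      then have z: "int z \<noteq> 0" "int z \<noteq> 1 + int (m * m) + int m" "int z = 1 + int (m * m) + int y" by linarith+
      have "?q (int z) = arr st2 ''q'' (int z)" using z(1,2) by simp
      then have "?q (int z) = arr st2 ''q'' (1 + int (m * m) + int y)" by (subst (asm) (2) z(3))
      then show ?thesis unfolding q2(1)[OF 3(2)] by (subst (2) 3(1)) (subst query_of_nth(3)[OF 3(2)])
    next
      case 4
      then have "int z = 1 + int (m * m) + int m" by simp
      then have "?q (int z) = int m - 1" by (simp only: fun_upd_same)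
      also have "\<dots> = query_of A T I J K ! z" unfolding 4 query_of_nth(4) by (simp add: m_def)
      finally show ?thesis .
    qed
    then have rd: "read ''q'' (2 + int m * int m + int m) ?st = query_of A T I J K"
      by (intro read_eqI) (simp_all add: length_query_of del: fun_upd_apply add: fun_upd_same)
    have ag: "agree {''x'', ''l'', ''h'', ''p'', ''o'', ''i'', ''j'', ''v''} {''q''} st ?st"
    proof -
      have "agree {''x'', ''l'', ''h'', ''p'', ''o'', ''i'', ''j'', ''v''} {''q''} st1 st2"
        using ag2 by (rule agree_mono) auto
      from agree_trans[OF ag1 this] show ?thesis by (simp add: agree_def)
    qed
    have t: "t2 + 1 + 1 \<le> t + 19 * (m * m) + 4 * m + 6" using t1 t2 by linarith
    have "0 \<le> (4 * int s + 1) * (4 * int s + 1)" "int m = 4 * int s + 1" by (simp_all add: m_def)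
    then have mX: "int m \<le> X" using X(4) by linarith
    show "wp (Store ''q'' (Const 0) (Var ''m'') ;; Store ''q'' (Const 1 \<oplus> Var ''mm'' \<oplus> Var ''m'') (Var ''m'' \<ominus> Const 1)) st2 t2 qs R"
      apply (intro wp_Seq wp_Store)
      using R[OF rd ag t] mX v2 by (simp_all add: m_def del: fun_upd_apply add: fun_upd_same)
  qed
qed

section \<open>Searching the blocks\<close>

definition block :: "int \<Rightarrow> bool" where "block I \<longleftrightarrow> 0 \<le> I \<and> I + int s \<le> N"

lemma in_block: "block I \<Longrightarrow> 0 \<le> i \<Longrightarrow> i < int s \<Longrightarrow> I + i \<in> {0..<N}"
  by (auto simp: block_def)

lemma weights_nonneg: "weights_ok A \<Longrightarrow> 0 \<le> A z"
  by (simp add: weights_ok_def)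

lemma N_pos: "1 \<le> N"
  using N n by linarith

lemma index_range:
  assumes "i \<in> {0..<N}" "j \<in> {0..<N}" shows "i * N + j \<in> {0..<N * N}"
proof -
  have "i * N + j < (i + 1) * N" using assms by (simp add: algebra_simps)
  also have "\<dots> \<le> N * N" using assms by (intro mult_right_mono) auto
  finally show ?thesis using assms by auto
qed

text \<open>All marks are confined to row \<open>I + i\<close>. This keeps the answers of the oracle
  for the rows still to come valid, although the thresholds have changed since the query.\<close>

lemma wp_pairs:
  assumes env: "env st" and st: "var st ''I'' = I" "var st ''J'' = J" "var st ''K'' = K" "arr st ''A'' = A" "arr st ''T'' = T"
    and ok: "weights_ok A" and bl: "block I" "block J" "block K"
    and i: "var st ''i'' = i" "0 \<le> i" "i < int s"
    and R: "\<And>st' t'. refines A N T (arr st' ''T'') \<Longrightarrow>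
      (\<And>j k. 0 \<le> j \<Longrightarrow> j < int s \<Longrightarrow> 0 \<le> k \<Longrightarrow> k < int s \<Longrightarrow> \<not> violated A (arr st' ''T'') N (I + i) (J + j) (K + k)) \<Longrightarrow>
      (\<And>z. z div N \<noteq> I + i \<Longrightarrow> arr st' ''T'' z = T z) \<Longrightarrow>
      agree {''z'', ''j'', ''k''} {''T''} st st' \<Longrightarrow> t' \<le> t + 6 * (s * s) + 2 \<Longrightarrow> R st' t' qs"
  shows "wp (For ''z'' ''ss'' pair_step) st t qs R"
proof -
  have ss: "int (s * s) = var st ''ss''" using env by (simp add: env_def)
  have sp: "0 < int s" using s by simp
  note A = weights_nonneg[OF ok]
  let ?I = "\<lambda>k st' t' qs'. refines A N T (arr st' ''T'') \<and>
    (\<forall>z. 0 \<le> z \<and> z < k \<longrightarrow> \<not> violated A (arr st' ''T'') N (I + i) (J + z div int s) (K + z mod int s)) \<and>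
    (\<forall>z. z div N \<noteq> I + i \<longrightarrow> arr st' ''T'' z = T z) \<and> qs' = qs \<and> t' \<le> t + 6 * nat k"
  show ?thesis
  proof (rule wp_For[where I = ?I, OF _ _ _ ss])
    fix z st1 t1 qs1
    assume z: "0 \<le> z" "z < int (s * s)" "var st1 ''z'' = z" and bd1: "bounded X st1"
      and ag: "agree (insert ''z'' (mod_vars pair_step)) (mod_arrs pair_step) st st1"
      and I: "?I z st1 t1 qs1"
    have env1: "env st1" using env_agree[OF ag env] by (simp add: params_def)
    have st1: "var st1 ''I'' = I" "var st1 ''J'' = J" "var st1 ''K'' = K" "arr st1 ''A'' = A" "var st1 ''i'' = i"
      "var st1 ''N'' = N" "var st1 ''s'' = int s"
      using agree_var[OF ag] agree_arr[OF ag] st i env1 by (simp_all add: env_def)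
    define T1 where "T1 = arr st1 ''T''"
    let ?j = "z div int s" and ?k = "z mod int s"
    have jk: "0 \<le> ?j" "?j < int s" "0 \<le> ?k" "?k < int s"
      using z sp div_less_of_less_mult[of z "int s" "int s"] by (auto simp: pos_imp_zdiv_nonneg_iff)
    have sX: "int s \<le> X" using bounded_var[OF bd1, of "''s''"] st1 by simp
    let ?idx = "(I + i) * N + (J + ?j)"
    have rng: "I + i \<in> {0..<N}" "J + ?j \<in> {0..<N}" "K + ?k \<in> {0..<N}"
      using in_block[OF bl(1) i(2,3)] in_block[OF bl(2) jk(1,2)] in_block[OF bl(3) jk(3,4)] by auto
    have post: "?I (z + 1) st2 (t1 + 1 + 1 + 1 + 1 + 2) qs1"
      if T2: "arr st2 ''T'' = (if violated A T1 N (I + i) (J + ?j) (K + ?k) then T1(?idx := 0) else T1)" for st2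
    proof -
      let ?T2 = "arr st2 ''T''"
      have r12: "refines A N T1 ?T2"
        unfolding T2 using refines_update[OF _ rng] by simp
      have r1: "refines A N T T1" using I by (simp add: T1_def)
      have v: "\<not> violated A ?T2 N (I + i) (J + ?j) (K + ?k)"
        using A[of "(I + i) * N + (K + ?k)"] A[of "(K + ?k) * N + (J + ?j)"]
        unfolding T2 by (auto simp: violated_def)
      have 1: "\<not> violated A ?T2 N (I + i) (J + y div int s) (K + y mod int s)" if "0 \<le> y \<and> y < z + 1" for y
      proof (cases "y = z")
        case False
        then have "\<not> violated A T1 N (I + i) (J + y div int s) (K + y mod int s)"
          using I that by (simp add: T1_def)
        then show ?thesis using violated_refines[OF r12 _ A] by blast
      qed (use v in simp)
      have "?idx div N = I + i" using rng(2) by simp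
      then have 2: "?T2 y = T y" if "y div N \<noteq> I + i" for y
        using that I unfolding T2 T1_def by auto
      have "t1 + 1 + 1 + 1 + 1 + 2 \<le> t + 6 * nat (z + 1)" using I z(1) by (simp add: nat_add_distrib)
      then show ?thesis using refines_trans[OF r1 r12 A] 1 2 I by blast
    qed
    have post': "?I (z + 1) st2 t2 qs1"
      if "t2 \<le> t1 + 1 + 1 + 1 + 1 + 2" "arr st2 ''T'' = (if violated A T1 N (I + i) (J + ?j) (K + ?k) then T1(?idx := 0) else T1)" for st2 t2
      using post[OF that(2)] that(1) by auto
    have bX: "\<bar>?j\<bar> \<le> X" "\<bar>?k\<bar> \<le> X" "0 \<le> X" using jk sX by linarith+
    show "wp pair_step st1 t1 qs1 (\<lambda>st2 t2 qs2. ?I (z + 1) (st2\<lparr>var := (var st2)(''z'' := z + 1)\<rparr>) (t2 + 2) qs2)"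
    proof (cases "violated A T1 N (I + i) (J + ?j) (K + ?k)")
      case True
      then have v: "A ((I + i) * N + (K + ?k)) + A ((K + ?k) * N + (J + ?j)) < arr st1 ''T'' ?idx"
        by (simp add: violated_def T1_def)
      show ?thesis unfolding pair_step_def
        apply (rule wp_Seq, rule wp_Assign, simp, simp, use bX z st1 in simp)
        apply (rule wp_Seq, rule wp_Assign, simp, simp, use bX z st1 in simp)
        apply (rule wp_Cond, simp, simp)
         apply (rule wp_Store, simp, simp, simp, simp, use bX in simp)
         apply (rule post', simp)
        using True v by (simp_all add: st1 z T1_def)
    next
      case False
      then have v: "\<not> A ((I + i) * N + (K + ?k)) + A ((K + ?k) * N + (J + ?j)) < arr st1 ''T'' ?idx"
        by (simp add: violated_def T1_def)
      show ?thesis unfolding pair_step_def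
        apply (rule wp_Seq, rule wp_Assign, simp, simp, use bX z st1 in simp)
        apply (rule wp_Seq, rule wp_Assign, simp, simp, use bX z st1 in simp)
        apply (rule wp_Cond, simp, simp)
         defer
         apply (rule wp_Skip)
         apply (rule post', simp)
        using False v by (simp_all add: st1 z T1_def)
    qed
  next
    fix st1 t1 qs1
    assume ag: "agree (insert ''z'' (mod_vars pair_step)) (mod_arrs pair_step) st st1" and I: "?I (int (s * s)) st1 t1 qs1"
    have "\<not> violated A (arr st1 ''T'') N (I + i) (J + j) (K + k)" if "0 \<le> j" "j < int s" "0 \<le> k" "k < int s" for j k
    proof -
      have "j * int s + k < (j + 1) * int s" using that by (simp add: algebra_simps)
      also have "\<dots> \<le> int s * int s" using that by (intro mult_right_mono) auto
      finally have "0 \<le> j * int s + k \<and> j * int s + k < int (s * s)" using that by simp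
      with I have "\<not> violated A (arr st1 ''T'') N (I + i) (J + (j * int s + k) div int s) (K + (j * int s + k) mod int s)"
        by blast
      then show ?thesis unfolding div_mod_unique[OF that(3,4)] .
    qed
    moreover have "t1 + 2 \<le> t + 6 * (s * s) + 2" using I by (simp add: nat_mult_distrib)
    ultimately show "R st1 (t1 + 2) qs1" using R[of st1 "t1 + 2"] ag I by simp
  qed (use st in auto)
qed

text \<open>The potential \<open>pending\<close> pays for the searches: a row is searched only if the oracle has found a
  violated threshold in it, and the search sets this threshold to 0.\<close>

lemma wp_rows:
  assumes env: "env st" and st: "var st ''I'' = I" "var st ''J'' = J" "var st ''K'' = K" "arr st ''A'' = A" "arr st ''T'' = T"
    and ok: "weights_ok A" and bl: "block I" "block J" "block K"
    and r: "\<And>i. 0 \<le> i \<Longrightarrow> i < int s \<Longrightarrow> int s < arr st ''r'' i \<longleftrightarrow>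
      (\<exists>j k. 0 \<le> j \<and> j < int s \<and> 0 \<le> k \<and> k < int s \<and> violated A T N (I + i) (J + j) (K + k))"
    and R: "\<And>st' t'. refines A N T (arr st' ''T'') \<Longrightarrow>
      (\<And>i j k. 0 \<le> i \<Longrightarrow> i < int s \<Longrightarrow> 0 \<le> j \<Longrightarrow> j < int s \<Longrightarrow> 0 \<le> k \<Longrightarrow> k < int s \<Longrightarrow>
        \<not> violated A (arr st' ''T'') N (I + i) (J + j) (K + k)) \<Longrightarrow>
      agree {''i'', ''z'', ''j'', ''k''} {''T''} st st' \<Longrightarrow>
      t' + (6 * (s * s) + 3) * pending (N * N) (arr st' ''T'') \<le>
        t + (6 * (s * s) + 3) * pending (N * N) T + 4 * s + 2 \<Longrightarrow> R st' t' qs"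
  shows "wp (For ''i'' ''s'' row_step) st t qs R"
proof -
  have sv: "int s = var st ''s''" using env by (simp add: env_def)
  note A = weights_nonneg[OF ok]
  let ?c = "6 * (s * s) + 3"
  \<comment> \<open>The rows from \<open>I + i\<close> on are still as they were at the time of the
    query, so the answers \<open>r\<close> remain applicable to them. The last conjunct is the
    amortised time bound: a unit of potential is worth one search.\<close>
  let ?I = "\<lambda>i st' t' qs'. refines A N T (arr st' ''T'') \<and>
    (\<forall>i' j k. 0 \<le> i' \<and> i' < i \<and> 0 \<le> j \<and> j < int s \<and> 0 \<le> k \<and> k < int s \<longrightarrow> \<not> violated A (arr st' ''T'') N (I + i') (J + j) (K + k)) \<and>
    (\<forall>z. z div N \<ge> I + i \<longrightarrow> arr st' ''T'' z = T z) \<and> qs' = qs \<and>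
    t' + ?c * pending (N * N) (arr st' ''T'') \<le> t + ?c * pending (N * N) T + 4 * nat i"
  show ?thesis
  proof (rule wp_For[where I = ?I, OF _ _ _ sv])
    fix i st1 t1 qs1
    assume i: "0 \<le> i" "i < int s" "var st1 ''i'' = i"
      and ag: "agree (insert ''i'' (mod_vars row_step)) (mod_arrs row_step) st st1"
      and I: "?I i st1 t1 qs1"
    have env1: "env st1" using env_agree[OF ag env] by (simp add: params_def)
    have st1: "var st1 ''I'' = I" "var st1 ''J'' = J" "var st1 ''K'' = K" "arr st1 ''A'' = A"
      using agree_var[OF ag] agree_arr[OF ag] st by simp_all
    have test: "var st1 ''s'' = int s" "arr st1 ''r'' = arr st ''r''"
      using agree_var[OF ag] agree_arr[OF ag] sv by simp_all
    define T1 where "T1 = arr st1 ''T''"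
    have T1: "refines A N T T1" "\<And>z. z div N \<ge> I + i \<Longrightarrow> T1 z = T z"
      "\<And>i' j k. 0 \<le> i' \<Longrightarrow> i' < i \<Longrightarrow> 0 \<le> j \<Longrightarrow> j < int s \<Longrightarrow> 0 \<le> k \<Longrightarrow> k < int s \<Longrightarrow> \<not> violated A T1 N (I + i') (J + j) (K + k)"
      "t1 + ?c * pending (N * N) T1 \<le> t + ?c * pending (N * N) T + 4 * nat i" "qs1 = qs"
      using I by (simp_all add: T1_def)
    have post: "?I (i + 1) (st2\<lparr>var := (var st2)(''i'' := i + 1)\<rparr>) (t2 + 2) qs1"
      if r12: "refines A N T1 (arr st2 ''T'')"
        and v: "\<And>j k. 0 \<le> j \<Longrightarrow> j < int s \<Longrightarrow> 0 \<le> k \<Longrightarrow> k < int s \<Longrightarrow> \<not> violated A (arr st2 ''T'') N (I + i) (J + j) (K + k)"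
        and u: "\<And>z. z div N \<noteq> I + i \<Longrightarrow> arr st2 ''T'' z = T1 z"
        and t2: "t2 + 2 + ?c * pending (N * N) (arr st2 ''T'') \<le> t1 + ?c * pending (N * N) T1 + 4" for st2 t2
    proof -
      have 1: "\<not> violated A (arr st2 ''T'') N (I + i') (J + j) (K + k)"
        if "0 \<le> i' \<and> i' < i + 1 \<and> 0 \<le> j \<and> j < int s \<and> 0 \<le> k \<and> k < int s" for i' j k
      proof (cases "i' = i")
        case False
        then have "\<not> violated A T1 N (I + i') (J + j) (K + k)" using that by (intro T1(3)) auto
        then show ?thesis using violated_refines[OF r12 _ A] by blast
      qed (use v that in simp)
      have 2: "arr st2 ''T'' z = T z" if "z div N \<ge> I + (i + 1)" for z
      proof -
        have "z div N \<noteq> I + i" "z div N \<ge> I + i" using that by linarith+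
        then show ?thesis using u T1(2) by simp
      qed
      have "4 * nat (i + 1) = 4 * nat i + 4" using i(1) by (simp add: nat_add_distrib)
      then have 3: "t2 + 2 + ?c * pending (N * N) (arr st2 ''T'') \<le> t + ?c * pending (N * N) T + 4 * nat (i + 1)"
        using t2 T1(4) by linarith
      show ?thesis using refines_trans[OF T1(1) r12 A] 1 2 3 T1(5) by simp
    qed
    show "wp row_step st1 t1 qs1 (\<lambda>st2 t2 qs2. ?I (i + 1) (st2\<lparr>var := (var st2)(''i'' := i + 1)\<rparr>) (t2 + 2) qs2)"
      unfolding row_step_def
    proof (rule wp_Cond)
      assume "bval (Less (Var ''s'') (Elem ''r'' (Var ''i''))) st1"
      then obtain j k where jk: "0 \<le> j" "j < int s" "0 \<le> k" "k < int s" and vT: "violated A T N (I + i) (J + j) (K + k)"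
        using r[OF i(1,2)] i(3) test by auto
      let ?idx = "(I + i) * N + (J + j)"
      have rng: "I + i \<in> {0..<N}" "J + j \<in> {0..<N}"
        using in_block[OF bl(1) i(1,2)] in_block[OF bl(2) jk(1,2)] by auto
      have "?idx div N = I + i" using rng(2) by simp
      \<comment> \<open>The oracle has spoken about \<open>T\<close>; row \<open>I + i\<close> still
        agrees with it, so the violation is present in \<open>T1\<close> as well.\<close>
      then have eq: "T1 ?idx = T ?idx" by (intro T1(2)) simp
      then have vT1: "violated A T1 N (I + i) (J + j) (K + k)" using vT by (simp add: violated_def)
      show "wp (For ''z'' ''ss'' pair_step) st1 (t1 + 1) qs1 (\<lambda>st2 t2 qs2. ?I (i + 1) (st2\<lparr>var := (var st2)(''i'' := i + 1)\<rparr>) (t2 + 2) qs2)"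
      proof (rule wp_pairs[OF env1 st1 T1_def[symmetric] ok bl i(3,1,2)])
        fix st2 t2
        assume r12: "refines A N T1 (arr st2 ''T'')"
          and v: "\<And>j k. 0 \<le> j \<Longrightarrow> j < int s \<Longrightarrow> 0 \<le> k \<Longrightarrow> k < int s \<Longrightarrow> \<not> violated A (arr st2 ''T'') N (I + i) (J + j) (K + k)"
          and u: "\<And>z. z div N \<noteq> I + i \<Longrightarrow> arr st2 ''T'' z = T1 z"
          and t2: "t2 \<le> t1 + 1 + 6 * (s * s) + 2"
        have "T1 ?idx \<noteq> 0"
          using vT1 A[of "(I + i) * N + (K + k)"] A[of "(K + k) * N + (J + j)"] by (auto simp: violated_def)
        moreover have "arr st2 ''T'' ?idx = 0"
          using refinesD[OF r12, of ?idx] v[OF jk] vT1 by (auto simp: violated_def)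
        ultimately have "pending (N * N) (arr st2 ''T'') + 1 \<le> pending (N * N) T1"
          using pending_less[OF r12 index_range[OF rng]] by simp
        then have le: "?c * (pending (N * N) (arr st2 ''T'') + 1) \<le> ?c * pending (N * N) T1"
          by (intro mult_le_mono2)
        have "t2 + 2 + ?c * pending (N * N) (arr st2 ''T'') \<le> t1 + ?c * pending (N * N) T1 + 4"
        proof -
          have "t2 + 2 + a \<le> t1 + b + 4" if "a + d * 1 \<le> b" "d = 6 * (s * s) + 3" for a b d :: nat
            using that t2 by linarith
          with le show ?thesis unfolding add_mult_distrib2 by blast
        qed
        then show "?I (i + 1) (st2\<lparr>var := (var st2)(''i'' := i + 1)\<rparr>) (t2 + 2) qs1"
          using r12 v u by (intro post) auto
      qed
    next
      assume "\<not> bval (Less (Var ''s'') (Elem ''r'' (Var ''i''))) st1"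
      then have "\<not> violated A T N (I + i) (J + j) (K + k)" if "0 \<le> j" "j < int s" "0 \<le> k" "k < int s" for j k
        using r[OF i(1,2)] i(3) test that by auto
      then have "\<not> violated A (arr st1 ''T'') N (I + i) (J + j) (K + k)" if "0 \<le> j" "j < int s" "0 \<le> k" "k < int s" for j k
        using violated_refines[OF T1(1) _ A] that unfolding T1_def by blast
      then show "wp Skip st1 (t1 + 1) qs1 (\<lambda>st2 t2 qs2. ?I (i + 1) (st2\<lparr>var := (var st2)(''i'' := i + 1)\<rparr>) (t2 + 2) qs2)"
        by (intro wp_Skip post) (simp_all add: T1_def)
    qed simp_all
  next
    fix st1 t1 qs1
    assume ag: "agree (insert ''i'' (mod_vars row_step)) (mod_arrs row_step) st st1" and I: "?I (int s) st1 t1 qs1"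
    then have "t1 + 2 + ?c * pending (N * N) (arr st1 ''T'') \<le> t + ?c * pending (N * N) T + 4 * s + 2" by simp
    then show "R st1 (t1 + 2) qs1" using R[of st1 "t1 + 2"] ag I by simp
  qed (use st in auto)
qed

text \<open>A run records its queries as lists of numbers, whereas a reduction has to name
  instances; hence the preimage \<open>y\<close>, together with the two sizes that enter
  \<open>cost_bound\<close>.\<close>

definition good :: "int list \<Rightarrow> bool" where
  "good q \<longleftrightarrow> (\<exists>y\<in>instances (reverse_rank_single_source \<kappa>). encode (reverse_rank_single_source \<kappa>) y = q \<and>
     nodes (reverse_rank_single_source \<kappa>) y = m \<and> max_len (reverse_rank_single_source \<kappa>) y \<le> nat (4 * H))"

lemma is_rank_le_card: "finite U \<Longrightarrow> is_rank G U i j r \<Longrightarrow> r \<le> card U"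
  by (auto simp: is_rank_def Let_def split: if_splits intro: order_trans intro!: card_mono)

lemma query_answer:
  assumes ok: "weights_ok A" "thresholds_ok T"
  shows "good (query_of A T I J K)"
    and "length (Q (query_of A T I J K)) = m"
    and "y \<in> set (Q (query_of A T I J K)) \<Longrightarrow> \<bar>y\<bar> \<le> X"
    and "i < s \<Longrightarrow> int s < Q (query_of A T I J K) ! i \<longleftrightarrow>
      (\<exists>j k. 0 \<le> j \<and> j < int s \<and> 0 \<le> k \<and> k < int s \<and> violated A T N (I + int i) (J + j) (K + k))"
proof -
  let ?a = "\<lambda>i k. A ((I + i) * N + (K + k))" and ?b = "\<lambda>k j. A ((K + k) * N + (J + j))"
    and ?c = "\<lambda>i j. T ((I + i) * N + (J + j))"
  \<comment> \<open>The gadget wants the entries strictly below \<open>P\<close>; they are at most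
    \<open>F\<close>, and \<open>F < P\<close>.\<close>
  interpret gd: triangle_gadget s P H ?a ?b ?c
    using ok s F H by unfold_locales (auto simp: weights_ok_def thresholds_ok_def intro: le_less_trans)
  let ?y = "(gadget s H ?a ?b ?c, {3 * s..<4 * s + 1}, 4 * s)"
  have nc: "node_count (gadget s H ?a ?b ?c) = m" using gd.node_count_gadget by (simp add: m_def)
  have arcs: "map (\<lambda>z. arc_length (gadget s H ?a ?b ?c) (z div m) (z mod m)) [0..<m * m] =
      map (\<lambda>z. arc_of A T I J K (int (z div m)) (int (z mod m))) [0..<m * m]"
  proof (intro map_cong refl gd.arc_length_gadget)
    fix z assume "z \<in> set [0..<m * m]"
    then have "z div m < m" "z mod m < m"
      by (auto intro: less_mult_imp_div_less) (simp add: m_def)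
    then show "z div m < 4 * s + 1" "z mod m < 4 * s + 1"
      by (simp_all only: m_def[symmetric])
  qed
  have flags: "map (\<lambda>i. if i \<in> {3 * s..<4 * s + 1} then 1 else 0) [0..<m] = map (\<lambda>z. if z < 3 * s then 0 else 1 :: int) [0..<m]"
    by (auto simp: m_def)
  have "encode (reverse_rank_single_source \<kappa>) ?y = encode_graph (gadget s H ?a ?b ?c) @
      map (\<lambda>i. if i \<in> {3 * s..<4 * s + 1} then 1 else 0) [0..<node_count (gadget s H ?a ?b ?c)] @ [int (4 * s)]"
    by (simp add: reverse_rank_single_source_def)
  then have enc: "encode (reverse_rank_single_source \<kappa>) ?y = query_of A T I J K"
    unfolding encode_graph_eq nc arcs flags query_of_def by (simp only: append_Cons)
  have sz: "nodes (reverse_rank_single_source \<kappa>) ?y = m" "max_len (reverse_rank_single_source \<kappa>) ?y \<le> nat (4 * H)"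
    using nc gd.length_bound_gadget by (simp_all add: reverse_rank_single_source_def)
  show "good (query_of A T I J K)"
    unfolding good_def using gd.instance_gadget enc sz by blast
  have "solution (reverse_rank_single_source \<kappa>) ?y (Q (query_of A T I J K))"
    using orac gd.instance_gadget unfolding oracle_for_def enc[symmetric] by blast
  then have len: "length (Q (query_of A T I J K)) = m"
    and rank: "\<And>i. i < m \<Longrightarrow> \<exists>r. Q (query_of A T I J K) ! i = int r \<and>
      is_rank (gadget s H ?a ?b ?c) {3 * s..<4 * s + 1} i (4 * s) r"
    by (auto simp: reverse_rank_single_source_def gd.node_count_gadget m_def)
  show "length (Q (query_of A T I J K)) = m" by (rule len)
  show "\<bar>y\<bar> \<le> X" if y: "y \<in> set (Q (query_of A T I J K))"
  proof -
    obtain i where "i < m" "y = Q (query_of A T I J K) ! i" using y len by (metis in_set_conv_nth)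
    with rank obtain r where r: "y = int r" "is_rank (gadget s H ?a ?b ?c) {3 * s..<4 * s + 1} i (4 * s) r" by blast
    have "r \<le> card {3 * s..<4 * s + 1}" by (rule is_rank_le_card[OF _ r(2)]) simp
    then have "int r \<le> 4 * int s + 1" by simp
    moreover have "0 \<le> (4 * int s + 1) * (4 * int s + 1)" by simp
    ultimately show ?thesis using r(1) X(4) by linarith
  qed
  show "int s < Q (query_of A T I J K) ! i \<longleftrightarrow>
      (\<exists>j k. 0 \<le> j \<and> j < int s \<and> 0 \<le> k \<and> k < int s \<and> violated A T N (I + int i) (J + j) (K + k))" if i: "i < s"
  proof -
    have "i < m" using i by (simp add: m_def)
    from rank[OF this] obtain r where r: "Q (query_of A T I J K) ! i = int r"
      "is_rank (gadget s H ?a ?b ?c) {3 * s..<4 * s + 1} i (4 * s) r" by blast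
    show ?thesis
      using gd.gadget_rank[OF i r(2)] unfolding r(1) violated_def by simp
  qed
qed

text \<open>The searches appear only as a drop of the potential. What remains,
  \<open>40 * (m * m)\<close>, is the price of writing, asking and reading one query, which is of
  the order of its length.\<close>

lemma wp_triple:
  assumes env: "env st" and w: "var st ''w'' = w" "0 \<le> w" "w < g * g * g" and st: "arr st ''A'' = A" "arr st ''T'' = T"
    and ok: "weights_ok A" "thresholds_ok T"
    and I: "I = w div (g * g) * int s" and J: "J = w div g mod g * int s" and K: "K = w mod g * int s"
    and R: "\<And>st' t' q. refines A N T (arr st' ''T'') \<Longrightarrow>
      (\<And>i j k. 0 \<le> i \<Longrightarrow> i < int s \<Longrightarrow> 0 \<le> j \<Longrightarrow> j < int s \<Longrightarrow> 0 \<le> k \<Longrightarrow> k < int s \<Longrightarrow>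
        \<not> violated A (arr st' ''T'') N (I + i) (J + j) (K + k)) \<Longrightarrow> good q \<Longrightarrow>
      t' + (6 * (s * s) + 3) * pending (N * N) (arr st' ''T'') \<le>
        t + (6 * (s * s) + 3) * pending (N * N) T + 40 * (m * m) \<Longrightarrow> R st' t' (qs @ [q])"
  shows "wp triple_step st t qs R"
proof -
  have gp: "0 < g" "0 < g * g" "0 < int s" using g s by auto
  have ranges: "0 \<le> w div (g * g)" "w div (g * g) < g" "0 \<le> w div g mod g" "w div g mod g < g" "0 \<le> w mod g" "w mod g < g"
    using w gp div_less_of_less_mult[of w g "g * g"] by (auto simp: pos_imp_zdiv_nonneg_iff mult.assoc)
  have blk: "block (c * int s)" if "0 \<le> c" "c < g" for c
  proof -
    have "(c + 1) * int s \<le> g * int s" using that gp by (intro mult_right_mono) auto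
    then have "0 \<le> c * int s" "c * int s + int s \<le> N" using that gp by (simp_all add: N(1) algebra_simps)
    then show ?thesis unfolding block_def by blast
  qed
  have bl: "block I" "block J" "block K" unfolding I J K using ranges by (simp_all add: blk)
  have "N * 1 \<le> N * N" using N_pos by (intro mult_left_mono) auto
  then have bX: "\<bar>L\<bar> \<le> X" if "block L" for L
    using that X(2) by (auto simp: block_def)
  have [simp]: "var st ''g'' = g" "var st ''s'' = int s" using env by (simp_all add: env_def)
  let ?st1 = "st\<lparr>var := (var st)(''I'' := I, ''J'' := J, ''K'' := K)\<rparr>"
  have ag1: "agree {''I'', ''J'', ''K''} {} st ?st1" by (simp add: agree_def)
  have env1: "env ?st1" using env_agree[OF ag1 env] by (simp add: params_def)
  have st1: "var ?st1 ''I'' = I" "var ?st1 ''J'' = J" "var ?st1 ''K'' = K" "arr ?st1 ''A'' = A" "arr ?st1 ''T'' = T"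
    using st by simp_all
  have "wp (build_query ;; Query ''q'' (Const 2 \<oplus> Var ''mm'' \<oplus> Var ''m'') ''r'' ;; For ''i'' ''s'' row_step) ?st1 (t + 1 + 1 + 1) qs R"
  proof (rule wp_Seq, rule wp_build_query[OF env1 st1 ok])
    fix st2 t2
    assume rd: "read ''q'' (2 + int m * int m + int m) st2 = query_of A T I J K"
      and ag2: "agree {''x'', ''l'', ''h'', ''p'', ''o'', ''i'', ''j'', ''v''} {''q''} ?st1 st2"
      and t2: "t2 \<le> t + 1 + 1 + 1 + 19 * (m * m) + 4 * m + 6"
    have env2: "env st2" using env_agree[OF ag2 env1] by (simp add: params_def)
    then have v2: "var st2 ''m'' = int m" "var st2 ''mm'' = int m * int m" by (simp_all add: env_def)
    let ?q = "query_of A T I J K"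
    let ?st3 = "load ''r'' (Q ?q) st2"
    have ag3: "agree {} {''r''} st2 ?st3" by (simp add: agree_def load_def)
    have env3: "env ?st3" using env_agree[OF ag3 env2] by simp
    have st3: "var ?st3 ''I'' = I" "var ?st3 ''J'' = J" "var ?st3 ''K'' = K" "arr ?st3 ''A'' = A" "arr ?st3 ''T'' = T"
      using agree_var[OF ag2] agree_arr[OF ag2] agree_var[OF ag3] agree_arr[OF ag3] st1 by simp_all
    have r: "int s < arr ?st3 ''r'' i \<longleftrightarrow>
      (\<exists>j k. 0 \<le> j \<and> j < int s \<and> 0 \<le> k \<and> k < int s \<and> violated A T N (I + i) (J + j) (K + k))"
      if i: "0 \<le> i" "i < int s" for i
    proof -
      obtain i' where i': "i = int i'" "i' < s" using i by (metis zero_le_imp_eq_int of_nat_less_iff)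
      then have "i' < m" by (simp add: m_def)
      then have "arr ?st3 ''r'' i = Q ?q ! i'" using i' query_answer(2)[OF ok] by (simp add: load_def)
      then show ?thesis unfolding query_answer(4)[OF ok i'(2), symmetric] i'(1) by (simp only:)
    qed
    show "wp (Query ''q'' (Const 2 \<oplus> Var ''mm'' \<oplus> Var ''m'') ''r'' ;; For ''i'' ''s'' row_step) st2 t2 qs R"
    proof (rule wp_Seq, rule wp_Query[where xs = ?q])
      show "?q = read ''q'' (aval (Const 2 \<oplus> Var ''mm'' \<oplus> Var ''m'') st2) st2" using rd v2 by simp
      show "wp (For ''i'' ''s'' row_step) ?st3 (t2 + 1 + length ?q + length (Q ?q)) (qs @ [?q]) R"
      proof (rule wp_rows[OF env3 st3 ok(1) bl r])
        fix st4 :: state and t4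
        assume 4: "refines A N T (arr st4 ''T'')"
          "\<And>i j k. 0 \<le> i \<Longrightarrow> i < int s \<Longrightarrow> 0 \<le> j \<Longrightarrow> j < int s \<Longrightarrow> 0 \<le> k \<Longrightarrow> k < int s \<Longrightarrow>
            \<not> violated A (arr st4 ''T'') N (I + i) (J + j) (K + k)"
          and t4: "t4 + (6 * (s * s) + 3) * pending (N * N) (arr st4 ''T'') \<le>
            t2 + 1 + length ?q + length (Q ?q) + (6 * (s * s) + 3) * pending (N * N) T + 4 * s + 2"
        show "R st4 t4 (qs @ [?q])"
        proof (rule R[OF 4 query_answer(1)[OF ok]])
          \<comment> \<open>The total is \<open>20 * m * m + 6 * m + 4 * s + 14\<close>, and
            \<open>m \<ge> 5\<close> makes the lower order terms fit into another
            \<open>20 * m * m\<close>.\<close>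
          have "5 * 1 \<le> m" "m * 1 \<le> m * m" "4 * s \<le> m" using s by (auto simp: m_def)
          then show "t4 + (6 * (s * s) + 3) * pending (N * N) (arr st4 ''T'') \<le>
            t + (6 * (s * s) + 3) * pending (N * N) T + 40 * (m * m)"
            using t4 t2 unfolding length_query_of query_answer(2)[OF ok] by linarith
        qed
      qed
    qed (use query_answer(3)[OF ok] in simp_all)
  qed
  then show ?thesis
    unfolding triple_step_def
    apply -
    apply (rule wp_Seq, rule wp_Assign, simp, simp, use bX[OF bl(1)] w I in simp)
    apply (rule wp_Seq, rule wp_Assign, simp, simp, use bX[OF bl(2)] w J in simp)
    apply (rule wp_Seq, rule wp_Assign, simp, simp, use bX[OF bl(3)] w K in simp)
    using w by (simp add: I J K)
qed

text \<open>One pass over all triples suffices, since marks made for a later triple create no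
  violation in an earlier one. At most \<open>N * N\<close> thresholds are pending at the start, so
  the searches of the whole pass cost at most \<open>6 * (s * s) + 3\<close> per cell of the
  matrix.\<close>

lemma wp_sweep:
  assumes env: "env st" and st: "arr st ''A'' = A" "arr st ''T'' = T"
    and ok: "weights_ok A" "thresholds_ok T"
    and R: "\<And>st' t' qs2. refines A N T (arr st' ''T'') \<Longrightarrow>
      (\<And>i j k. i \<in> {0..<N} \<Longrightarrow> j \<in> {0..<N} \<Longrightarrow> k \<in> {0..<N} \<Longrightarrow> \<not> violated A (arr st' ''T'') N i j k) \<Longrightarrow>
      agree (insert ''w'' (mod_vars triple_step)) (mod_arrs triple_step) st st' \<Longrightarrow>
      (\<And>q. q \<in> set qs2 \<Longrightarrow> good q) \<Longrightarrow> length qs2 = nat (g * g * g) \<Longrightarrow>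
      t' \<le> t + (6 * (s * s) + 3) * nat (N * N) + 42 * (m * m) * nat (g * g * g) + 2 \<Longrightarrow> R st' t' (qs @ qs2)"
  shows "wp (For ''w'' ''ggg'' triple_step) st t qs R"
proof -
  have gv: "g * g * g = var st ''ggg''" using env by (simp add: env_def)
  note A = weights_nonneg[OF ok(1)]
  let ?c = "6 * (s * s) + 3"
  let ?bad = "\<lambda>T w. \<exists>i j k. 0 \<le> i \<and> i < int s \<and> 0 \<le> j \<and> j < int s \<and> 0 \<le> k \<and> k < int s \<and>
     violated A T N (w div (g * g) * int s + i) (w div g mod g * int s + j) (w mod g * int s + k)"
  let ?I = "\<lambda>w st' t' qs'. refines A N T (arr st' ''T'') \<and> (\<forall>w'. 0 \<le> w' \<and> w' < w \<longrightarrow> \<not> ?bad (arr st' ''T'') w') \<and>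
    (\<exists>qs2. qs' = qs @ qs2 \<and> length qs2 = nat w \<and> (\<forall>q\<in>set qs2. good q)) \<and>
    t' + ?c * pending (N * N) (arr st' ''T'') \<le> t + ?c * pending (N * N) T + 42 * (m * m) * nat w"
  show ?thesis
  proof (rule wp_For[where I = ?I, OF _ _ _ gv])
    fix w st1 t1 qs1
    assume w: "0 \<le> w" "w < g * g * g" "var st1 ''w'' = w"
      and ag: "agree (insert ''w'' (mod_vars triple_step)) (mod_arrs triple_step) st st1"
      and I: "?I w st1 t1 qs1"
    have env1: "env st1" using env_agree[OF ag env] by (simp add: params_def)
    have A1: "arr st1 ''A'' = A" using agree_arr[OF ag] st by simp
    define T1 where "T1 = arr st1 ''T''"
    have r1: "refines A N T T1" using I by (simp add: T1_def)
    have ok1: "thresholds_ok T1"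
      unfolding thresholds_ok_def
    proof
      fix z show "0 \<le> T1 z \<and> T1 z \<le> P"
        using refinesD[OF r1, of z] ok(2) F by (auto simp: thresholds_ok_def)
    qed
    obtain qs2 where qs2: "qs1 = qs @ qs2" "length qs2 = nat w" "\<forall>q\<in>set qs2. good q" using I by blast
    have bad1: "\<not> ?bad T1 w'" if "0 \<le> w'" "w' < w" for w' using I that by (simp add: T1_def)
    have t1: "t1 + ?c * pending (N * N) T1 \<le> t + ?c * pending (N * N) T + 42 * (m * m) * nat w"
      using I by (simp add: T1_def)
    show "wp triple_step st1 t1 qs1 (\<lambda>st2 t2 qs2. ?I (w + 1) (st2\<lparr>var := (var st2)(''w'' := w + 1)\<rparr>) (t2 + 2) qs2)"
    proof (rule wp_triple[OF env1 w(3,1,2) A1 T1_def[symmetric] ok(1) ok1 refl refl refl])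
      fix st2 t2 q
      assume r12: "refines A N T1 (arr st2 ''T'')"
        and v: "\<And>i j k. 0 \<le> i \<Longrightarrow> i < int s \<Longrightarrow> 0 \<le> j \<Longrightarrow> j < int s \<Longrightarrow> 0 \<le> k \<Longrightarrow> k < int s \<Longrightarrow>
          \<not> violated A (arr st2 ''T'') N (w div (g * g) * int s + i) (w div g mod g * int s + j) (w mod g * int s + k)"
        and q: "good q"
        and t2: "t2 + ?c * pending (N * N) (arr st2 ''T'') \<le> t1 + ?c * pending (N * N) T1 + 40 * (m * m)"
      have 1: "\<not> ?bad (arr st2 ''T'') w'" if "0 \<le> w' \<and> w' < w + 1" for w'
      proof (cases "w' = w")
        case False
        then have "\<not> ?bad T1 w'" using bad1 that by simp
        then show ?thesis using violated_refines[OF r12 _ A] by blast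
      qed (use v in blast)
      have 2: "qs1 @ [q] = qs @ (qs2 @ [q])" "length (qs2 @ [q]) = nat (w + 1)" "\<forall>q\<in>set (qs2 @ [q]). good q"
        using qs2 q w(1) by (auto simp: nat_add_distrib)
      have "2 \<le> 2 * (m * m)" by (simp add: m_def)
      moreover have "42 * (m * m) * nat (w + 1) = 42 * (m * m) * nat w + 42 * (m * m)"
        using w(1) by (simp add: nat_add_distrib)
      ultimately have 3: "t2 + 2 + ?c * pending (N * N) (arr st2 ''T'') \<le> t + ?c * pending (N * N) T + 42 * (m * m) * nat (w + 1)"
        using t2 t1 by linarith
      have 4: "refines A N T (arr st2 ''T'')" by (rule refines_trans[OF r1 r12 A])
      show "?I (w + 1) (st2\<lparr>var := (var st2)(''w'' := w + 1)\<rparr>) (t2 + 2) (qs1 @ [q])"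
        using 1 2 3 4 by (intro conjI allI impI exI[of _ "qs2 @ [q]"]) (simp_all del: append_assoc)
    qed
  next
    fix st1 t1 qs1
    assume ag: "agree (insert ''w'' (mod_vars triple_step)) (mod_arrs triple_step) st st1" and I: "?I (g * g * g) st1 t1 qs1"
    obtain qs2 where qs2: "qs1 = qs @ qs2" "length qs2 = nat (g * g * g)" "\<forall>q\<in>set qs2. good q" using I by blast
    have gp: "0 < g" "0 < int s" using g s by auto
    have v: "\<not> violated A (arr st1 ''T'') N i j k" if ijk: "i \<in> {0..<N}" "j \<in> {0..<N}" "k \<in> {0..<N}" for i j k
    proof -
      have rg: "0 \<le> x div int s" "x div int s < g" "0 \<le> x mod int s" "x mod int s < int s" if "x \<in> {0..<N}" for x
        using that gp N div_less_of_less_mult[of x g "int s"] by (auto simp: pos_imp_zdiv_nonneg_iff)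
      let ?a = "i div int s" and ?b = "j div int s" and ?d = "k div int s"
      \<comment> \<open>The round in which the blocks containing \<open>i\<close>, \<open>j\<close>
        and \<open>k\<close> were treated.\<close>
      let ?w = "(?a * g + ?b) * g + ?d"
      note a = rg[OF ijk(1)] and b = rg[OF ijk(2)] and d = rg[OF ijk(3)]
      have 1: "?w div g = ?a * g + ?b" "?w mod g = ?d" by (rule div_mod_unique[OF d(1,2)])+
      have 2: "?w div g mod g = ?b" "?w div (g * g) = ?a"
        unfolding zdiv_zmult2_eq[OF less_imp_le[OF gp(1)]] 1 by (rule div_mod_unique[OF b(1,2)])+
      have "?a * g + ?b + 1 \<le> (?a + 1) * g" using b(2) by (simp add: algebra_simps)
      also have "\<dots> \<le> g * g" using a gp by (intro mult_right_mono) auto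
      finally have "(?a * g + ?b + 1) * g \<le> g * g * g" using gp by (intro mult_right_mono) auto
      then have "?w < g * g * g" using d(2) by (simp add: algebra_simps)
      moreover have "0 \<le> ?w" using a(1) b(1) d(1) gp by simp
      ultimately have "\<not> ?bad (arr st1 ''T'') ?w" using I by blast
      then have "\<not> violated A (arr st1 ''T'') N (?a * int s + i mod int s) (?b * int s + j mod int s) (?d * int s + k mod int s)"
        unfolding 1(2) 2 using a(3,4) b(3,4) d(3,4) by blast
      then show ?thesis by simp
    qed
    have "?c * pending (N * N) T \<le> ?c * nat (N * N)" by (intro mult_le_mono2 pending_le)
    then have "t1 + 2 \<le> t + ?c * nat (N * N) + 42 * (m * m) * nat (g * g * g) + 2"
      using I by linarith
    then show "R st1 (t1 + 2) qs1"
      unfolding qs2(1) using I ag qs2(2,3) v by (intro R) auto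
  qed (use st g in auto)
qed

section \<open>Determining the minima by bisection\<close>

definition approx :: "(int \<Rightarrow> int) \<Rightarrow> (int \<Rightarrow> int) \<Rightarrow> int \<Rightarrow> bool" where
  "approx A C b \<longleftrightarrow>
     (\<forall>i\<in>{0..<N}. \<forall>j\<in>{0..<N}. \<forall>k\<in>{0..<N}. C (i * N + j) \<le> A (i * N + k) + A (k * N + j)) \<and>
     (\<forall>i\<in>{0..<N}. \<forall>j\<in>{0..<N}. \<exists>k\<in>{0..<N}. A (i * N + k) + A (k * N + j) < C (i * N + j) + b) \<and>
     (\<forall>z\<in>{0..<N * N}. 0 \<le> C z \<and> C z + b \<le> P)"

definition phase_cost :: nat where
  "phase_cost = (6 * (s * s) + 10) * nat (N * N) + 42 * (m * m) * nat (g * g * g) + 7"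

lemma index_inj:
  assumes "i * N + j = i' * N + j'" "j \<in> {0..<N}" "j' \<in> {0..<N}" shows "i = i'" "j = j'"
proof -
  have j: "0 \<le> j" "j < N" "0 \<le> j'" "j' < N" using assms by auto
  show "i = i'" using div_mod_unique(1)[OF j(1,2), of i] div_mod_unique(1)[OF j(3,4), of i'] assms(1) by simp
  show "j = j'" using div_mod_unique(2)[OF j(1,2), of i] div_mod_unique(2)[OF j(3,4), of i'] assms(1) by simp
qed

lemma thresholds_refines:
  assumes "thresholds_ok T" "refines A N T T'" shows "thresholds_ok T'"
  unfolding thresholds_ok_def
proof
  fix z show "0 \<le> T' z \<and> T' z \<le> P"
    using refinesD[OF assms(2), of z] assms(1) F by (auto simp: thresholds_ok_def)
qed

text \<open>Halving the interval \<open>{C..<C + 2 * b}\<close> that contains the minimum: if the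
  pair was marked, the responsible \<open>k\<close> shows that the minimum is below
  \<open>C + b\<close>, and \<open>C\<close> is kept. Otherwise no sum is below
  \<open>C + b\<close>, which becomes the lower end. \<open>C + 2 * b \<le> P\<close> keeps the
  thresholds within the range of the gadget.\<close>

lemma approx_step:
  assumes C: "approx A C (2 * b)" and b: "1 \<le> b"
    and T: "\<And>z. z \<in> {0..<N * N} \<Longrightarrow> T z = C z + b" and ref: "refines A N T T'"
    and viol: "\<And>i j k. i \<in> {0..<N} \<Longrightarrow> j \<in> {0..<N} \<Longrightarrow> k \<in> {0..<N} \<Longrightarrow> \<not> violated A T' N i j k"
    and C': "\<And>z. z \<in> {0..<N * N} \<Longrightarrow> C' z = (if 0 < T' z then T' z else C z)"
  shows "approx A C' b"
proof -
  have Cz: "0 \<le> C z \<and> C z + 2 * b \<le> P" if "z \<in> {0..<N * N}" for z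
    using C that by (simp add: approx_def)
  have cases: "T' z = C z + b \<and> C' z = C z + b \<or> T' z = 0 \<and> C' z = C z" if "z \<in> {0..<N * N}" for z
    using refinesD[OF ref, of z] T[OF that] C'[OF that] Cz[OF that] b by auto
  have "C' (i * N + j) \<le> A (i * N + k) + A (k * N + j)" if ijk: "i \<in> {0..<N}" "j \<in> {0..<N}" "k \<in> {0..<N}" for i j k
  proof -
    have "C (i * N + j) \<le> A (i * N + k) + A (k * N + j)" using C ijk by (simp add: approx_def)
    moreover have "T' (i * N + j) \<le> A (i * N + k) + A (k * N + j)" using viol[OF ijk] by (simp add: violated_def)
    ultimately show ?thesis using cases[OF index_range[OF ijk(1,2)]] by auto
  qed
  moreover have "\<exists>k\<in>{0..<N}. A (i * N + k) + A (k * N + j) < C' (i * N + j) + b" if ij: "i \<in> {0..<N}" "j \<in> {0..<N}" for i j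
  proof (cases "T' (i * N + j) = 0")
    case False
    then have "C' (i * N + j) = C (i * N + j) + b" using cases[OF index_range[OF ij]] by auto
    moreover have "\<exists>k\<in>{0..<N}. A (i * N + k) + A (k * N + j) < C (i * N + j) + 2 * b" using C ij by (simp add: approx_def)
    ultimately show ?thesis by (simp add: algebra_simps)
  next
    case True
    note z = index_range[OF ij]
    \<comment> \<open>A threshold that has changed was marked, and \<open>refines\<close> remembers
      a \<open>k\<close> that justifies this.\<close>
    have T0: "T (i * N + j) \<noteq> T' (i * N + j)" using True T[OF z] Cz[OF z] b by auto
    then obtain i' j' k where k: "i' \<in> {0..<N}" "j' \<in> {0..<N}" "k \<in> {0..<N}" "i * N + j = i' * N + j'" "violated A T N i' j' k"
      using ref unfolding refines_def by metis
    have "i = i'" "j = j'" using index_inj[OF k(4) ij(2) k(2)] by auto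
    then have "A (i * N + k) + A (k * N + j) < C (i * N + j) + b" using k(5) T[OF z] by (simp add: violated_def)
    moreover have "C' (i * N + j) = C (i * N + j)" using cases[OF z] True Cz[OF z] b by auto
    ultimately show ?thesis using k(3) by auto
  qed
  moreover have "0 \<le> C' z \<and> C' z + b \<le> P" if "z \<in> {0..<N * N}" for z
    using cases[OF that] Cz[OF that] b by auto
  ultimately show ?thesis by (simp add: approx_def)
qed

lemma wp_bit_step:
  assumes env: "env st" and b: "var st ''b'' = 2 * b" "1 \<le> b" and ok: "weights_ok (arr st ''A'')" "thresholds_ok (arr st ''T'')"
    and ap: "approx (arr st ''A'') (arr st ''C'') (2 * b)"
    and R: "\<And>st' t' qs2. var st' ''b'' = b \<Longrightarrow> thresholds_ok (arr st' ''T'') \<Longrightarrow>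
      approx (arr st ''A'') (arr st' ''C'') b \<Longrightarrow> (\<And>q. q \<in> set qs2 \<Longrightarrow> good q) \<Longrightarrow>
      length qs2 = nat (g * g * g) \<Longrightarrow> t' \<le> t + phase_cost \<Longrightarrow> R st' t' (qs @ qs2)"
  shows "wp bit_step st t qs R"
proof (rule wp_bounded)
  assume bd: "bounded X st"
  define A where "A = arr st ''A''"
  define C where "C = arr st ''C''"
  have NN: "0 \<le> N * N" by simp
  have z0: "0 \<in> {0..<N * N}" using N_pos by simp
  have bP: "b \<le> P" "0 \<le> b" using ap z0 b(2) unfolding approx_def by fastforce+
  have PX: "P \<le> X" using X F H by auto
  have Cz: "0 \<le> C z \<and> C z + 2 * b \<le> P" if "z \<in> {0..<N * N}" for z
    using ap that by (simp add: approx_def C_def)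
  let ?st1 = "st\<lparr>var := (var st)(''b'' := b)\<rparr>"
  have ag1: "agree {''b''} {} st ?st1" by (simp add: agree_def)
  have env1: "env ?st1" using env_agree[OF ag1 env] by (simp add: params_def)
  have nn1: "var ?st1 ''NN'' = N * N" using env1 by (simp add: env_def)
  have "wp (For ''z'' ''NN'' (Store ''T'' (Var ''z'') (Elem ''C'' (Var ''z'') \<oplus> Var ''b'')) ;;
    For ''w'' ''ggg'' triple_step ;;
    For ''z'' ''NN'' (Cond (Less (Const 0) (Elem ''T'' (Var ''z''))) (Store ''C'' (Var ''z'') (Elem ''T'' (Var ''z''))) Skip)) ?st1 (t + 1) qs R"
  proof (rule wp_Seq, rule wp_pointwise[where a = "''T''" and f = "\<lambda>z. C z + b" and d = 1, OF _ _ _ _ nn1 NN])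
    fix k :: int and st2 :: state and t2 :: nat and R' :: "state \<Rightarrow> nat \<Rightarrow> int list list \<Rightarrow> bool"
    assume k: "0 \<le> k" "k < N * N" "var st2 ''z'' = k"
      and ag2: "agree (insert ''z'' (mod_vars (Store ''T'' (Var ''z'') (Elem ''C'' (Var ''z'') \<oplus> Var ''b'')))) {''T''} ?st1 st2"
      and R': "\<And>st3 t3. arr st3 ''T'' = (arr st2 ''T'')(k := C k + b) \<Longrightarrow> t3 \<le> t2 + 1 \<Longrightarrow> R' st3 t3 qs"
    have 2: "arr st2 ''C'' = C" "var st2 ''b'' = b" using agree_var[OF ag2] agree_arr[OF ag2] by (simp_all add: C_def)
    have "\<bar>C k + b\<bar> \<le> X" using Cz[of k] k b PX by auto
    then show "wp (Store ''T'' (Var ''z'') (Elem ''C'' (Var ''z'') \<oplus> Var ''b'')) st2 t2 qs R'"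
      using k 2 by (intro wp_Store R') simp_all
  next
    fix st2 :: state and t2 :: nat
    assume T2: "arr st2 ''T'' = (\<lambda>z. if 0 \<le> z \<and> z < N * N then C z + b else arr ?st1 ''T'' z)"
      and ag2': "agree (insert ''z'' (mod_vars (Store ''T'' (Var ''z'') (Elem ''C'' (Var ''z'') \<oplus> Var ''b'')))) {''T''} ?st1 st2"
      and t2: "t2 \<le> t + 1 + (1 + 2) * nat (N * N) + 2"
    have ag2: "agree {''z''} {''T''} ?st1 st2" using ag2' by simp
    have env2: "env st2" using env_agree[OF ag2 env1] by (simp add: params_def)
    have arr2: "arr st2 ''A'' = A" "arr st2 ''C'' = C" "var st2 ''b'' = b"
      using agree_arr[OF ag2] agree_var[OF ag2] by (simp_all add: A_def C_def)
    define T where "T = arr st2 ''T''"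
    have okT: "thresholds_ok T"
      unfolding thresholds_ok_def
    proof
      fix z
      show "0 \<le> T z \<and> T z \<le> P"
      proof (cases "z \<in> {0..<N * N}")
        case True
        then have "T z = C z + b" by (simp add: T_def T2)
        then show ?thesis using Cz[OF True] b(2) by linarith
      next
        case False
        then have "T z = arr st ''T'' z" unfolding T_def T2 by auto
        then show ?thesis using ok(2) by (simp add: thresholds_ok_def)
      qed
    qed
    have okA: "weights_ok A" using ok(1) by (simp add: A_def)
    show "wp (For ''w'' ''ggg'' triple_step ;;
      For ''z'' ''NN'' (Cond (Less (Const 0) (Elem ''T'' (Var ''z''))) (Store ''C'' (Var ''z'') (Elem ''T'' (Var ''z''))) Skip)) st2 t2 qs R"
    proof (rule wp_Seq, rule wp_sweep[OF env2 arr2(1) T_def[symmetric] okA okT])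
      fix st3 :: state and t3 :: nat and qs3 :: "int list list"
      assume ref: "refines A N T (arr st3 ''T'')"
        and viol: "\<And>i j k. i \<in> {0..<N} \<Longrightarrow> j \<in> {0..<N} \<Longrightarrow> k \<in> {0..<N} \<Longrightarrow> \<not> violated A (arr st3 ''T'') N i j k"
        and ag3: "agree (insert ''w'' (mod_vars triple_step)) (mod_arrs triple_step) st2 st3"
        and qs3: "\<And>q. q \<in> set qs3 \<Longrightarrow> good q" "length qs3 = nat (g * g * g)"
        and t3: "t3 \<le> t2 + (6 * (s * s) + 3) * nat (N * N) + 42 * (m * m) * nat (g * g * g) + 2"
      define T3 where "T3 = arr st3 ''T''"
      have env3: "env st3" using env_agree[OF ag3 env2] by (simp add: params_def)
      have nn3: "var st3 ''NN'' = N * N" using env3 by (simp add: env_def)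
      have st3: "arr st3 ''C'' = C" "var st3 ''b'' = b"
        using agree_arr[OF ag3] agree_var[OF ag3] arr2 by simp_all
      let ?c = "Cond (Less (Const 0) (Elem ''T'' (Var ''z''))) (Store ''C'' (Var ''z'') (Elem ''T'' (Var ''z''))) Skip"
      show "wp (For ''z'' ''NN'' ?c) st3 t3 (qs @ qs3) R"
      proof (rule wp_pointwise[where a = "''C''" and f = "\<lambda>z. if 0 < T3 z then T3 z else C z" and d = 2, OF _ _ _ _ nn3 NN])
        fix k :: int and st4 :: state and t4 :: nat and R' :: "state \<Rightarrow> nat \<Rightarrow> int list list \<Rightarrow> bool"
        assume k: "0 \<le> k" "k < N * N" "var st4 ''z'' = k" and bd4: "bounded X st4"
          and ag4: "agree (insert ''z'' (mod_vars ?c)) {''C''} st3 st4" and Ck: "arr st4 ''C'' k = arr st3 ''C'' k"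
          and R': "\<And>st5 t5. arr st5 ''C'' = (arr st4 ''C'')(k := if 0 < T3 k then T3 k else C k) \<Longrightarrow> t5 \<le> t4 + 2 \<Longrightarrow> R' st5 t5 (qs @ qs3)"
        have 4: "arr st4 ''T'' = T3" using agree_arr[OF ag4] by (simp add: T3_def)
        have bT: "\<bar>T3 k\<bar> \<le> X" using bounded_arr[OF bd4, of "''T''" k] 4 by simp
        show "wp ?c st4 t4 (qs @ qs3) R'"
          using k 4 bT Ck st3(1) by (intro wp_Cond wp_Store wp_Skip R') (simp_all add: fun_upd_idem)
      next
        fix st4 :: state and t4 :: nat
        assume C4: "arr st4 ''C'' = (\<lambda>z. if 0 \<le> z \<and> z < N * N then if 0 < T3 z then T3 z else C z else arr st3 ''C'' z)"
          and ag4': "agree (insert ''z'' (mod_vars ?c)) {''C''} st3 st4"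
          and t4: "t4 \<le> t3 + (2 + 2) * nat (N * N) + 2"
        have ag4: "agree {''z''} {''C''} st3 st4" using ag4' by simp
        show "R st4 t4 (qs @ qs3)"
        proof (rule R)
          show "var st4 ''b'' = b" using agree_var[OF ag4] st3 by simp
          have "arr st4 ''T'' = T3" using agree_arr[OF ag4] by (simp add: T3_def)
          then show "thresholds_ok (arr st4 ''T'')" using thresholds_refines[OF okT ref] by (simp add: T3_def)
          show "approx (arr st ''A'') (arr st4 ''C'') b"
            unfolding A_def[symmetric]
          proof (rule approx_step[OF _ b(2) _ ref[folded T3_def] viol[folded T3_def]])
            show "approx A C (2 * b)" using ap by (simp add: A_def C_def)
          qed (auto simp: T_def T2 C4)
          have "(6 * (s * s) + 10) * nat (N * N) = (6 * (s * s) + 3) * nat (N * N) + (1 + 2) * nat (N * N) + (2 + 2) * nat (N * N)"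
            by (simp add: algebra_simps)
          then show "t4 \<le> t + phase_cost" using t2 t3 t4 unfolding phase_cost_def by linarith
        qed (use qs3 in auto)
      qed auto
    qed
  qed auto
  then show ?thesis
    unfolding bit_step_def
    apply -
    apply (rule wp_Seq, rule wp_Assign, simp, simp, use b bP PX in simp)
    using b by simp
qed

section \<open>Min-plus squares and distances\<close>

definition min_plus :: "(int \<Rightarrow> int) \<Rightarrow> (int \<Rightarrow> int) \<Rightarrow> bool" where
  "min_plus A A' \<longleftrightarrow> (\<forall>i\<in>{0..<N}. \<forall>j\<in>{0..<N}.
     (\<forall>k\<in>{0..<N}. A' (i * N + j) \<le> A (i * N + k) + A (k * N + j)) \<and>
     (\<exists>k\<in>{0..<N}. A (i * N + k) + A (k * N + j) \<le> A' (i * N + j)))"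

definition square_cost :: "nat \<Rightarrow> nat" where
  "square_cost B = 6 * nat (N * N) + (phase_cost + 1) * B + 6"

text \<open>The zero diagonal is used twice. Taking \<open>k = i\<close> bounds the minimum at
  \<open>(i, j)\<close> by the old entry, which is below \<open>P\<close>, and this starts the
  bisection with \<open>C = 0\<close>. For the same reason squaring never increases an entry, so
  that \<open>F\<close> stays the largest value and sums of infinities do not grow.\<close>

lemma wp_min_plus_square:
  assumes env: "env st" and ok: "weights_ok (arr st ''A'')" "thresholds_ok (arr st ''T'')"
    and diag: "\<And>i. i \<in> {0..<N} \<Longrightarrow> arr st ''A'' (i * N + i) = 0" and B: "P = 2 ^ B"
    and R: "\<And>st' t' qs2. min_plus (arr st ''A'') (arr st' ''A'') \<Longrightarrow> weights_ok (arr st' ''A'') \<Longrightarrow>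
      thresholds_ok (arr st' ''T'') \<Longrightarrow> (\<And>q. q \<in> set qs2 \<Longrightarrow> good q) \<Longrightarrow>
      length qs2 = nat (g * g * g) * B \<Longrightarrow> t' \<le> t + square_cost B \<Longrightarrow> R st' t' (qs @ qs2)"
  shows "wp min_plus_square st t qs R"
proof (rule wp_bounded)
  assume bd: "bounded X st"
  define A where "A = arr st ''A''"
  have okA: "weights_ok A" using ok by (simp add: A_def)
  note A = weights_nonneg[OF okA]
  have NN: "0 \<le> N * N" by simp
  have nn: "var st ''NN'' = N * N" using env by (simp add: env_def)
  have PX: "P \<le> X" "0 \<le> P" using X F H by auto
  let ?tail = "For ''z'' ''NN'' (Store ''A'' (Var ''z'') (Elem ''C'' (Var ''z'')))"
  show ?thesis
    unfolding min_plus_square_def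
  proof (rule wp_Seq, rule wp_pointwise[where a = "''C''" and f = "\<lambda>z. 0" and d = 1, OF _ _ _ _ nn NN])
    fix st1 :: state and t1 :: nat
    assume C1: "arr st1 ''C'' = (\<lambda>z. if 0 \<le> z \<and> z < N * N then 0 else arr st ''C'' z)"
      and ag1': "agree (insert ''z'' (mod_vars (Store ''C'' (Var ''z'') (Const 0)))) {''C''} st st1"
      and t1: "t1 \<le> t + (1 + 2) * nat (N * N) + 2"
    have ag1: "agree {''z''} {''C''} st st1" using ag1' by simp
    let ?st2 = "st1\<lparr>var := (var st1)(''b'' := P)\<rparr>"
    have ag2: "agree {''z'', ''b''} {''C''} st ?st2" using ag1 by (simp add: agree_def)
    have env2: "env ?st2" using env_agree[OF ag2 env] by (simp add: params_def)
    have ap: "approx A (arr ?st2 ''C'') P"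
      unfolding approx_def
    proof (intro conjI ballI)
      fix i j assume ij: "i \<in> {0..<N}" "j \<in> {0..<N}"
      have z: "arr ?st2 ''C'' (i * N + j) = 0" using index_range[OF ij] by (simp add: C1)
      show "arr ?st2 ''C'' (i * N + j) \<le> A (i * N + k) + A (k * N + j)" for k
        using A[of "i * N + k"] A[of "k * N + j"] z by simp
      have "A (i * N + i) + A (i * N + j) < arr ?st2 ''C'' (i * N + j) + P"
        using diag[OF ij(1)] okA F le_less_trans[of "A (i * N + j)" F P] unfolding z by (simp add: A_def weights_ok_def)
      then show "\<exists>k\<in>{0..<N}. A (i * N + k) + A (k * N + j) < arr ?st2 ''C'' (i * N + j) + P" using ij by blast
    qed (auto simp: C1)
    have st2: "arr ?st2 ''A'' = A" "arr ?st2 ''T'' = arr st ''T''"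
      using agree_arr[OF ag1] by (simp_all add: A_def)
    \<comment> \<open>\<open>c\<close> bits are still to be determined, \<open>B - c\<close> phases
      are done.\<close>
    let ?I = "\<lambda>st' t' qs'. (\<exists>c\<le>B. var st' ''b'' = 2 ^ c \<and> approx A (arr st' ''C'') (2 ^ c) \<and> thresholds_ok (arr st' ''T'') \<and>
      t' \<le> t1 + 1 + (phase_cost + 1) * (B - c) \<and>
      (\<exists>qs2. qs' = qs @ qs2 \<and> length qs2 = nat (g * g * g) * (B - c) \<and> (\<forall>q\<in>set qs2. good q)))"
    have "wp (While (Less (Const 1) (Var ''b'')) bit_step ;; ?tail) ?st2 (t1 + 1) qs R"
    proof (rule wp_Seq, rule wp_While[where I = ?I and f = "\<lambda>st. nat (var st ''b'')"])
      show "?I ?st2 (t1 + 1) qs"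
        using ap ok(2) st2(2) by (intro exI[of _ B]) (simp add: B)
    next
      fix st3 :: state and t3 :: nat and qs3 :: "int list list"
      assume I: "?I st3 t3 qs3" and tst: "bval (Less (Const 1) (Var ''b'')) st3"
        and ag3: "agree (mod_vars bit_step) (mod_arrs bit_step) ?st2 st3"
      obtain c qs2 where c: "c \<le> B" "var st3 ''b'' = 2 ^ c" "approx A (arr st3 ''C'') (2 ^ c)" "thresholds_ok (arr st3 ''T'')"
        "t3 \<le> t1 + 1 + (phase_cost + 1) * (B - c)" "qs3 = qs @ qs2" "length qs2 = nat (g * g * g) * (B - c)" "\<forall>q\<in>set qs2. good q"
        using I by blast
      have "c \<noteq> 0"
      proof
        assume "c = 0"
        with tst c(2) show False by simp
      qed
      then obtain c' where c': "c = Suc c'" by (cases c) auto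
      have b: "var st3 ''b'' = 2 * 2 ^ c'" "(1::int) \<le> 2 ^ c'" using c(2) c' by simp_all
      have env3: "env st3" using env_agree[OF ag3 env2] by (simp add: params_def)
      have A3: "arr st3 ''A'' = A" using agree_arr[OF ag3] st2 by simp
      have BC: "B - c' = Suc (B - c)" using c(1) c' by simp
      show "wp bit_step st3 (t3 + 1) qs3 (\<lambda>st4 t4 qs4. ?I st4 t4 qs4 \<and> nat (var st4 ''b'') < nat (var st3 ''b''))"
      proof (rule wp_bit_step[OF env3 b])
        show "weights_ok (arr st3 ''A'')" using okA A3 by simp
        show "thresholds_ok (arr st3 ''T'')" by (rule c(4))
        show "approx (arr st3 ''A'') (arr st3 ''C'') (2 * 2 ^ c')" using c(3) A3 c' by simp
        fix st4 :: state and t4 :: nat and qs4 :: "int list list"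
        assume 4: "var st4 ''b'' = 2 ^ c'" "thresholds_ok (arr st4 ''T'')" "approx (arr st3 ''A'') (arr st4 ''C'') (2 ^ c')"
          "\<And>q. q \<in> set qs4 \<Longrightarrow> good q" "length qs4 = nat (g * g * g)" "t4 \<le> t3 + 1 + phase_cost"
        have "t4 \<le> t1 + 1 + (phase_cost + 1) * (B - c')" using 4(6) c(5) unfolding BC by simp
        moreover have "qs3 @ qs4 = qs @ (qs2 @ qs4)" "length (qs2 @ qs4) = nat (g * g * g) * (B - c')" "\<forall>q\<in>set (qs2 @ qs4). good q"
          using c(6-8) 4(4,5) unfolding BC by auto
        moreover have "c' \<le> B" using c(1) c' by simp
        ultimately have "?I st4 t4 (qs3 @ qs4)"
          using 4(1-3) unfolding A3 by blast
        moreover have "nat (var st4 ''b'') < nat (var st3 ''b'')" using 4(1) b by simp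
        ultimately show "?I st4 t4 (qs3 @ qs4) \<and> nat (var st4 ''b'') < nat (var st3 ''b'')" by (rule conjI)
      qed
    next
      fix st3 :: state and t3 :: nat and qs3 :: "int list list"
      assume I: "?I st3 t3 qs3" and tst: "\<not> bval (Less (Const 1) (Var ''b'')) st3"
        and ag3: "agree (mod_vars bit_step) (mod_arrs bit_step) ?st2 st3"
      obtain c qs2 where c: "c \<le> B" "var st3 ''b'' = 2 ^ c" "approx A (arr st3 ''C'') (2 ^ c)" "thresholds_ok (arr st3 ''T'')"
        "t3 \<le> t1 + 1 + (phase_cost + 1) * (B - c)" "qs3 = qs @ qs2" "length qs2 = nat (g * g * g) * (B - c)" "\<forall>q\<in>set qs2. good q"
        using I by blast
      have c0: "c = 0" using tst c(2) one_less_power[of "2::int" c] by (cases "c = 0") auto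
      define C where "C = arr st3 ''C''"
      have ap3: "approx A C 1" using c(3) c0 by (simp add: C_def)
      have env3: "env st3" using env_agree[OF ag3 env2] by (simp add: params_def)
      then have nn3: "var st3 ''NN'' = N * N" by (simp add: env_def)
      have A3: "arr st3 ''A'' = A" using agree_arr[OF ag3] st2 by simp
      show "wp ?tail st3 (t3 + 1) qs3 R"
      proof (rule wp_pointwise[where a = "''A''" and f = C and d = 1, OF _ _ _ _ nn3 NN])
        fix k :: int and st4 :: state and t4 :: nat and R' :: "state \<Rightarrow> nat \<Rightarrow> int list list \<Rightarrow> bool"
        assume k: "0 \<le> k" "k < N * N" "var st4 ''z'' = k" and bd4: "bounded X st4"
          and ag4: "agree (insert ''z'' (mod_vars (Store ''A'' (Var ''z'') (Elem ''C'' (Var ''z''))))) {''A''} st3 st4"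
          and R': "\<And>st5 t5. arr st5 ''A'' = (arr st4 ''A'')(k := C k) \<Longrightarrow> t5 \<le> t4 + 1 \<Longrightarrow> R' st5 t5 qs3"
        have 4: "arr st4 ''C'' = C" using agree_arr[OF ag4] by (simp add: C_def)
        show "wp (Store ''A'' (Var ''z'') (Elem ''C'' (Var ''z''))) st4 t4 qs3 R'"
          using k 4 bounded_arr[OF bd4, of "''C''" k] by (intro wp_Store R') simp_all
      next
        fix st4 :: state and t4 :: nat
        assume A4: "arr st4 ''A'' = (\<lambda>z. if 0 \<le> z \<and> z < N * N then C z else arr st3 ''A'' z)"
          and ag4': "agree (insert ''z'' (mod_vars (Store ''A'' (Var ''z'') (Elem ''C'' (Var ''z''))))) {''A''} st3 st4"
          and t4: "t4 \<le> t3 + 1 + (1 + 2) * nat (N * N) + 2"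
        have ag4: "agree {''z''} {''A''} st3 st4" using ag4' by simp
        have T4: "arr st4 ''T'' = arr st3 ''T''" using agree_arr[OF ag4] by simp
        have le: "C (i * N + j) \<le> A (i * N + k) + A (k * N + j)" if "i \<in> {0..<N}" "j \<in> {0..<N}" "k \<in> {0..<N}" for i j k
          using ap3 that unfolding approx_def by blast
        have eq: "arr st4 ''A'' (i * N + j) = C (i * N + j)" if "i \<in> {0..<N}" "j \<in> {0..<N}" for i j
          using index_range[OF that] by (simp add: A4)
        have mp: "min_plus A (arr st4 ''A'')"
          unfolding min_plus_def
        proof (intro ballI conjI)
          fix i j assume ij: "i \<in> {0..<N}" "j \<in> {0..<N}"
          show "arr st4 ''A'' (i * N + j) \<le> A (i * N + k) + A (k * N + j)" if "k \<in> {0..<N}" for k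
            using le[OF ij that] eq[OF ij] by simp
          have "\<exists>k\<in>{0..<N}. A (i * N + k) + A (k * N + j) < C (i * N + j) + 1" using ap3 ij unfolding approx_def by blast
          then show "\<exists>k\<in>{0..<N}. A (i * N + k) + A (k * N + j) \<le> arr st4 ''A'' (i * N + j)"
            unfolding eq[OF ij] by auto
        qed
        have ok4: "weights_ok (arr st4 ''A'')"
          unfolding weights_ok_def
        proof
          fix z
          show "0 \<le> arr st4 ''A'' z \<and> arr st4 ''A'' z \<le> F"
          proof (cases "0 \<le> z \<and> z < N * N")
            case True
            then have ij: "z div N \<in> {0..<N}" "z mod N \<in> {0..<N}" and z: "z = z div N * N + z mod N"
              using N_pos div_less_of_less_mult[of z N N] by (auto simp: pos_imp_zdiv_nonneg_iff)
            \<comment> \<open>The choice \<open>k = i\<close> again, with \<open>0\<close> on the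
              diagonal.\<close>
            have "C z \<le> A (z div N * N + z div N) + A (z div N * N + z mod N)"
              using le[OF ij(1,2,1)] z by simp
            also have "\<dots> \<le> F" using diag[OF ij(1)] okA by (simp add: A_def weights_ok_def)
            finally have "C z \<le> F" .
            moreover have "0 \<le> C z" using ap3 True unfolding approx_def by auto
            ultimately show ?thesis using True by (simp add: A4)
          next
            case False
            then have "arr st4 ''A'' z = A z" unfolding A4 A3 by auto
            then show ?thesis using okA by (simp add: weights_ok_def)
          qed
        qed
        show "R st4 t4 qs3"
          unfolding c(6)
        proof (rule R[OF _ ok4])
          show "min_plus (arr st ''A'') (arr st4 ''A'')" using mp by (simp add: A_def)
          show "thresholds_ok (arr st4 ''T'')" using c(4) T4 by simp
          show "length qs2 = nat (g * g * g) * B" using c(7) c0 by simp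
          show "t4 \<le> t + square_cost B" using t4 t1 c(5) c0 unfolding square_cost_def by simp
        qed (use c(8) in auto)
      qed auto
    qed simp_all
    then show "wp (''b'' ::= Var ''P'' ;; While (Less (Const 1) (Var ''b'')) bit_step ;; ?tail) st1 t1 qs R"
      using env_agree[OF ag1 env] PX
      by (intro wp_Seq[where ?c1.0 = "_ ::= _"] wp_Assign) (simp_all add: params_def env_def)
  next
    fix k :: int and st4 :: state and t4 :: nat and R' :: "state \<Rightarrow> nat \<Rightarrow> int list list \<Rightarrow> bool"
    assume k: "0 \<le> k" "k < N * N" "var st4 ''z'' = k"
      and R': "\<And>st5 t5. arr st5 ''C'' = (arr st4 ''C'')(k := 0) \<Longrightarrow> t5 \<le> t4 + 1 \<Longrightarrow> R' st5 t5 qs"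
    show "wp (Store ''C'' (Var ''z'') (Const 0)) st4 t4 qs R'"
      using k X_ge by (intro wp_Store R') simp_all
  qed auto
qed

text \<open>An entry below \<open>F\<close> must be backed by some walk, without any bound on its
  arcs, whereas walks with at most \<open>e\<close> arcs bound the entries from above. The exception
  \<open>i = j\<close> is for padding indices: they are not nodes, so that not even the empty walk
  exists there.\<close>

definition dist_inv :: "lgraph \<Rightarrow> (int \<Rightarrow> int) \<Rightarrow> nat \<Rightarrow> bool" where
  "dist_inv G A e \<longleftrightarrow> weights_ok A \<and> (\<forall>i\<in>{0..<N}. A (i * N + i) = 0) \<and>
     (\<forall>i\<in>{0..<N}. \<forall>j\<in>{0..<N}. A (i * N + j) < F \<longrightarrow>
        i = j \<or> (\<exists>c l. walk G c (nat i) (nat j) l \<and> int l \<le> A (i * N + j))) \<and>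
     (\<forall>i<nat n. \<forall>j<nat n. \<forall>c\<le>e. \<forall>l. walk G c i j l \<longrightarrow> A (int i * N + int j) \<le> int l)"

lemma dist_inv_square:
  assumes G: "G \<in> lgraphs \<kappa>'" and nG: "n = int (node_count G)"
    and A: "dist_inv G A e" and mp: "min_plus A A'" and ok': "weights_ok A'"
  shows "dist_inv G A' (2 * e)"
proof -
  have ok: "weights_ok A" and diag: "\<And>i. i \<in> {0..<N} \<Longrightarrow> A (i * N + i) = 0"
    and lower: "\<And>i j. i \<in> {0..<N} \<Longrightarrow> j \<in> {0..<N} \<Longrightarrow> A (i * N + j) < F \<Longrightarrow>
        i = j \<or> (\<exists>c l. walk G c (nat i) (nat j) l \<and> int l \<le> A (i * N + j))"
    and upper: "\<And>i j c l. i < nat n \<Longrightarrow> j < nat n \<Longrightarrow> c \<le> e \<Longrightarrow> walk G c i j l \<Longrightarrow> A (int i * N + int j) \<le> int l"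
    using A unfolding dist_inv_def by blast+
  have le: "A' (i * N + j) \<le> A (i * N + k) + A (k * N + j)" if "i \<in> {0..<N}" "j \<in> {0..<N}" "k \<in> {0..<N}" for i j k
    using mp that unfolding min_plus_def by blast
  have ge: "\<exists>k\<in>{0..<N}. A (i * N + k) + A (k * N + j) \<le> A' (i * N + j)" if "i \<in> {0..<N}" "j \<in> {0..<N}" for i j
    using mp that unfolding min_plus_def by blast
  note nonneg = weights_nonneg[OF ok] weights_nonneg[OF ok']
  have 1: "A' (i * N + i) = 0" if "i \<in> {0..<N}" for i
    using le[OF that that that] diag[OF that] nonneg(2)[of "i * N + i"] by simp
  have 2: "i = j \<or> (\<exists>c l. walk G c (nat i) (nat j) l \<and> int l \<le> A' (i * N + j))"
    if ij: "i \<in> {0..<N}" "j \<in> {0..<N}" and F: "A' (i * N + j) < F" for i j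
  proof -
    obtain k where k: "k \<in> {0..<N}" "A (i * N + k) + A (k * N + j) \<le> A' (i * N + j)" using ge[OF ij] by blast
    \<comment> \<open>Nonnegative summands of a sum below \<open>F\<close> are below
      \<open>F\<close> themselves. So no walk is ever composed from an entry that stands for
      infinity.\<close>
    have lt: "A (i * N + k) < F" "A (k * N + j) < F"
      using k(2) F nonneg(1)[of "i * N + k"] nonneg(1)[of "k * N + j"] by linarith+
    from lower[OF ij(1) k(1) lt(1)] show ?thesis
    proof
      assume "i = k"
      have "A (k * N + j) \<le> A' (i * N + j)" using k(2) nonneg(1)[of "i * N + k"] by linarith
      with lower[OF k(1) ij(2) lt(2)] show ?thesis unfolding \<open>i = k\<close> by (meson order_trans)
    next
      assume "\<exists>c l. walk G c (nat i) (nat k) l \<and> int l \<le> A (i * N + k)"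
      then obtain c1 l1 where w1: "walk G c1 (nat i) (nat k) l1" "int l1 \<le> A (i * N + k)" by blast
      from lower[OF k(1) ij(2) lt(2)] show ?thesis
      proof
        assume "k = j"
        then show ?thesis using w1 k(2) nonneg(1)[of "k * N + j"] by (intro disjI2 exI[of _ c1] exI[of _ l1]) auto
      next
        assume "\<exists>c l. walk G c (nat k) (nat j) l \<and> int l \<le> A (k * N + j)"
        then obtain c2 l2 where w2: "walk G c2 (nat k) (nat j) l2" "int l2 \<le> A (k * N + j)" by blast
        have "walk G (c1 + c2) (nat i) (nat j) (l1 + l2)" by (rule walk_append[OF w1(1) w2(1)])
        moreover have "int (l1 + l2) \<le> A' (i * N + j)" using w1(2) w2(2) k(2) by simp
        ultimately show ?thesis by blast
      qed
    qed
  qed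
  have 3: "A' (int i * N + int j) \<le> int l"
    if ij: "i < nat n" "j < nat n" and c: "c \<le> 2 * e" and w: "walk G c i j l" for i j c l
  proof -
    \<comment> \<open>The walk is cut after at most \<open>e\<close> arcs; what is left has at most
      \<open>e\<close> arcs as well.\<close>
    define c1 where "c1 = min c e"
    have c12: "c = c1 + (c - c1)" "c1 \<le> e" "c - c1 \<le> e" using c by (auto simp: c1_def)
    interpret pair_fin_digraph "graph G" by (rule lgraph_wf[OF G])
    have "wf_digraph (with_proj (graph G))" by unfold_locales
    then obtain v l1 l2 where v: "walk G c1 i v l1" "walk G (c - c1) v j l2" "l = l1 + l2"
      using walk_split[of G c1 "c - c1" i j l] w c12(1) by auto
    have vn: "v < nat n" using walk_end[OF v(1)] lgraph_verts_iff[OF G] nG by simp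
    have rng: "int x \<in> {0..<N}" if "x < nat n" for x using that N(2) by auto
    have "A' (int i * N + int j) \<le> A (int i * N + int v) + A (int v * N + int j)"
      by (intro le rng ij vn)
    also have "\<dots> \<le> int l1 + int l2"
      by (intro add_mono upper[OF ij(1) vn c12(2) v(1)] upper[OF vn ij(2) c12(3) v(2)])
    finally show ?thesis using v(3) by simp
  qed
  show ?thesis
    using ok' 1 2 3 unfolding dist_inv_def by blast
qed

text \<open>A finite distance is attained with fewer than \<open>node_count G \<le> e\<close> arcs
  and is at most \<open>n * M < F\<close>. Hence entries below \<open>F\<close> are exact distances,
  and the entry \<open>F\<close> means that no walk exists.\<close>

lemma dist_inv_codes:
  assumes G: "G \<in> lgraphs \<kappa>'" and nG: "n = int (node_count G)" and FM: "F = n * int (length_bound G) + 1"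
    and A: "dist_inv G A e" and e: "node_count G \<le> e" and ij: "i < node_count G" "j < node_count G"
  shows "codes_distance (if A (int i * N + int j) < F then A (int i * N + int j) else -1) (distance G i j)"
proof -
  have rng: "int x \<in> {0..<N}" if "x < node_count G" for x using that N(2) nG by auto
  have lower: "A (int i * N + int j) < F \<Longrightarrow> i = j \<or> (\<exists>c l. walk G c i j l \<and> int l \<le> A (int i * N + int j))"
    using A rng[OF ij(1)] rng[OF ij(2)] unfolding dist_inv_def by (metis nat_int)
  have upper: "c \<le> e \<Longrightarrow> walk G c i j l \<Longrightarrow> A (int i * N + int j) \<le> int l" for c l
    using A ij nG unfolding dist_inv_def by simp
  have walk: "\<exists>c l. walk G c i j l \<and> int l \<le> A (int i * N + int j)" if "A (int i * N + int j) < F"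
  proof (cases "i = j")
    case True
    have "walk G 0 i j 0" using True ij lgraph_verts_iff[OF G] by simp
    moreover have "0 \<le> A (int i * N + int j)" using A by (simp add: dist_inv_def weights_ok_def)
    ultimately show ?thesis by (metis of_nat_0)
  qed (use lower[OF that] in blast)
  show ?thesis
  proof (cases "distance G i j = \<infinity>")
    case True
    then have "\<not> walk G c i j l" for c l using distance_le_walk[OF G, of c i j l] by auto
    then show ?thesis using walk True by (auto simp: codes_distance_def)
  next
    case False
    obtain c l where cl: "c < node_count G" "walk G c i j l" "distance G i j = ereal (real l)"
      using distance_attained[OF G False] by blast
    have Al: "A (int i * N + int j) \<le> int l" using upper[OF _ cl(2)] cl(1) e by simp
    have "l \<le> c * length_bound G" by (rule walk_length_le[OF G cl(2)])
    also have "\<dots> \<le> node_count G * length_bound G" using cl(1) by (intro mult_le_mono1) simp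
    finally have "int l < F" unfolding FM nG by (simp flip: of_nat_mult)
    with Al have lt: "A (int i * N + int j) < F" by simp
    then obtain c' l' where cl': "walk G c' i j l'" "int l' \<le> A (int i * N + int j)" using walk by blast
    have "ereal (real l) \<le> ereal (real l')" using distance_le_walk[OF G cl'(1)] cl(3) by simp
    then have "int l \<le> int l'" by simp
    then have "A (int i * N + int j) = int l" using Al cl'(2) by linarith
    then show ?thesis using lt cl(3) by (simp add: codes_distance_def)
  qed
qed

definition init_value :: "(int \<Rightarrow> int) \<Rightarrow> int \<Rightarrow> int" where
  "init_value f z = (if z div N = z mod N then 0
     else if z div N < n \<and> z mod N < n \<and> 0 < f (1 + (z div N * n + z mod N)) then f (1 + (z div N * n + z mod N))
     else F)"

lemma dist_inv_init:
  assumes G: "G \<in> lgraphs \<kappa>'" and nG: "n = int (node_count G)" and FM: "F = n * int (length_bound G) + 1"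
    and f: "\<And>i j. i < node_count G \<Longrightarrow> j < node_count G \<Longrightarrow> f (1 + (int i * n + int j)) = arc_length G i j"
    and A: "A = (\<lambda>z. if 0 \<le> z \<and> z < N * N then init_value f z else 0)"
  shows "dist_inv G A 1"
proof -
  have val: "A (i * N + j) = (if i = j then 0
     else if i < n \<and> j < n \<and> (nat i, nat j) \<in> parcs (graph G) then int (len G (nat i, nat j)) else F)"
    if ij: "i \<in> {0..<N}" "j \<in> {0..<N}" for i j
  proof -
    have j: "0 \<le> j" "j < N" using ij by auto
    have "A (i * N + j) = init_value f (i * N + j)" using index_range[OF ij] by (simp add: A)
    also have "\<dots> = (if i = j then 0 else if i < n \<and> j < n \<and> 0 < f (1 + (i * n + j)) then f (1 + (i * n + j)) else F)"
      unfolding init_value_def div_mod_unique[OF j] ..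
    also have "\<dots> = (if i = j then 0
     else if i < n \<and> j < n \<and> (nat i, nat j) \<in> parcs (graph G) then int (len G (nat i, nat j)) else F)"
    proof (cases "i < n \<and> j < n")
      case True
      then have "nat i < node_count G" "nat j < node_count G" using ij nG by auto
      from f[OF this] have "f (1 + (i * n + j)) = arc_length G (nat i) (nat j)" using ij by simp
      then show ?thesis using lgraph_arc(3)[OF G, of "nat i" "nat j"] by (auto simp: arc_length_def)
    qed auto
    finally show ?thesis .
  qed
  have M: "int (len G (i, j)) \<le> F" if "(i, j) \<in> parcs (graph G)" for i j
  proof -
    have "1 * int (length_bound G) \<le> n * int (length_bound G)" using n by (intro mult_right_mono) auto
    then show ?thesis using lgraph_arc(4)[OF G that] unfolding FM by linarith
  qed
  have "0 \<le> A z \<and> A z \<le> F" for z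
  proof (cases "0 \<le> z \<and> z < N * N")
    case True
    then have ij: "z div N \<in> {0..<N}" "z mod N \<in> {0..<N}" and z: "z = z div N * N + z mod N"
      using N_pos div_less_of_less_mult[of z N N] by (auto simp: pos_imp_zdiv_nonneg_iff)
    show ?thesis using val[OF ij] M F unfolding z[symmetric] by auto
  next
    case False
    then show ?thesis using F by (auto simp: A)
  qed
  moreover have "i = j \<or> (\<exists>c l. walk G c (nat i) (nat j) l \<and> int l \<le> A (i * N + j))"
    if ij: "i \<in> {0..<N}" "j \<in> {0..<N}" and F: "A (i * N + j) < F" for i j
  proof (cases "i = j")
    case False
    then have arc: "(nat i, nat j) \<in> parcs (graph G)" "A (i * N + j) = int (len G (nat i, nat j))"
      using F val[OF ij] by (auto split: if_splits)
    then have "walk G 1 (nat i) (nat j) (len G (nat i, nat j))"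
      using lgraph_arc(2)[OF G arc(1)] arc(1) lgraph_verts_iff[OF G] by simp
    then show ?thesis using arc(2) by (metis order_refl)
  qed simp
  moreover have "A (int i * N + int j) \<le> int l" if ij: "i < nat n" "j < nat n" and c: "c \<le> 1" "walk G c i j l" for i j c l
  proof -
    have rng: "int i \<in> {0..<N}" "int j \<in> {0..<N}" using ij N(2) by auto
    consider "c = 0" | "c = 1" using c by linarith
    then show ?thesis
    proof cases
      case 1
      then show ?thesis using c(2) val[OF rng] by simp
    next
      case 2
      then have "(i, j) \<in> parcs (graph G)" "l = len G (i, j)" using c(2) by auto
      moreover have "int i < n" "int j < n" using ij by auto
      ultimately show ?thesis using val[OF rng] by simp
    qed
  qed
  ultimately show ?thesis using val unfolding dist_inv_def weights_ok_def by auto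
qed

lemma wp_init_step:
  assumes env: "env st" and z: "var st ''z'' = z" "0 \<le> z"
    and R: "\<And>st' t'. arr st' ''A'' = (arr st ''A'')(z := init_value (arr st ''in'') z) \<Longrightarrow> t' \<le> t + 5 \<Longrightarrow> R st' t' qs"
  shows "wp init_step st t qs R"
proof (rule wp_bounded)
  assume bd: "bounded X st"
  have [simp]: "var st ''N'' = N" "var st ''n'' = n" "var st ''F'' = F" using env by (simp_all add: env_def)
  have zb: "\<bar>z div N\<bar> \<le> X" "\<bar>z mod N\<bar> \<le> X"
    using abs_div_int_le[of z N] bounded_var[OF bd, of "''z''"] bounded_var[OF bd, of "''N''"] z(1)
      pos_mod_bound[of N z] pos_mod_sign[of N z] N_pos \<open>var st ''N'' = N\<close> by (simp_all, linarith+)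
  have FX: "\<bar>F\<bar> \<le> X" "0 \<le> X" using bounded_var[OF bd, of "''F''"] by auto
  define i where "i = z div N"
  define j where "j = z mod N"
  define y where "y = arr st ''in'' (1 + (i * n + j))"
  have yX: "\<bar>y\<bar> \<le> X" unfolding y_def by (rule bounded_arr[OF bd])
  define v where "v = init_value (arr st ''in'') z"
  have v: "v = (if i = j then 0 else if i < n \<and> j < n \<and> 0 < y then y else F)"
    by (simp add: v_def init_value_def i_def j_def y_def)
  let ?st2 = "st\<lparr>var := (var st)(''i'' := i, ''j'' := j)\<rparr>"
  have store: "wp (Store ''A'' (Var ''z'') e) ?st2 t2 qs R"
    if "asmall e" "asize e \<le> 50" "aval e ?st2 = v" "\<bar>v\<bar> \<le> X" "t2 + 1 \<le> t + 5" for e t2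
    using that z(1) by (intro wp_Store R) (simp_all add: v_def)
  have eq: "bval (Equal (Var ''i'') (Var ''j'')) ?st2 \<longleftrightarrow> i = j" by auto
  have test: "bval (Conj (Less (Var ''i'') (Var ''n'')) (Conj (Less (Var ''j'') (Var ''n''))
      (Less (Const 0) (Elem ''in'' (Const 1 \<oplus> (Var ''i'' \<otimes> Var ''n'' \<oplus> Var ''j'')))))) ?st2 \<longleftrightarrow> i < n \<and> j < n \<and> 0 < y"
    by (simp add: y_def)
  show ?thesis
    unfolding init_step_def
  proof (rule wp_Seq, rule wp_Assign, simp, simp, use zb z in simp, rule wp_Seq, rule wp_Assign, simp, simp, use zb z in simp)
    have "wp init_cell ?st2 (t + 1 + 1) qs R"
      unfolding init_cell_def
    proof (rule wp_Cond, simp, simp, unfold eq)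
      assume "i = j"
      then show "wp (Store ''A'' (Var ''z'') (Const 0)) ?st2 (t + 1 + 1 + 1) qs R"
        using FX by (intro store) (simp_all add: v)
    next
      assume ne: "i \<noteq> j"
      show "wp (Cond (Conj (Less (Var ''i'') (Var ''n'')) (Conj (Less (Var ''j'') (Var ''n''))
          (Less (Const 0) (Elem ''in'' (Const 1 \<oplus> (Var ''i'' \<otimes> Var ''n'' \<oplus> Var ''j''))))))
        (Store ''A'' (Var ''z'') (Elem ''in'' (Const 1 \<oplus> (Var ''i'' \<otimes> Var ''n'' \<oplus> Var ''j''))))
        (Store ''A'' (Var ''z'') (Var ''F''))) ?st2 (t + 1 + 1 + 1) qs R"
      proof (rule wp_Cond, simp, simp, unfold test)
        assume "i < n \<and> j < n \<and> 0 < y"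
        then have "v = y" using ne by (simp add: v)
        then show "wp (Store ''A'' (Var ''z'') (Elem ''in'' (Const 1 \<oplus> (Var ''i'' \<otimes> Var ''n'' \<oplus> Var ''j'')))) ?st2 (t + 1 + 1 + 1 + 1) qs R"
          using yX by (intro store) (simp_all add: y_def)
      next
        assume "\<not> (i < n \<and> j < n \<and> 0 < y)"
        then have "v = F" using ne by (simp only: v if_False)
        then show "wp (Store ''A'' (Var ''z'') (Var ''F'')) ?st2 (t + 1 + 1 + 1 + 1) qs R"
          using FX by (intro store) simp_all
      qed
    qed
    then show "wp init_cell
      (st\<lparr>var := (var st)(''i'' := aval (Div (Var ''z'') (Var ''N'')) st),
          var := (var (st\<lparr>var := (var st)(''i'' := aval (Div (Var ''z'') (Var ''N'')) st)\<rparr>))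
            (''j'' := aval (Mod (Var ''z'') (Var ''N'')) (st\<lparr>var := (var st)(''i'' := aval (Div (Var ''z'') (Var ''N'')) st)\<rparr>))\<rparr>)
      (t + 1 + 1) qs R"
      using z by (simp add: i_def j_def)
  qed
qed

lemma wp_output_step:
  assumes env: "env st" and z: "var st ''z'' = z" "0 \<le> z"
    and w: "w = arr st ''A'' (z div n * N + z mod n)"
    and R: "\<And>st' t'. arr st' ''out'' = (arr st ''out'')(z := if w < F then w else -1) \<Longrightarrow> t' \<le> t + 5 \<Longrightarrow> R st' t' qs"
  shows "wp output_step st t qs R"
proof (rule wp_bounded)
  assume bd: "bounded X st"
  have [simp]: "var st ''N'' = N" "var st ''n'' = n" "var st ''F'' = F" using env by (simp_all add: env_def)
  have zb: "\<bar>z div n\<bar> \<le> X" "\<bar>z mod n\<bar> \<le> X"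
    using abs_div_int_le[of z n] bounded_var[OF bd, of "''z''"] bounded_var[OF bd, of "''n''"] z(1)
      pos_mod_bound[of n z] pos_mod_sign[of n z] n \<open>var st ''n'' = n\<close> by (simp_all, linarith+)
  have wX: "\<bar>w\<bar> \<le> X" unfolding w by (rule bounded_arr[OF bd])
  show ?thesis unfolding output_step_def using zb wX z w[symmetric] X_ge
    by (intro wp_Seq wp_Assign wp_Cond wp_Store) (simp_all, (rule R; simp)+)
qed


text \<open>Of \<open>c\<close> squarings the last one starts at \<open>2 ^ (c - 1) < n\<close>,
  which bounds \<open>c\<close> by \<open>1 + log n\<close>. The alternative \<open>c = 0\<close>
  stands apart because the subtraction truncates.\<close>

lemma wp_squarings:
  assumes env: "env st" and e: "var st ''e'' = 1" and G: "G \<in> lgraphs \<kappa>'" and nG: "n = int (node_count G)"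
    and nX: "2 * n \<le> X" and B: "P = 2 ^ B" and A: "dist_inv G (arr st ''A'') 1" and T: "thresholds_ok (arr st ''T'')"
    and R: "\<And>st' t' qs2 c. dist_inv G (arr st' ''A'') (2 ^ c) \<Longrightarrow> node_count G \<le> 2 ^ c \<Longrightarrow>
      env st' \<Longrightarrow> (\<And>q. q \<in> set qs2 \<Longrightarrow> good q) \<Longrightarrow> length qs2 = nat (g * g * g) * B * c \<Longrightarrow>
      c = 0 \<or> 2 ^ (c - 1) < node_count G \<Longrightarrow> t' \<le> t + (square_cost B + 2) * c + 1 \<Longrightarrow> R st' t' (qs @ qs2)"
  shows "wp (While (Less (Var ''e'') (Var ''n'')) (min_plus_square ;; ''e'' ::= Var ''e'' \<oplus> Var ''e'')) st t qs R"
proof -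
  let ?c = "min_plus_square ;; ''e'' ::= Var ''e'' \<oplus> Var ''e''"
  let ?I = "\<lambda>st' t' qs'. \<exists>c. var st' ''e'' = 2 ^ c \<and> dist_inv G (arr st' ''A'') (2 ^ c) \<and> thresholds_ok (arr st' ''T'') \<and>
     (c = 0 \<or> 2 ^ (c - 1) < node_count G) \<and> t' \<le> t + (square_cost B + 2) * c \<and>
     (\<exists>qs2. qs' = qs @ qs2 \<and> length qs2 = nat (g * g * g) * B * c \<and> (\<forall>q\<in>set qs2. good q))"
  show ?thesis
  proof (rule wp_While[where I = ?I and f = "\<lambda>st. nat (n - var st ''e'')"])
    show "?I st t qs" using e A T by (intro exI[of _ 0]) simp
  next
    fix st1 :: state and t1 qs1
    assume I: "?I st1 t1 qs1" and tst: "bval (Less (Var ''e'') (Var ''n'')) st1"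
      and ag: "agree (mod_vars ?c) (mod_arrs ?c) st st1"
    obtain c qs2 where c: "var st1 ''e'' = 2 ^ c" "dist_inv G (arr st1 ''A'') (2 ^ c)" "thresholds_ok (arr st1 ''T'')"
      "t1 \<le> t + (square_cost B + 2) * c" "qs1 = qs @ qs2" "length qs2 = nat (g * g * g) * B * c" "\<forall>q\<in>set qs2. good q"
      using I by blast
    have env1: "env st1" using env_agree[OF ag env] by (simp add: params_def)
    have less: "(2::int) ^ c < n" using tst c(1) env1 by (simp add: env_def)
    have ok: "weights_ok (arr st1 ''A'')" and diag: "\<And>i. i \<in> {0..<N} \<Longrightarrow> arr st1 ''A'' (i * N + i) = 0"
      using c(2) by (simp_all add: dist_inv_def)
    show "wp (min_plus_square ;; ''e'' ::= Var ''e'' \<oplus> Var ''e'') st1 (t1 + 1) qs1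
        (\<lambda>st2 t2 qs2. ?I st2 t2 qs2 \<and> nat (n - var st2 ''e'') < nat (n - var st1 ''e''))"
    proof (rule wp_Seq, rule wp_conseq, rule wp_min_plus_square[OF env1 ok c(3) diag B])
      fix st2 :: state and t2 qs3
      assume 2: "min_plus (arr st1 ''A'') (arr st2 ''A'')" "weights_ok (arr st2 ''A'')" "thresholds_ok (arr st2 ''T'')"
        "\<And>q. q \<in> set qs3 \<Longrightarrow> good q" "length qs3 = nat (g * g * g) * B" "t2 \<le> t1 + 1 + square_cost B"
      show "dist_inv G (arr st2 ''A'') (2 ^ (c + 1)) \<and> thresholds_ok (arr st2 ''T'') \<and> t2 + 1 \<le> t + (square_cost B + 2) * (c + 1) \<and>
        (\<exists>qs4. qs1 @ qs3 = qs @ qs4 \<and> length qs4 = nat (g * g * g) * B * (c + 1) \<and> (\<forall>q\<in>set qs4. good q))"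
      proof (intro conjI)
        show "dist_inv G (arr st2 ''A'') (2 ^ (c + 1))"
          using dist_inv_square[OF G nG c(2) 2(1,2)] by simp
        show "t2 + 1 \<le> t + (square_cost B + 2) * (c + 1)" using 2(6) c(4) by simp
        show "\<exists>qs4. qs1 @ qs3 = qs @ qs4 \<and> length qs4 = nat (g * g * g) * B * (c + 1) \<and> (\<forall>q\<in>set qs4. good q)"
          using c(5-7) 2(4,5) by (intro exI[of _ "qs2 @ qs3"]) auto
      qed (rule 2(3))
    next
      fix st2 :: state and t2 qs3
      assume 3: "dist_inv G (arr st2 ''A'') (2 ^ (c + 1)) \<and> thresholds_ok (arr st2 ''T'') \<and> t2 + 1 \<le> t + (square_cost B + 2) * (c + 1) \<and>
        (\<exists>qs4. qs3 = qs @ qs4 \<and> length qs4 = nat (g * g * g) * B * (c + 1) \<and> (\<forall>q\<in>set qs4. good q))"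
        and ag2: "agree (mod_vars min_plus_square) (mod_arrs min_plus_square) st1 st2"
      have e2: "var st2 ''e'' = 2 ^ c" using agree_var[OF ag2] c(1) by simp
      have "(2::int) ^ c + 2 ^ c \<le> X" using less nX by linarith
      then have eX: "\<bar>(2::int) ^ c + 2 ^ c\<bar> \<le> X" by simp
      have lt: "2 ^ (c + 1 - 1) < node_count G"
      proof -
        have "int (2 ^ c) < int (node_count G)" using less nG by simp
        then show ?thesis by (simp only: of_nat_less_iff add_diff_cancel_right')
      qed
      let ?st3 = "st2\<lparr>var := (var st2)(''e'' := 2 ^ (c + 1))\<rparr>"
      have "?I ?st3 (t2 + 1) qs3"
        using 3 lt by (intro exI[of _ "c + 1"]) (simp del: power_Suc)
      moreover have "nat (n - var ?st3 ''e'') < nat (n - var st1 ''e'')"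
        using less c(1) by simp
      ultimately have "?I ?st3 (t2 + 1) qs3 \<and> nat (n - var ?st3 ''e'') < nat (n - var st1 ''e'')" by (rule conjI)
      then show "wp (''e'' ::= Var ''e'' \<oplus> Var ''e'') st2 t2 qs3
        (\<lambda>st2 t2 qs2. ?I st2 t2 qs2 \<and> nat (n - var st2 ''e'') < nat (n - var st1 ''e''))"
        using e2 eX by (intro wp_Assign) (simp_all only: asmall.simps asize.simps aval.simps, simp_all)
    qed
  next
    fix st1 :: state and t1 qs1
    assume I: "?I st1 t1 qs1" and tst: "\<not> bval (Less (Var ''e'') (Var ''n'')) st1"
      and ag: "agree (mod_vars ?c) (mod_arrs ?c) st st1"
    obtain c qs2 where c: "var st1 ''e'' = 2 ^ c" "dist_inv G (arr st1 ''A'') (2 ^ c)"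
      "c = 0 \<or> 2 ^ (c - 1) < node_count G"
      "t1 \<le> t + (square_cost B + 2) * c" "qs1 = qs @ qs2" "length qs2 = nat (g * g * g) * B * c" "\<forall>q\<in>set qs2. good q"
      using I by blast
    have env1: "env st1" using env_agree[OF ag env] by (simp add: params_def)
    have "n \<le> 2 ^ c" using tst c(1) env1 by (simp add: env_def)
    then have "int (node_count G) \<le> int (2 ^ c)" using nG by simp
    then have nc: "node_count G \<le> 2 ^ c" by (simp only: of_nat_le_iff)
    show "R st1 (t1 + 1) qs1"
      unfolding c(5) using c(4,7) by (intro R[OF c(2) nc env1 _ c(6,3)]) auto
  qed simp_all
qed

lemma wp_solve:
  assumes env: "env st" and G: "G \<in> lgraphs \<kappa>'" and nG: "n = int (node_count G)" and FM: "F = n * int (length_bound G) + 1"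
    and nX: "2 * n \<le> X" "n * n \<le> X" and B: "P = 2 ^ B"
    and inp: "\<And>i j. i < node_count G \<Longrightarrow> j < node_count G \<Longrightarrow> arr st ''in'' (1 + (int i * n + int j)) = arc_length G i j"
    and A: "arr st ''A'' = (\<lambda>_. 0)" and T: "arr st ''T'' = (\<lambda>_. 0)"
    and R: "\<And>st' t' qs2 c. var st' ''len'' = n * n \<Longrightarrow>
      (\<And>i j. i < node_count G \<Longrightarrow> j < node_count G \<Longrightarrow> codes_distance (arr st' ''out'' (int i * n + int j)) (distance G i j)) \<Longrightarrow>
      (\<And>q. q \<in> set qs2 \<Longrightarrow> good q) \<Longrightarrow> length qs2 = nat (g * g * g) * B * c \<Longrightarrow>
      c = 0 \<or> 2 ^ (c - 1) < node_count G \<Longrightarrow>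
      t' \<le> t + 7 * nat (N * N) + 7 * nat (n * n) + (square_cost B + 2) * c + 10 \<Longrightarrow> R st' t' (qs @ qs2)"
  shows "wp (For ''z'' ''NN'' init_step ;; ''e'' ::= Const 1 ;;
    While (Less (Var ''e'') (Var ''n'')) (min_plus_square ;; ''e'' ::= Var ''e'' \<oplus> Var ''e'') ;;
    For ''z'' ''nn'' output_step ;; ''len'' ::= Var ''nn'') st t qs R"
proof -
  have NN: "var st ''NN'' = N * N" "0 \<le> N * N" using env by (simp_all add: env_def)
  define f where "f = arr st ''in''"
  show ?thesis
  proof (rule wp_Seq, rule wp_pointwise[where a = "''A''" and f = "init_value f" and d = 5, OF _ _ _ _ NN])
    fix k :: int and st1 :: state and t1 :: nat and R' :: "state \<Rightarrow> nat \<Rightarrow> int list list \<Rightarrow> bool"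
    assume k: "0 \<le> k" "var st1 ''z'' = k" and ag1: "agree (insert ''z'' (mod_vars init_step)) {''A''} st st1"
      and R': "\<And>st2 t2. arr st2 ''A'' = (arr st1 ''A'')(k := init_value f k) \<Longrightarrow> t2 \<le> t1 + 5 \<Longrightarrow> R' st2 t2 qs"
    have env1: "env st1" using env_agree[OF ag1 env] by (simp add: params_def)
    have "arr st1 ''in'' = f" using agree_arr[OF ag1] by (simp add: f_def)
    with R' show "wp init_step st1 t1 qs R'" by (intro wp_init_step[OF env1 k(2,1)]) simp
  next
    fix st1 :: state and t1 :: nat
    assume A1: "arr st1 ''A'' = (\<lambda>z. if 0 \<le> z \<and> z < N * N then init_value f z else arr st ''A'' z)"
      and ag1: "agree (insert ''z'' (mod_vars init_step)) {''A''} st st1" and t1: "t1 \<le> t + (5 + 2) * nat (N * N) + 2"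
    have env1: "env st1" using env_agree[OF ag1 env] by (simp add: params_def)
    let ?st2 = "st1\<lparr>var := (var st1)(''e'' := 1)\<rparr>"
    have ag2: "agree {''e''} {} st1 ?st2" by (simp add: agree_def)
    have env2: "env ?st2" using env_agree[OF ag2 env1] by (simp add: params_def)
    have D: "dist_inv G (arr ?st2 ''A'') 1"
      using inp A1[unfolded A] by (intro dist_inv_init[OF G nG FM, of f]) (simp_all add: f_def)
    have T2: "thresholds_ok (arr ?st2 ''T'')"
      using agree_arr[OF ag1] T F by (simp add: thresholds_ok_def)
    have "wp (While (Less (Var ''e'') (Var ''n'')) (min_plus_square ;; ''e'' ::= Var ''e'' \<oplus> Var ''e'') ;;
      For ''z'' ''nn'' output_step ;; ''len'' ::= Var ''nn'') ?st2 (t1 + 1) qs R"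
    proof (rule wp_Seq, rule wp_squarings[OF env2 _ G nG nX(1) B D T2])
      fix st3 :: state and t3 :: nat and qs3 and c :: nat
      assume D3: "dist_inv G (arr st3 ''A'') (2 ^ c)" "node_count G \<le> 2 ^ c" and env3: "env st3"
        and qs3: "\<And>q. q \<in> set qs3 \<Longrightarrow> good q" "length qs3 = nat (g * g * g) * B * c"
        and c: "c = 0 \<or> 2 ^ (c - 1) < node_count G" and t3: "t3 \<le> t1 + 1 + (square_cost B + 2) * c + 1"
      have nn: "var st3 ''nn'' = n * n" "0 \<le> n * n" using env3 by (simp_all add: env_def)
      define A3 where "A3 = arr st3 ''A''"
      let ?o = "\<lambda>z. if A3 (z div n * N + z mod n) < F then A3 (z div n * N + z mod n) else -1"
      show "wp (For ''z'' ''nn'' output_step ;; ''len'' ::= Var ''nn'') st3 t3 (qs @ qs3) R"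
      proof (rule wp_Seq, rule wp_pointwise[where a = "''out''" and f = ?o and d = 5, OF _ _ _ _ nn])
        fix k :: int and st4 :: state and t4 :: nat and R' :: "state \<Rightarrow> nat \<Rightarrow> int list list \<Rightarrow> bool"
        assume k: "0 \<le> k" "var st4 ''z'' = k" and ag4: "agree (insert ''z'' (mod_vars output_step)) {''out''} st3 st4"
          and R': "\<And>st5 t5. arr st5 ''out'' = (arr st4 ''out'')(k := ?o k) \<Longrightarrow> t5 \<le> t4 + 5 \<Longrightarrow> R' st5 t5 (qs @ qs3)"
        have env4: "env st4" using env_agree[OF ag4 env3] by (simp add: params_def)
        have A4: "arr st4 ''A'' = A3" using agree_arr[OF ag4] by (simp add: A3_def)
        show "wp output_step st4 t4 (qs @ qs3) R'"
          by (rule wp_output_step[OF env4 k(2,1) refl]) (rule R', simp_all add: A4)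
      next
        fix st4 :: state and t4 :: nat
        assume o4: "arr st4 ''out'' = (\<lambda>z. if 0 \<le> z \<and> z < n * n then ?o z else arr st3 ''out'' z)"
          and ag4: "agree (insert ''z'' (mod_vars output_step)) {''out''} st3 st4"
          and t4: "t4 \<le> t3 + (5 + 2) * nat (n * n) + 2"
        have nn4: "var st4 ''nn'' = n * n" using agree_var[OF ag4] nn by simp
        let ?st5 = "st4\<lparr>var := (var st4)(''len'' := n * n)\<rparr>"
        have "R ?st5 (t4 + 1) (qs @ qs3)"
        proof (rule R[OF _ _ qs3 c])
          fix i j assume ij: "i < node_count G" "j < node_count G"
          have j: "0 \<le> int j" "int j < n" using ij nG by simp_all
          have "int i * n + int j < (int i + 1) * n" using j by (simp add: algebra_simps)
          also have "\<dots> \<le> n * n" using ij nG by (intro mult_right_mono) auto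
          finally have "arr ?st5 ''out'' (int i * n + int j) = ?o (int i * n + int j)" using j n by (simp add: o4)
          also have "\<dots> = (if A3 (int i * N + int j) < F then A3 (int i * N + int j) else -1)"
            unfolding div_mod_unique[OF j] ..
          finally show "codes_distance (arr ?st5 ''out'' (int i * n + int j)) (distance G i j)"
            using dist_inv_codes[OF G nG FM D3 ij, folded A3_def] by (simp only:)
        next
          have "t4 + 1 \<le> t + 7 * a + 7 * b + d + 10"
            if "t1 \<le> t + (5 + 2) * a + 2" "t3 \<le> t1 + 1 + d + 1" "t4 \<le> t3 + (5 + 2) * b + 2" for a b d :: nat
            using that by simp
          from this[OF t1 t3 t4]
          show "t4 + 1 \<le> t + 7 * nat (N * N) + 7 * nat (n * n) + (square_cost B + 2) * c + 10" .
        qed simp_all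
        then show "wp (''len'' ::= Var ''nn'') st4 t4 (qs @ qs3) R"
          using nn4 nX(2) by (intro wp_Assign) simp_all
      qed simp_all
    qed simp
    then show "wp (''e'' ::= Const 1 ;; While (Less (Var ''e'') (Var ''n'')) (min_plus_square ;; ''e'' ::= Var ''e'' \<oplus> Var ''e'') ;;
      For ''z'' ''nn'' output_step ;; ''len'' ::= Var ''nn'') st1 t1 qs R"
      using X_ge by (intro wp_Seq[where ?c1.0 = "_ ::= _"] wp_Assign) simp_all
  qed simp_all
qed

end

section \<open>Computing the parameters\<close>

context bounded_machine
begin

text \<open>A linear search is affordable: its at most \<open>n\<close> rounds vanish beside the
  \<open>n * n\<close> cells of the input.\<close>

lemma wp_root_loop:
  assumes n: "var st ''n'' = int n" "1 \<le> n" and s: "var st ''s'' = 1"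
    and R: "\<And>st' t' s. var st' ''s'' = int s \<Longrightarrow> 1 \<le> s \<Longrightarrow> s ^ 3 \<le> n \<Longrightarrow> n < (s + 1) ^ 3 \<Longrightarrow>
      agree {''s''} {} st st' \<Longrightarrow> t' \<le> t + 2 * n + 1 \<Longrightarrow> R st' t' qs"
  shows "wp root_loop st t qs R"
proof (rule wp_bounded)
  assume bd: "bounded X st"
  have nX: "int n \<le> X" using bounded_var[OF bd, of "''n''"] n by simp
  have cube: "k \<le> k ^ 3" for k :: nat by (cases "k = 0") (auto intro: self_le_power)
  let ?I = "\<lambda>st' t' qs'. \<exists>s. var st' ''s'' = int s \<and> 1 \<le> s \<and> s ^ 3 \<le> n \<and> t' \<le> t + 2 * s \<and> qs' = qs"
  let ?b = "Neg (Less (Var ''n'') ((Var ''s'' \<oplus> Const 1) \<otimes> (Var ''s'' \<oplus> Const 1) \<otimes> (Var ''s'' \<oplus> Const 1)))" and ?c = "''s'' ::= Var ''s'' \<oplus> Const 1"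
  have tst: "bval ?b st'
      \<longleftrightarrow> (s + 1) ^ 3 \<le> n" if "var st' ''s'' = int s" "var st' ''n'' = int n" for st' s
  proof -
    have "int ((s + 1) ^ 3) = (int s + 1) * (int s + 1) * (int s + 1)"
      by (simp add: power3_eq_cube algebra_simps)
    then have "(s + 1) ^ 3 \<le> n \<longleftrightarrow> (int s + 1) * (int s + 1) * (int s + 1) \<le> int n" by (metis of_nat_le_iff)
    then show ?thesis using that by auto
  qed
  show ?thesis
    unfolding root_loop_def
  proof (rule wp_While[where I = ?I and f = "\<lambda>st. nat (int n - var st ''s'')"])
    show "?I st t qs" using s n(2) by (intro exI[of _ 1]) simp
  next
    fix st1 :: state and t1 qs1
    assume I: "?I st1 t1 qs1" and b: "bval ?b st1"
      and ag: "agree (mod_vars ?c) (mod_arrs ?c) st st1"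
    obtain s where s: "var st1 ''s'' = int s" "1 \<le> s" "s ^ 3 \<le> n" "t1 \<le> t + 2 * s" "qs1 = qs" using I by blast
    have n1: "var st1 ''n'' = int n" using agree_var[OF ag] n by simp
    have s1: "(s + 1) ^ 3 \<le> n" using b unfolding tst[OF s(1) n1] .
    then have "s + 1 \<le> n" using cube[of "s + 1"] by simp
    then have sn: "int s + 1 \<le> int n" by simp
    let ?st2 = "st1\<lparr>var := (var st1)(''s'' := int s + 1)\<rparr>"
    have "?I ?st2 (t1 + 1 + 1) qs1" using s s1 by (intro exI[of _ "s + 1"]) simp
    moreover have "nat (int n - var ?st2 ''s'') < nat (int n - var st1 ''s'')" using s(1) sn by simp
    ultimately have "?I ?st2 (t1 + 1 + 1) qs1 \<and> nat (int n - var ?st2 ''s'') < nat (int n - var st1 ''s'')" by (rule conjI)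
    then show "wp (''s'' ::= Var ''s'' \<oplus> Const 1) st1 (t1 + 1) qs1
        (\<lambda>st2 t2 qs2. ?I st2 t2 qs2 \<and> nat (int n - var st2 ''s'') < nat (int n - var st1 ''s''))"
      using s(1) sn nX by (intro wp_Assign) (simp_all only: asmall.simps asize.simps aval.simps, simp_all)
  next
    fix st1 :: state and t1 qs1
    assume I: "?I st1 t1 qs1" and b: "\<not> bval ?b st1"
      and ag: "agree (mod_vars ?c) (mod_arrs ?c) st st1"
    obtain s where s: "var st1 ''s'' = int s" "1 \<le> s" "s ^ 3 \<le> n" "t1 \<le> t + 2 * s" "qs1 = qs" using I by blast
    have n1: "var st1 ''n'' = int n" using agree_var[OF ag] n by simp
    have s1: "n < (s + 1) ^ 3" using b unfolding tst[OF s(1) n1] by simp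
    have "s \<le> n" using cube[of s] s(3) by simp
    then have t1: "t1 + 1 \<le> t + 2 * n + 1" using s(4) by simp
    have ag': "agree {''s''} {} st st1" using ag by simp
    show "R st1 (t1 + 1) qs1" unfolding s(5) by (rule R[OF s(1-3) s1 ag' t1])
  qed simp_all
qed

text \<open>Together \<open>le\<close> and \<open>att\<close> say that \<open>M\<close> is the
  maximum of 1 and the entries, i.e. \<open>length_bound\<close>; the zeros that code missing edges
  never exceed the initial value 1.\<close>

lemma wp_max_loop:
  assumes nn: "var st ''nn'' = int nn" and M1: "var st ''M'' = 1" and M: "1 \<le> M"
    and le: "\<And>z. z < nn \<Longrightarrow> arr st ''in'' (1 + int z) \<le> int M"
    and att: "M = 1 \<or> (\<exists>z<nn. arr st ''in'' (1 + int z) = int M)"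
    and R: "\<And>st' t'. var st' ''M'' = int M \<Longrightarrow> agree {''z'', ''M''} {} st st' \<Longrightarrow> t' \<le> t + 4 * nn + 2 \<Longrightarrow> R st' t' qs"
  shows "wp max_loop st t qs R"
proof -
  let ?c = "Cond (Less (Var ''M'') (Elem ''in'' (Const 1 \<oplus> Var ''z''))) (''M'' ::= Elem ''in'' (Const 1 \<oplus> Var ''z'')) Skip"
  let ?I = "\<lambda>k st' t' qs'. 1 \<le> var st' ''M'' \<and> var st' ''M'' \<le> int M \<and>
    (\<forall>z. 0 \<le> z \<and> z < k \<longrightarrow> arr st ''in'' (1 + z) \<le> var st' ''M'') \<and> qs' = qs \<and> t' \<le> t + 4 * nat k"
  show ?thesis
    unfolding max_loop_def
  proof (rule wp_For[where I = ?I, OF _ _ _ nn[symmetric]])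
    fix k st1 t1 qs1
    assume k: "0 \<le> k" "k < int nn" "var st1 ''z'' = k" and bd: "bounded X st1"
      and ag: "agree (insert ''z'' (mod_vars ?c)) (mod_arrs ?c) st st1" and I: "?I k st1 t1 qs1"
    have in1: "arr st1 ''in'' = arr st ''in''" using agree_arr[OF ag] by simp
    define y where "y = arr st ''in'' (1 + k)"
    have yM: "y \<le> int M" using le[of "nat k"] k by (simp add: y_def)
    have yX: "\<bar>y\<bar> \<le> X" using bounded_arr[OF bd, of "''in''" "1 + k"] in1 by (simp add: y_def)
    have all: "\<forall>z. 0 \<le> z \<and> z < k + 1 \<longrightarrow> arr st ''in'' (1 + z) \<le> v" if "var st1 ''M'' \<le> v" "y \<le> v" for v
    proof (intro allI impI)
      fix z assume "0 \<le> z \<and> z < k + 1"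
      then show "arr st ''in'' (1 + z) \<le> v" using I that by (cases "z = k") (force simp: y_def)+
    qed
    have tt: "t1 + 1 + 1 + 2 \<le> t + 4 * nat (k + 1)" using I k(1) by (simp add: nat_add_distrib)
    show "wp ?c st1 t1 qs1 (\<lambda>st2 t2 qs2. ?I (k + 1) (st2\<lparr>var := (var st2)(''z'' := k + 1)\<rparr>) (t2 + 2) qs2)"
    proof (rule wp_Cond)
      assume b: "bval (Less (Var ''M'') (Elem ''in'' (Const 1 \<oplus> Var ''z''))) st1"
      then have "var st1 ''M'' \<le> y" using k in1 by (simp add: y_def)
      then have "?I (k + 1) (st1\<lparr>var := (var st1)(''M'' := y, ''z'' := k + 1)\<rparr>) (t1 + 1 + 1 + 2) qs1"
        using I all[of y] yM tt by simp
      then show "wp (''M'' ::= Elem ''in'' (Const 1 \<oplus> Var ''z'')) st1 (t1 + 1) qs1 (\<lambda>st2 t2 qs2. ?I (k + 1) (st2\<lparr>var := (var st2)(''z'' := k + 1)\<rparr>) (t2 + 2) qs2)"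
        using k(3) in1 by (intro wp_Assign_Elem) (simp_all add: y_def)
    next
      assume b: "\<not> bval (Less (Var ''M'') (Elem ''in'' (Const 1 \<oplus> Var ''z''))) st1"
      then have "y \<le> var st1 ''M''" using k in1 by (simp add: y_def)
      then show "wp Skip st1 (t1 + 1) qs1 (\<lambda>st2 t2 qs2. ?I (k + 1) (st2\<lparr>var := (var st2)(''z'' := k + 1)\<rparr>) (t2 + 2) qs2)"
        using I all[of "var st1 ''M''"] tt by (intro wp_Skip) simp
    qed simp_all
  next
    fix st1 t1 qs1
    assume ag: "agree (insert ''z'' (mod_vars ?c)) (mod_arrs ?c) st st1" and I: "?I (int nn) st1 t1 qs1"
    have "var st1 ''M'' = int M"
    proof (cases "M = 1")
      case False
      then obtain z where "z < nn" "arr st ''in'' (1 + int z) = int M" using att by blast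
      moreover have "0 \<le> int z \<and> int z < int nn" using \<open>z < nn\<close> by simp
      ultimately have "int M \<le> var st1 ''M''" using I by metis
      then show ?thesis using I by simp
    qed (use I in simp)
    then show "R st1 (t1 + 2) qs1" using R[of st1 "t1 + 2"] I ag by simp
  qed (use M1 M in auto)
qed

text \<open>The last doubling starts from a power at most \<open>F\<close>, so \<open>P\<close>
  overshoots by a factor of at most 2, and the number \<open>B\<close> of bits is logarithmic in
  \<open>n * M\<close>.\<close>

lemma wp_double_loop:
  assumes F: "var st ''F'' = F" "1 \<le> F" "2 * F \<le> X" and P: "var st ''P'' = 1"
    and R: "\<And>st' t' B. var st' ''P'' = 2 ^ B \<Longrightarrow> F < 2 ^ B \<Longrightarrow> 2 ^ B \<le> 2 * F \<Longrightarrow>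
      agree {''P''} {} st st' \<Longrightarrow> t' \<le> t + 2 * B + 1 \<Longrightarrow> R st' t' qs"
  shows "wp (While (Neg (Less (Var ''F'') (Var ''P''))) (''P'' ::= Var ''P'' \<oplus> Var ''P'')) st t qs R"
proof -
  let ?c = "''P'' ::= Var ''P'' \<oplus> Var ''P''"
  let ?I = "\<lambda>st' t' qs'. \<exists>B. var st' ''P'' = 2 ^ B \<and> 2 ^ B \<le> 2 * F \<and> t' \<le> t + 2 * B \<and> qs' = qs"
  show ?thesis
  proof (rule wp_While[where I = ?I and f = "\<lambda>st. nat (F + 1 - var st ''P'')"])
    show "?I st t qs" using P F by (intro exI[of _ 0]) simp
  next
    fix st1 :: state and t1 qs1
    assume I: "?I st1 t1 qs1" and b: "bval (Neg (Less (Var ''F'') (Var ''P''))) st1"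
      and ag: "agree (mod_vars ?c) (mod_arrs ?c) st st1"
    obtain B where B: "var st1 ''P'' = 2 ^ B" "t1 \<le> t + 2 * B" "qs1 = qs" using I by blast
    have F1: "var st1 ''F'' = F" using agree_var[OF ag] F by simp
    have le: "(2::int) ^ B \<le> F" using b B(1) F1 by simp
    have pos: "(1::int) \<le> 2 ^ B" by simp
    let ?st2 = "st1\<lparr>var := (var st1)(''P'' := 2 ^ B + 2 ^ B)\<rparr>"
    have "?I ?st2 (t1 + 1 + 1) qs1" using B le by (intro exI[of _ "B + 1"]) simp
    moreover have "nat (F + 1 - var ?st2 ''P'') < nat (F + 1 - var st1 ''P'')" using B(1) le pos by simp
    ultimately have 2: "?I ?st2 (t1 + 1 + 1) qs1 \<and> nat (F + 1 - var ?st2 ''P'') < nat (F + 1 - var st1 ''P'')" by (rule conjI)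
    have "\<bar>(2::int) ^ B + 2 ^ B\<bar> \<le> X" using le pos F(3) by linarith
    with 2 show "wp ?c st1 (t1 + 1) qs1
        (\<lambda>st2 t2 qs2. ?I st2 t2 qs2 \<and> nat (F + 1 - var st2 ''P'') < nat (F + 1 - var st1 ''P''))"
      using B(1) by (intro wp_Assign) (simp_all only: asmall.simps asize.simps aval.simps, (simp_all)?)
  next
    fix st1 :: state and t1 qs1
    assume I: "?I st1 t1 qs1" and b: "\<not> bval (Neg (Less (Var ''F'') (Var ''P''))) st1"
      and ag: "agree (mod_vars ?c) (mod_arrs ?c) st st1"
    obtain B where B: "var st1 ''P'' = 2 ^ B" "2 ^ B \<le> 2 * F" "t1 \<le> t + 2 * B" "qs1 = qs" using I by blast
    have F1: "var st1 ''F'' = F" using agree_var[OF ag] F by simp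
    have lt: "F < 2 ^ B" using b B(1) F1 by simp
    have ag': "agree {''P''} {} st st1" using ag by simp
    show "R st1 (t1 + 1) qs1" unfolding B(4) using B(3) by (intro R[OF B(1) lt B(2) ag']) simp
  qed simp_all
qed

text \<open>The same information as \<open>env\<close>, but outside \<open>apsp_machine\<close>: the
  parameters \<open>s\<close> and \<open>B\<close> of that locale are known only after the program
  has computed them.\<close>

definition prepared :: "state \<Rightarrow> nat \<Rightarrow> nat \<Rightarrow> nat \<Rightarrow> nat \<Rightarrow> bool" where
  "prepared st n M s B \<longleftrightarrow> (let g = n div s + 1; N = g * s; m = 4 * s + 1; F = n * M + 1 in
     var st ''n'' = int n \<and> var st ''nn'' = int n * int n \<and> var st ''s'' = int s \<and> var st ''ss'' = int s * int s \<and>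
     var st ''g'' = int g \<and> var st ''ggg'' = int g * int g * int g \<and> var st ''N'' = int N \<and> var st ''NN'' = int N * int N \<and>
     var st ''m'' = int m \<and> var st ''mm'' = int m * int m \<and> var st ''F'' = int F \<and> var st ''P'' = 2 ^ B \<and>
     var st ''H'' = 16 * 2 ^ B)"

lemma wp_prepare:
  assumes n: "arr st ''in'' 0 = int n" "1 \<le> n" and M: "1 \<le> M"
    and le: "\<And>z. z < n * n \<Longrightarrow> arr st ''in'' (1 + int z) \<le> int M"
    and att: "M = 1 \<or> (\<exists>z<n * n. arr st ''in'' (1 + int z) = int M)"
    and bounds: "\<And>s. 1 \<le> s \<Longrightarrow> s ^ 3 \<le> n \<Longrightarrow> int ((n div s + 1) ^ 3) \<le> X \<and>
      int (((n div s + 1) * s) ^ 2) \<le> X \<and> int ((4 * s + 1) ^ 2) \<le> X"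
    and F: "64 * int (n * M) \<le> X" "int (n ^ 2) \<le> X"
    and R: "\<And>st' t' s B. 1 \<le> s \<Longrightarrow> s ^ 3 \<le> n \<Longrightarrow> n < (s + 1) ^ 3 \<Longrightarrow> int (n * M + 1) < 2 ^ B \<Longrightarrow>
      2 ^ B \<le> 2 * int (n * M + 1) \<Longrightarrow> prepared st' n M s B \<Longrightarrow> arr st' = arr st \<Longrightarrow>
      t' \<le> t + 4 * (n * n) + 2 * n + 2 * B + 30 \<Longrightarrow> R st' t' qs"
  shows "wp prepare st t qs R"
proof -
  have pow: "int (k * k) = int (k ^ 2)" "int (k * k * k) = int (k ^ 3)" for k :: nat
    by (simp_all add: power2_eq_square power3_eq_cube)
  have self: "int k \<le> int (k ^ 2)" "int k \<le> int (k ^ 3)" for k :: nat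
    by (cases "k = 0"; simp add: self_le_power del: of_nat_power)+
  have nM: "1 \<le> int (n * M)"
  proof -
    have "1 * 1 \<le> n * M" using n M by (intro mult_le_mono) auto
    then show ?thesis by linarith
  qed
  let ?A = "st\<lparr>var := (var st)(''n'' := int n, ''nn'' := int (n * n), ''s'' := 1)\<rparr>"
  have varA: "var ?A ''n'' = int n" "var ?A ''s'' = 1" by simp_all
  let ?P2 = "''g'' ::= Div (Var ''n'') (Var ''s'') \<oplus> Const 1 ;;
    ''ggg'' ::= Var ''g'' \<otimes> Var ''g'' \<otimes> Var ''g'' ;;
    ''N'' ::= Var ''g'' \<otimes> Var ''s'' ;;
    ''NN'' ::= Var ''N'' \<otimes> Var ''N'' ;;
    ''m'' ::= Const 4 \<otimes> Var ''s'' \<oplus> Const 1 ;;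
    ''mm'' ::= Var ''m'' \<otimes> Var ''m'' ;;
    ''ss'' ::= Var ''s'' \<otimes> Var ''s'' ;;
    ''F'' ::= Var ''n'' \<otimes> Var ''M'' \<oplus> Const 1 ;;
    ''P'' ::= Const 1 ;;
    While (Neg (Less (Var ''F'') (Var ''P''))) (''P'' ::= Var ''P'' \<oplus> Var ''P'') ;;
    ''H'' ::= Const 16 \<otimes> Var ''P''"
  have "wp (root_loop ;; ''M'' ::= Const 1 ;; max_loop ;; ?P2) ?A (t + 1 + 1 + 1) qs R"
  proof (rule wp_Seq, rule wp_root_loop[OF varA(1) n(2) varA(2)])
    fix st1 :: state and t1 s
    assume s: "var st1 ''s'' = int s" "1 \<le> s" "s ^ 3 \<le> n" "n < (s + 1) ^ 3" and ag1: "agree {''s''} {} ?A st1"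
      and t1: "t1 \<le> t + 1 + 1 + 1 + 2 * n + 1"
    have arr1: "arr st1 = arr st" using agree_arr[OF ag1] by (simp add: fun_eq_iff)
    let ?st2 = "st1\<lparr>var := (var st1)(''M'' := 1)\<rparr>"
    have v2: "var ?st2 ''nn'' = int (n * n)" "var ?st2 ''M'' = 1" "var ?st2 ''n'' = int n" "var ?st2 ''s'' = int s"
      using agree_var[OF ag1] s(1) by simp_all
    have "wp (max_loop ;; ?P2) ?st2 (t1 + 1) qs R"
    proof (rule wp_Seq, rule wp_max_loop[OF v2(1,2) M])
      show "arr ?st2 ''in'' (1 + int z) \<le> int M" if "z < n * n" for z using le[OF that] arr1 by simp
      show "M = 1 \<or> (\<exists>z<n * n. arr ?st2 ''in'' (1 + int z) = int M)" using att arr1 by simp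
      fix st3 :: state and t3
      assume M3: "var st3 ''M'' = int M" and ag3: "agree {''z'', ''M''} {} ?st2 st3" and t3: "t3 \<le> t1 + 1 + 4 * (n * n) + 2"
      have arr3: "arr st3 = arr st" using agree_arr[OF ag3] arr1 by (simp add: fun_eq_iff)
      have v3: "var st3 ''n'' = int n" "var st3 ''nn'' = int (n * n)" "var st3 ''s'' = int s"
        using agree_var[OF ag3] v2 by simp_all
      define g where "g = n div s + 1"
      define N where "N = g * s"
      define m where "m = 4 * s + 1"
      define F where "F = n * M + 1"
      have b: "int (g ^ 3) \<le> X" "int (N ^ 2) \<le> X" "int (m ^ 2) \<le> X"
        using bounds[OF s(2,3)] by (simp_all add: g_def N_def m_def)
      have FnM: "int F = int (n * M) + 1" by (simp add: F_def)
      then have F2: "2 * int F = 2 * int (n * M) + 2" by linarith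
      then have b4: "2 * int F \<le> X" using assms(7) nM by linarith
      have b': "int g \<le> X" "int N \<le> X" "int m \<le> X"
        using b self[of g] self[of N] self[of m] by linarith+
      have sm: "int (s * s) \<le> int (m * m)" by (simp add: m_def mult_mono del: of_nat_mult)
      have ssX: "int (s * s) \<le> X" using sm b(3) unfolding pow by linarith
      have gv: "int n div int s + 1 = int g" by (simp add: g_def zdiv_int)
      have val: "\<bar>int g\<bar> \<le> X" "\<bar>int (g * g * g)\<bar> \<le> X" "\<bar>int N\<bar> \<le> X" "\<bar>int (N * N)\<bar> \<le> X" "\<bar>int m\<bar> \<le> X"
        "\<bar>int (m * m)\<bar> \<le> X" "\<bar>int (s * s)\<bar> \<le> X" "\<bar>int F\<bar> \<le> X" "\<bar>1\<bar> \<le> X"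
        using b b' ssX b4 X_ge unfolding pow by simp_all
      let ?st4 = "st3\<lparr>var := (var st3)(''g'' := int g, ''ggg'' := int (g * g * g), ''N'' := int N, ''NN'' := int (N * N),
        ''m'' := int m, ''mm'' := int (m * m), ''ss'' := int (s * s), ''F'' := int F, ''P'' := 1)\<rparr>"
      have F4: "var ?st4 ''F'' = int F" "1 \<le> int F" and P4: "var ?st4 ''P'' = 1" by (simp_all add: F_def)
      have "wp (While (Neg (Less (Var ''F'') (Var ''P''))) (''P'' ::= Var ''P'' \<oplus> Var ''P'') ;;
        ''H'' ::= Const 16 \<otimes> Var ''P'') ?st4 (t3 + 1 + 1 + 1 + 1 + 1 + 1 + 1 + 1 + 1) qs R"
      proof (rule wp_Seq, rule wp_double_loop[OF F4 b4 P4])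
        fix st5 :: state and t5 B
        assume B: "var st5 ''P'' = 2 ^ B" "int F < 2 ^ B" "2 ^ B \<le> 2 * int F" and ag5: "agree {''P''} {} ?st4 st5"
          and t5: "t5 \<le> t3 + 1 + 1 + 1 + 1 + 1 + 1 + 1 + 1 + 1 + 2 * B + 1"
        have arr5: "arr st5 = arr st" using agree_arr[OF ag5] arr3 by (simp add: fun_eq_iff)
        let ?st6 = "st5\<lparr>var := (var st5)(''H'' := 16 * 2 ^ B)\<rparr>"
        have "prepared ?st6 n M s B"
          unfolding prepared_def Let_def g_def[symmetric] N_def[symmetric] m_def[symmetric] F_def[symmetric]
          using agree_var[OF ag5] v3 B(1) by simp
        moreover have "int (n * M + 1) < 2 ^ B" "2 ^ B \<le> 2 * int (n * M + 1)" using B by (simp_all add: F_def)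
        moreover have "t5 + 1 \<le> t + 4 * (n * n) + 2 * n + 2 * B + 30" using t1 t3 t5 by linarith
        ultimately have "R ?st6 (t5 + 1) qs" using R[OF s(2-4)] arr5 by simp
        moreover have "\<bar>16 * 2 ^ B\<bar> \<le> X"
        proof -
          have "0 \<le> (2::int) ^ B" by simp
          moreover have "16 * (2::int) ^ B \<le> 64 * int (n * M)" using B(3) nM F2 by linarith
          ultimately show ?thesis using assms(7) by linarith
        qed
        ultimately show "wp (''H'' ::= Const 16 \<otimes> Var ''P'') st5 t5 qs R"
          using B(1) by (intro wp_Assign) simp_all
      qed
      then show "wp ?P2 st3 t3 qs R"
        apply -
        apply (rule wp_Seq, rule wp_Assign_val[where v = "int g"], simp, simp, use v3 gv in simp, rule val)
        apply (rule wp_Seq, rule wp_Assign_val[where v = "int (g * g * g)"], simp, simp, use v3 in simp, rule val)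
        apply (rule wp_Seq, rule wp_Assign_val[where v = "int N"], simp, simp, use v3 N_def in simp, rule val)
        apply (rule wp_Seq, rule wp_Assign_val[where v = "int (N * N)"], simp, simp, use v3 in simp, rule val)
        apply (rule wp_Seq, rule wp_Assign_val[where v = "int m"], simp, simp, use v3 m_def in simp, rule val)
        apply (rule wp_Seq, rule wp_Assign_val[where v = "int (m * m)"], simp, simp, use v3 in simp, rule val)
        apply (rule wp_Seq, rule wp_Assign_val[where v = "int (s * s)"], simp, simp, use v3 in simp, rule val)
        apply (rule wp_Seq, rule wp_Assign_val[where v = "int F"], simp, simp, use v3 M3 F_def in simp, rule val)
        apply (rule wp_Seq, rule wp_Assign_val[where v = "1"], simp, simp, use v3 in simp, rule val)
        apply simp
        done
    qed
    then show "wp (''M'' ::= Const 1 ;; max_loop ;; ?P2) st1 t1 qs R"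
      using X_ge by (intro wp_Seq[where ?c1.0 = "_ ::= Const 1"] wp_Assign) simp_all
  qed
  then show ?thesis
    unfolding prepare_def
    apply -
    apply (rule wp_Seq, rule wp_Assign_Elem, simp, simp)
    apply (rule wp_Seq, rule wp_Assign, simp, simp, use n F(2) pow(1)[of n] in simp)
    apply (rule wp_Seq, rule wp_Assign, simp, simp, use X_ge in simp)
    using n by simp
qed

end

text \<open>Turns the recorded list of encoded queries into a list of instances, as
  \<open>subcubic_reducible\<close> demands.\<close>

lemma obtain_preimages:
  "(\<And>q. q \<in> set qs \<Longrightarrow> \<exists>y. P y \<and> f y = q) \<Longrightarrow> \<exists>ys. map f ys = qs \<and> (\<forall>y\<in>set ys. P y)"
proof (induction qs)
  case (Cons q qs)
  obtain ys where "map f ys = qs" "\<forall>y\<in>set ys. P y" using Cons.IH Cons.prems by auto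
  moreover obtain y where "P y" "f y = q" using Cons.prems[of q] by auto
  ultimately show ?case by (intro exI[of _ "y # ys"]) auto
qed simp

section \<open>Correctness and step count of the whole program\<close>

definition sweep_units :: "nat \<Rightarrow> nat \<Rightarrow> nat" where
  "sweep_units g s = (6 * (s * s) + 10) * (g * s) ^ 2 + 42 * ((4 * s + 1) * (4 * s + 1)) * g ^ 3 + 7"

definition total_units :: "nat \<Rightarrow> nat \<Rightarrow> nat \<Rightarrow> nat \<Rightarrow> nat" where
  "total_units n s B c = (let g = n div s + 1 in
     4 * (n * n) + 2 * n + 2 * B + 30 + 7 * (g * s) ^ 2 + 7 * n ^ 2 +
     (6 * (g * s) ^ 2 + (sweep_units g s + 1) * B + 6 + 2) * c + 10)"

lemma block_count_bounds:
  assumes "1 \<le> (s::nat)" "s ^ 3 \<le> n"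
  shows "n div s + 1 \<le> 2 * n" "(n div s + 1) * s \<le> 2 * n" "n \<le> (n div s + 1) * s" "s \<le> n"
proof -
  have "s \<le> s ^ 3" using assms(1) by (intro self_le_power) auto
  then show sn: "s \<le> n" using assms(2) by simp
  have "n div s \<le> n" by simp
  then show "n div s + 1 \<le> 2 * n" using sn assms(1) by linarith
  have e: "(n div s + 1) * s = n div s * s + s" by simp
  have d: "n div s * s + n mod s = n" "n mod s < s" using assms(1) by simp_all
  show "(n div s + 1) * s \<le> 2 * n" unfolding e using d sn by linarith
  show "n \<le> (n div s + 1) * s" unfolding e using d by linarith
qed

text \<open>Besides correctness it exports the three numbers that determine all costs: the block
  size \<open>s\<close>, the number \<open>B\<close> of bits per entry and the number
  \<open>c\<close> of squarings, each with the bounds needed for the asymptotic estimates.\<close>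

lemma apsp_prog_correct:
  fixes G :: lgraph
  defines "n \<equiv> node_count G" and "M \<equiv> length_bound G"
  assumes G: "G \<in> lgraphs \<kappa>" and orac: "oracle_for (reverse_rank_single_source \<kappa>) Q"
  shows "\<exists>ys t qs s B c. set qs \<subseteq> instances (reverse_rank_single_source \<kappa>) \<and>
    computes Q apsp_prog (encode (APSP \<kappa>) G) ys t (map (encode (reverse_rank_single_source \<kappa>)) qs) \<and>
    solution (APSP \<kappa>) G ys \<and> 1 \<le> s \<and> s ^ 3 \<le> n \<and> n < (s + 1) ^ 3 \<and> 2 ^ B \<le> 2 * (n * M + 1) \<and>
    (c = 0 \<or> 2 ^ (c - 1) < n) \<and> length qs = (n div s + 1) ^ 3 * B * c \<and>
    (\<forall>q\<in>set qs. nodes (reverse_rank_single_source \<kappa>) q = 4 * s + 1 \<and>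
       max_len (reverse_rank_single_source \<kappa>) q \<le> nat (magnitude n M)) \<and>
    t \<le> unit_cost (magnitude n M) * total_units n s B c"
proof -
  define X where "X = magnitude n M"
  define xs where "xs = encode_graph G"
  have nM: "1 \<le> n" "1 \<le> M" using node_count_pos[OF G] length_bound_pos[OF G] by (simp_all add: n_def M_def)
  have X16: "16 \<le> X" unfolding X_def by (rule magnitude_ge(3)[OF _ nM, of 0]) simp
  have X2: "int (n ^ 2) * k \<le> X" and XM: "int (n * M) * k \<le> X" and X3: "int (n ^ 3) * k \<le> X" if "k \<le> 4096" for k
    using magnitude_ge[OF that nM] magnitude_ge_cube[OF that nM(2)] by (simp_all add: X_def)
  interpret bounded_machine X Q by unfold_locales (rule X16)
  have len: "length xs = 1 + n * n" by (simp add: xs_def length_encode_graph n_def)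
  have nn1: "1 \<le> n * n" "n \<le> n * n" using nM by auto
  have bnd: "bounded X (initial xs)"
  proof (rule bounded_initial)
    have "int (length xs) \<le> int (n ^ 2) * 2" using nn1 unfolding len power2_eq_square by linarith
    also have "\<dots> \<le> X" by (rule X2) simp
    finally show "int (length xs) \<le> X" .
    show "\<bar>x\<bar> \<le> X" if "x \<in> set xs" for x
    proof -
      have "\<bar>x\<bar> \<le> int (n * M) * 1" using encode_graph_bounds[OF G that[unfolded xs_def]] unfolding n_def M_def by linarith
      also have "\<dots> \<le> X" by (rule XM) simp
      finally show ?thesis .
    qed
  qed (use X16 in simp)
  let ?s = "initial xs"
  have arr_in: "arr ?s ''in'' (int z) = xs ! z" if "z < 1 + n * n" for z
    using that unfolding len[symmetric] by (simp add: arr_initial)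
  have in0: "arr ?s ''in'' 0 = int n" using arr_in[of 0] encode_graph_nth(1)[of G] by (simp add: xs_def n_def)
  have inz: "arr ?s ''in'' (1 + int z) = arc_length G (z div n) (z mod n)" if "z < n * n" for z
  proof -
    have "arr ?s ''in'' (int (1 + z)) = xs ! (1 + z)" using that by (intro arr_in) simp
    also have "\<dots> = arc_length G (z div n) (z mod n)" using that by (simp add: xs_def encode_graph_eq n_def)
    finally show ?thesis by simp
  qed
  have idx: "i * n + j < n * n" "(i * n + j) div n = i" "(i * n + j) mod n = j" if "i < n" "j < n" for i j
  proof -
    show "i * n + j < n * n" using that mult_le_mono1[of "Suc i" n n] by simp
    show "(i * n + j) div n = i" "(i * n + j) mod n = j" using that by simp_all
  qed
  have le: "arr ?s ''in'' (1 + int z) \<le> int M" if "z < n * n" for z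
    using inz[OF that] arc_length_bounds(2)[OF G] by (simp add: M_def)
  have att: "M = 1 \<or> (\<exists>z<n * n. arr ?s ''in'' (1 + int z) = int M)"
  proof (cases "M = 1")
    case False
    have "finite (parcs (graph G))" using lgraph_wf[OF G] by (simp add: pair_fin_digraph_def pair_fin_digraph_axioms_def)
    then have "M \<in> insert 1 (len G ` parcs (graph G))" unfolding M_def length_bound_def by (intro Max_in) auto
    then obtain i j where ij: "(i, j) \<in> parcs (graph G)" "M = len G (i, j)" using False by auto
    then have "i < n" "j < n" using lgraph_arc(1,2)[OF G ij(1)] by (simp_all add: n_def)
    from inz[OF idx(1)[OF this]] idx[OF this] ij have "arr ?s ''in'' (1 + int (i * n + j)) = int M"
      by (simp add: arc_length_def)
    then show ?thesis using idx(1)[OF \<open>i < n\<close> \<open>j < n\<close>] by blast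
  qed simp
  \<comment> \<open>A weaker form of \<open>good\<close> from \<open>apsp_machine\<close> with a
    length bound that does not mention \<open>B\<close>, since the postcondition of the whole
    program is fixed before \<open>B\<close> is known.\<close>
  define good where "good s q \<longleftrightarrow> (\<exists>y\<in>instances (reverse_rank_single_source \<kappa>). encode (reverse_rank_single_source \<kappa>) y = q \<and>
     nodes (reverse_rank_single_source \<kappa>) y = 4 * s + 1 \<and> max_len (reverse_rank_single_source \<kappa>) y \<le> nat X)" for s q
  define post :: "state \<Rightarrow> nat \<Rightarrow> int list list \<Rightarrow> bool" where "post st t qs \<longleftrightarrow> (\<exists>s B c. var st ''len'' = int (n * n) \<and>
      (\<forall>i<n. \<forall>j<n. codes_distance (arr st ''out'' (int i * int n + int j)) (distance G i j)) \<and>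
      (\<forall>q\<in>set qs. good s q) \<and> 1 \<le> s \<and> s ^ 3 \<le> n \<and> n < (s + 1) ^ 3 \<and> 2 ^ B \<le> 2 * (n * M + 1) \<and>
      (c = 0 \<or> 2 ^ (c - 1) < n) \<and> length qs = (n div s + 1) ^ 3 * B * c \<and> t \<le> total_units n s B c)" for st t qs
  have "wp apsp_prog ?s 0 [] post"
    unfolding apsp_prog_def
  proof (rule wp_Seq, rule wp_prepare[OF in0 nM le att])
    fix s :: nat assume s: "1 \<le> s" "s ^ 3 \<le> n"
    note b = block_count_bounds[OF s]
    have "(n div s + 1) ^ 3 \<le> (2 * n) ^ 3" "((n div s + 1) * s) ^ 2 \<le> (2 * n) ^ 2" "(4 * s + 1) ^ 2 \<le> (5 * n) ^ 2"
      using b s nM by (intro power_mono; simp)+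
    then have "int ((n div s + 1) ^ 3) \<le> int ((2 * n) ^ 3)" "int (((n div s + 1) * s) ^ 2) \<le> int ((2 * n) ^ 2)"
      "int ((4 * s + 1) ^ 2) \<le> int ((5 * n) ^ 2)" by (simp_all only: of_nat_le_iff)
    moreover have "int ((2 * n) ^ 3) = int (n ^ 3) * 8" "int ((2 * n) ^ 2) = int (n ^ 2) * 4" "int ((5 * n) ^ 2) = int (n ^ 2) * 25"
      by (simp_all add: power_mult_distrib)
    ultimately show "int ((n div s + 1) ^ 3) \<le> X \<and> int (((n div s + 1) * s) ^ 2) \<le> X \<and> int ((4 * s + 1) ^ 2) \<le> X"
      using X3[of 8] X2[of 4] X2[of 25] by linarith
  next
    show "64 * int (n * M) \<le> X" using XM[of 64] by (simp only: mult.commute)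
    show "int (n ^ 2) \<le> X" using X2[of 1] by simp
  next
    fix st1 t1 s B
    assume s: "1 \<le> s" "s ^ 3 \<le> n" "n < (s + 1) ^ 3" and B: "int (n * M + 1) < 2 ^ B" "2 ^ B \<le> 2 * int (n * M + 1)"
      and pr: "prepared st1 n M s B" and arr1: "arr st1 = arr ?s" and t1: "t1 \<le> 0 + 4 * (n * n) + 2 * n + 2 * B + 30"
    note b = block_count_bounds[OF s(1,2)]
    define g where "g = n div s + 1"
    define F where "F = n * M + 1"
    have bg: "g \<le> 2 * n" "g * s \<le> 2 * n" "n \<le> g * s" using b by (simp_all add: g_def)
    have nM1: "1 \<le> int (n * M)"
    proof -
      have "1 * 1 \<le> n * M" using nM by (intro mult_le_mono) auto
      then show ?thesis by linarith
    qed
    have m5: "4 * s + 1 \<le> 5 * n" using b(4) s(1) by linarith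
    note sq = mult_le_mono[OF bg(2) bg(2)] mult_le_mono[OF mult_le_mono[OF bg(1) bg(1)] bg(1)] mult_le_mono[OF m5 m5] m5
    interpret am: apsp_machine X Q \<kappa> "int n" "int g" "int (g * s)" "int F" "2 ^ B" "16 * 2 ^ B" s
    proof unfold_locales
      show "oracle_for (reverse_rank_single_source \<kappa>) Q" by (rule orac)
      show "1 \<le> s" by (rule s(1))
      show "1 \<le> int g" "1 \<le> int F" "1 \<le> int n" using nM by (simp_all add: g_def F_def)
      show "int (g * s) = int g * int s" by simp
      show "int n \<le> int (g * s)" using bg(3) by (simp only: of_nat_le_iff)
      show "int F < 2 ^ B" using B(1) by (simp add: F_def)
      show "(16::int) * 2 ^ B = 16 * 2 ^ B" ..
      \<comment> \<open>From \<open>2 * (n * M + 1) \<le> 4 * (n * M)\<close>; then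
        \<open>4 * H = 64 * 2 ^ B\<close> is at most \<open>256 * (n * M)\<close>.\<close>
      have "(2::int) ^ B \<le> 4 * int (n * M)" using B(2) nM1 by simp
      then show "4 * (16 * 2 ^ B) \<le> X" using XM[of 256] by linarith
      have "int (g * s * (g * s)) \<le> int (2 * n * (2 * n))" using sq(1) by (simp only: of_nat_le_iff)
      also have "\<dots> = int (n ^ 2) * 4" by (simp add: power2_eq_square)
      also have "\<dots> \<le> X" by (rule X2) simp
      finally show "int (g * s) * int (g * s) \<le> X" by (simp only: of_nat_mult)
      have "int (g * g * g) \<le> int (2 * n * (2 * n) * (2 * n))" using sq(2) by (simp only: of_nat_le_iff)
      also have "\<dots> = int (n ^ 3) * 8" by (simp add: power3_eq_cube)
      also have "\<dots> \<le> X" by (rule X3) simp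
      finally show "int g * int g * int g \<le> X" by (simp only: of_nat_mult)
      have "2 + a + b \<le> n * n * 2 + 25 * (n * n) + 5 * (n * n)" if "a \<le> 5 * n * (5 * n)" "b \<le> 5 * n" for a b
        using that nn1 by linarith
      from this[OF sq(3,4)]
      have "2 + (4 * s + 1) * (4 * s + 1) + (4 * s + 1) \<le> n * n * 2 + 25 * (n * n) + 5 * (n * n)" .
      also have "\<dots> = n ^ 2 * 32" by (simp add: power2_eq_square)
      finally have "int (2 + (4 * s + 1) * (4 * s + 1) + (4 * s + 1)) \<le> int (n ^ 2 * 32)" by (simp only: of_nat_le_iff)
      also have "\<dots> = int (n ^ 2) * 32" by simp
      also have "\<dots> \<le> X" by (rule X2) simp
      finally show "2 + (4 * int s + 1) * (4 * int s + 1) + (4 * int s + 1) \<le> X" by (simp add: algebra_simps)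
    qed
    have env: "am.env st1"
      using pr unfolding prepared_def Let_def am.env_def am.m_def g_def[symmetric] F_def[symmetric] by simp
    have nX: "2 * int n \<le> X" "int n * int n \<le> X"
    proof -
      have "int n \<le> int (n * n)" using nn1 by (simp only: of_nat_le_iff)
      then show "2 * int n \<le> X" using X2[of 2] unfolding power2_eq_square by linarith
      show "int n * int n \<le> X" using X2[of 1] by (simp add: power2_eq_square)
    qed
    show "wp (For ''z'' ''NN'' init_step ;; ''e'' ::= Const 1 ;;
      While (Less (Var ''e'') (Var ''n'')) (min_plus_square ;; ''e'' ::= Var ''e'' \<oplus> Var ''e'') ;;
      For ''z'' ''nn'' output_step ;; ''len'' ::= Var ''nn'') st1 t1 [] post"
    proof (rule am.wp_solve[OF env G _ _ nX refl])
      show "int n = int (node_count G)" by (simp add: n_def)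
      show "int F = int n * int (length_bound G) + 1" by (simp add: F_def M_def)
      show "arr st1 ''A'' = (\<lambda>_. 0)" "arr st1 ''T'' = (\<lambda>_. 0)" using arr1 by (simp_all add: fun_eq_iff arr_initial)
      show "arr st1 ''in'' (1 + (int i * int n + int j)) = arc_length G i j" if "i < node_count G" "j < node_count G" for i j
        using inz[OF idx(1)[of i j]] idx(2,3)[of i j] that arr1 unfolding n_def[symmetric] by simp
    next
      fix st2 :: state and t2 :: nat and qs2 and c :: nat
      assume 2: "var st2 ''len'' = int n * int n"
        "\<And>i j. i < node_count G \<Longrightarrow> j < node_count G \<Longrightarrow> codes_distance (arr st2 ''out'' (int i * int n + int j)) (distance G i j)"
        "\<And>q. q \<in> set qs2 \<Longrightarrow> am.good q" "length qs2 = nat (int g * int g * int g) * B * c" "c = 0 \<or> 2 ^ (c - 1) < node_count G"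
        and t2: "t2 \<le> t1 + 7 * nat (int (g * s) * int (g * s)) + 7 * nat (int n * int n) + (am.square_cost B + 2) * c + 10"
      have nats: "nat (int g * int g * int g) = g ^ 3" "nat (int (g * s) * int (g * s)) = (g * s) ^ 2" "nat (int n * int n) = n ^ 2"
        by (simp_all add: nat_mult_distrib power2_eq_square power3_eq_cube flip: of_nat_mult)
      have "am.square_cost B = 6 * (g * s) ^ 2 + (sweep_units g s + 1) * B + 6"
        unfolding am.square_cost_def am.phase_cost_def am.m_def nats sweep_units_def ..
      then have t: "t2 \<le> total_units n s B c"
        using t2 t1 unfolding nats total_units_def Let_def g_def[symmetric] by simp
      have gd: "good s q" if "q \<in> set qs2" for q
      proof -
        have "am.good q" by (rule 2(3)[OF that])
        moreover have "nat (4 * (16 * 2 ^ B)) \<le> nat X" using am.X(1) by (intro nat_mono)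
        ultimately show ?thesis unfolding am.good_def good_def am.m_def by (meson order_trans)
      qed
      have "2 ^ B \<le> 2 * (n * M + 1)"
      proof -
        have "int (2 ^ B) \<le> int (2 * (n * M + 1))" using B(2) by simp
        then show ?thesis by (simp only: of_nat_le_iff)
      qed
      moreover have "length qs2 = (n div s + 1) ^ 3 * B * c" using 2(4) unfolding nats by (simp only: g_def)
      moreover have "var st2 ''len'' = int (n * n)" using 2(1) by simp
      ultimately show "post st2 t2 ([] @ qs2)"
        unfolding post_def append_Nil
        using 2(2,5) gd t s unfolding n_def[symmetric] by blast
    qed
  qed
  then obtain st t u qs where run: "exec Q apsp_prog ?s st t qs" "t \<le> unit_cost X * u" "post st u qs"
    by (rule wpE[OF _ bnd])
  from run(3) obtain s B c where p: "var st ''len'' = int (n * n)"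
      "\<And>i j. i < n \<Longrightarrow> j < n \<Longrightarrow> codes_distance (arr st ''out'' (int i * int n + int j)) (distance G i j)"
      "\<And>q. q \<in> set qs \<Longrightarrow> good s q" "1 \<le> s" "s ^ 3 \<le> n" "n < (s + 1) ^ 3" "2 ^ B \<le> 2 * (n * M + 1)"
      "c = 0 \<or> 2 ^ (c - 1) < n" "length qs = (n div s + 1) ^ 3 * B * c" "u \<le> total_units n s B c"
    unfolding post_def by blast
  let ?P = "\<lambda>y. y \<in> instances (reverse_rank_single_source \<kappa>) \<and> nodes (reverse_rank_single_source \<kappa>) y = 4 * s + 1 \<and>
    max_len (reverse_rank_single_source \<kappa>) y \<le> nat X"
  obtain ys where ys: "map (encode (reverse_rank_single_source \<kappa>)) ys = qs" "\<forall>y\<in>set ys. ?P y"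
    using obtain_preimages[of qs ?P "encode (reverse_rank_single_source \<kappa>)"] p(3) unfolding good_def by blast
  have res: "length (result st) = n * n" "\<And>z. z < n * n \<Longrightarrow> result st ! z = arr st ''out'' (int z)"
    using result_eq[OF p(1)] by auto
  have "codes_distance (result st ! (i * n + j)) (distance G i j)" if "i < n" "j < n" for i j
    using p(2)[OF that] res(2)[OF idx(1)[OF that]] by simp
  then have sol: "solution (APSP \<kappa>) G (result st)"
    using res(1) by (simp add: APSP_def n_def)
  have comp: "computes Q apsp_prog (encode (APSP \<kappa>) G) (result st) t (map (encode (reverse_rank_single_source \<kappa>)) ys)"
    unfolding computes_def ys(1) using run(1) by (auto simp: APSP_def xs_def)
  have "t \<le> unit_cost X * total_units n s B c" using order_trans[OF run(2) mult_le_mono2[OF p(10)]] .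
  moreover have "length ys = (n div s + 1) ^ 3 * B * c" using p(9) ys(1) by (metis length_map)
  moreover have "set ys \<subseteq> instances (reverse_rank_single_source \<kappa>)" using ys(2) by blast
  ultimately show ?thesis
    using sol comp p(4-8) ys(2) unfolding X_def by blast
qed

section \<open>Asymptotics\<close>

definition lg :: "nat \<Rightarrow> real" where "lg n = 1 + log 2 (real n)"

lemma lg_ge_1: "1 \<le> n \<Longrightarrow> 1 \<le> lg n"
  by (simp add: lg_def)

text \<open>\<open>cost_bound\<close> grants powers of \<open>log M\<close> but none of
  \<open>log n\<close>, so these have to be absorbed into a small power of \<open>n\<close>. It
  suffices to bound \<open>lg n\<close> by a multiple of \<open>n powr a\<close> with
  \<open>a * q \<le> \<gamma>\<close>.\<close>

lemma lg_power_bound: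
  assumes "0 < \<gamma>" shows "\<exists>C\<ge>0. \<forall>n\<ge>1. lg n ^ q \<le> C * real n powr \<gamma>"
proof -
  \<comment> \<open>The \<open>+ 1\<close> avoids division by zero for \<open>q = 0\<close>.\<close>
  define a where "a = \<gamma> / (real q + 1)"
  have a: "0 < a" "a * real q \<le> \<gamma>" using assms by (simp_all add: a_def field_simps)
  define K where "K = 1 + 1 / (a * ln 2)"
  have K: "0 \<le> K" using a by (simp add: K_def)
  have "lg n ^ q \<le> K ^ q * real n powr \<gamma>" if n: "1 \<le> n" for n
  proof -
    have n1: "1 \<le> real n" using n by simp
    have "1 \<le> real n powr a" using n1 a by (simp add: ge_one_powr_ge_zero)
    moreover have "ln (real n) / ln 2 \<le> real n powr a / a / ln 2"
      using ln_powr_bound[OF n1 a(1)] by (intro divide_right_mono) auto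
    ultimately have "lg n \<le> real n powr a + real n powr a / a / ln 2"
      by (simp add: lg_def log_def)
    also have "\<dots> = K * real n powr a" by (simp add: K_def algebra_simps)
    finally have "lg n ^ q \<le> (K * real n powr a) ^ q"
      using lg_ge_1[OF n] by (intro power_mono) auto
    also have "\<dots> = K ^ q * real n powr (a * real q)"
      using n1 by (simp add: power_mult_distrib powr_powr[symmetric] powr_realpow)
    also have "\<dots> \<le> K ^ q * real n powr \<gamma>"
      using n1 a(2) K by (intro mult_left_mono powr_mono) auto
    finally show ?thesis .
  qed
  then show ?thesis using K by (intro exI[of _ "K ^ q"]) auto
qed

text \<open>The logarithm is \<open>12 + 3 * log n + log M\<close>, where 12 comes from the factor
  4096. Both \<open>lg n\<close> and \<open>lg M\<close> are at least 1, so constants and single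
  logarithms all fit under a multiple of their product.\<close>

lemma log_magnitude:
  assumes "1 \<le> n" "1 \<le> M"
  shows "1 + log 2 (real_of_int (magnitude n M)) \<le> 14 * (lg n * lg M)"
    and "real (unit_cost (magnitude n M)) \<le> 80000 * (lg n * lg M)"
proof -
  have l: "1 \<le> lg n" "1 \<le> lg M" using assms by (simp_all add: lg_ge_1)
  have "1 * lg n \<le> lg M * lg n" "1 * lg M \<le> lg n * lg M" "1 * 1 \<le> lg n * lg M"
    using l by (intro mult_mono; simp)+
  then have prod: "lg n \<le> lg n * lg M" "lg M \<le> lg n * lg M" "1 \<le> lg n * lg M" by (simp_all add: mult.commute)
  have "log 2 (real_of_int (magnitude n M)) = log 2 (2 ^ 12 * real n ^ 3 * real M)"
    by (simp add: magnitude_def)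
  also have "\<dots> = log 2 (2 ^ 12) + log 2 (real n ^ 3) + log 2 (real M)"
    using assms by (simp add: log_mult del: power_numeral)
  also have "log 2 (2 ^ 12) = (12 :: real)" by (subst log_nat_power) simp_all
  also have "log 2 (real n ^ 3) = 3 * (lg n - 1)" using assms by (simp add: log_nat_power lg_def)
  also have "log 2 (real M) = lg M - 1" by (simp add: lg_def)
  finally have log: "log 2 (real_of_int (magnitude n M)) = 8 + 3 * lg n + lg M" by simp
  show "1 + log 2 (real_of_int (magnitude n M)) \<le> 14 * (lg n * lg M)"
    using prod unfolding log by linarith
  have X: "16 \<le> magnitude n M" by (rule magnitude_ge(3)[OF _ assms, of 0]) simp
  have "real (floorlog 2 (nat (magnitude n M))) \<le> 1 + log 2 (real_of_int (magnitude n M))"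
  proof -
    have "floorlog 2 (nat (magnitude n M)) = nat \<lfloor>log 2 (real (nat (magnitude n M)))\<rfloor> + 1"
      using X by (simp add: floorlog_def)
    moreover have "0 \<le> log 2 (real_of_int (magnitude n M))" using X by simp
    moreover have "real (nat (magnitude n M)) = real_of_int (magnitude n M)" using X by simp
    ultimately show ?thesis by simp
  qed
  then have "real (bits (magnitude n M)) \<le> 2 + log 2 (real_of_int (magnitude n M))"
    using X by (simp add: bits_def)
  \<comment> \<open>The coefficients add up to \<open>10 + 3 + 1\<close>; and
    \<open>5001 * 15 = 75015\<close> explains the 80000.\<close>
  also have "\<dots> \<le> 15 * (lg n * lg M)" using prod unfolding log by linarith
  finally show "real (unit_cost (magnitude n M)) \<le> 80000 * (lg n * lg M)"
    using prod(3) by (simp add: unit_cost_def)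
qed

lemma lgraph_cost_bound:
  "cost_bound (APSP \<kappa>) \<alpha> k G = real (node_count G) powr \<alpha> * lg (length_bound G) ^ k"
  "cost_bound (reverse_rank_single_source \<kappa>) \<alpha> k (G, U, u) = real (node_count G) powr \<alpha> * lg (length_bound G) ^ k"
  by (simp_all add: cost_bound_def APSP_def reverse_rank_single_source_def lg_def)

theorem reverse_rank_reducible_to_APSP:
  "subcubic_reducible (reverse_rank_single_source \<kappa>) (APSP \<kappa>)"
  unfolding subcubic_reducible_def
proof (intro exI[of _ rank_prog] allI impI)
  let ?A = "reverse_rank_single_source \<kappa>" and ?B = "APSP \<kappa>"
  fix \<epsilon> :: real assume "0 < \<epsilon>"
  \<comment> \<open>The time is of order \<open>n ^ 2 * lg n\<close>, which admits any
    \<open>\<delta> < 1\<close>; the single query has \<open>n\<close> nodes and demands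
    \<open>\<delta> \<le> \<epsilon>\<close>. Halving leaves a positive exponent
    \<open>1 - \<delta>\<close> to absorb \<open>lg n\<close>.\<close>
  define \<delta> where "\<delta> = min \<epsilon> 1 / 2"
  have \<delta>: "0 < \<delta>" "\<delta> \<le> \<epsilon>" "0 < 1 - \<delta>" using \<open>0 < \<epsilon>\<close> by (auto simp: \<delta>_def min_def)
  obtain C where C: "0 \<le> C" "\<And>n. 1 \<le> n \<Longrightarrow> lg n ^ 1 \<le> C * real n powr (1 - \<delta>)"
    using lg_power_bound[OF \<delta>(3), of 1] by blast
  show "\<exists>\<delta>>0. \<forall>k. \<exists>C k'. \<forall>Q. oracle_for ?B Q \<longrightarrow>
        (\<forall>x\<in>instances ?A. \<exists>ys t qs.
           set qs \<subseteq> instances ?B \<and>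
           computes Q rank_prog (encode ?A x) ys t (map (encode ?B) qs) \<and>
           solution ?A x ys \<and>
           real t \<le> C * cost_bound ?A (3 - \<delta>) k' x \<and>
           (\<Sum>q\<leftarrow>qs. cost_bound ?B (3 - \<epsilon>) k q) \<le> C * cost_bound ?A (3 - \<delta>) k' x)"
  proof (rule exI[of _ \<delta>], rule conjI, rule \<delta>(1), rule allI)
    fix k
    \<comment> \<open>\<open>2400000 = 80000 * 30\<close> is for the running time, the summand 1 for
      the query.\<close>
    let ?C = "1 + 2400000 * C"
    show "\<exists>C k'. \<forall>Q. oracle_for ?B Q \<longrightarrow>
        (\<forall>x\<in>instances ?A. \<exists>ys t qs.
           set qs \<subseteq> instances ?B \<and>
           computes Q rank_prog (encode ?A x) ys t (map (encode ?B) qs) \<and>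
           solution ?A x ys \<and>
           real t \<le> C * cost_bound ?A (3 - \<delta>) k' x \<and>
           (\<Sum>q\<leftarrow>qs. cost_bound ?B (3 - \<epsilon>) k q) \<le> C * cost_bound ?A (3 - \<delta>) k' x)"
    \<comment> \<open>The power \<open>k + 1\<close> of \<open>lg M\<close> covers the single factor
      in the running time as well as the \<open>k\<close> factors of the query.\<close>
    proof (intro exI[of _ ?C] exI[of _ "k + 1"] allI impI ballI)
      fix Q and x :: "lgraph \<times> nat set \<times> nat"
      assume Q: "oracle_for ?B Q" and x: "x \<in> instances ?A"
      obtain G U u where xG: "x = (G, U, u)" by (cases x)
      have G: "G \<in> lgraphs \<kappa>" using x by (simp add: xG reverse_rank_single_source_def)
      define n where "n = node_count G"
      define M where "M = length_bound G"
      have nM: "1 \<le> n" "1 \<le> M" using node_count_pos[OF G] length_bound_pos[OF G] by (simp_all add: n_def M_def)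
      have n1: "1 \<le> real n" using nM by simp
      have lM: "1 \<le> lg M" by (rule lg_ge_1[OF nM(2)])
      obtain ys t where ys: "computes Q rank_prog (encode ?A x) ys t [encode_graph G]"
        "solution ?A x ys" and t: "t \<le> unit_cost (magnitude n M) * (30 * n * n)"
        using rank_prog_correct[OF x[unfolded xG] Q] unfolding xG n_def M_def by blast
      define R where "R = real n powr (3 - \<delta>)"
      have R0: "0 \<le> R" by (simp add: R_def)
      have lk: "1 \<le> lg M ^ k" "lg M ^ k \<le> lg M ^ (k + 1)" "lg M \<le> lg M ^ (k + 1)"
        using lM by (simp_all add: one_le_power mult_left_mono self_le_power power_increasing)
      have "real t \<le> real (unit_cost (magnitude n M)) * (30 * (real n)\<^sup>2)"
        using of_nat_mono[OF t, where 'a = real] by (simp add: power2_eq_square algebra_simps)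
      also have "\<dots> \<le> 80000 * (lg n * lg M) * (30 * (real n)\<^sup>2)"
        by (intro mult_right_mono log_magnitude(2) nM) simp
      also have "\<dots> = 2400000 * lg M * ((real n)\<^sup>2 * lg n)" by simp
      also have "\<dots> \<le> 2400000 * lg M * ((real n)\<^sup>2 * (C * real n powr (1 - \<delta>)))"
        using C(2)[OF nM(1)] lM by (intro mult_left_mono) auto
      also have "(real n)\<^sup>2 * (C * real n powr (1 - \<delta>)) = C * R"
      proof -
        have "(real n)\<^sup>2 * real n powr (1 - \<delta>) = R"
          using n1 by (simp add: R_def powr_add[symmetric] flip: powr_numeral)
        then show ?thesis by simp
      qed
      finally have "real t \<le> 2400000 * C * (R * lg M)" by (simp add: ac_simps)
      also have "\<dots> \<le> ?C * (R * lg M ^ (k + 1))"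
        using C(1) R0 lk lM by (intro mult_mono) auto
      finally have tb: "real t \<le> ?C * (R * lg M ^ (k + 1))" .
      have "real n powr (3 - \<epsilon>) \<le> R" unfolding R_def using n1 \<delta>(2) by (intro powr_mono) auto
      then have "real n powr (3 - \<epsilon>) * lg M ^ k \<le> R * lg M ^ (k + 1)"
        using lk R0 lM by (intro mult_mono) auto
      also have "\<dots> = 1 * (R * lg M ^ (k + 1))" by simp
      also have "\<dots> \<le> ?C * (R * lg M ^ (k + 1))"
        using C(1) R0 lM by (intro mult_right_mono) auto
      finally have qb: "real n powr (3 - \<epsilon>) * lg M ^ k \<le> ?C * (R * lg M ^ (k + 1))" .
      show "\<exists>ys t qs. set qs \<subseteq> instances ?B \<and>
           computes Q rank_prog (encode ?A x) ys t (map (encode ?B) qs) \<and>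
           solution ?A x ys \<and>
           real t \<le> ?C * cost_bound ?A (3 - \<delta>) (k + 1) x \<and>
           (\<Sum>q\<leftarrow>qs. cost_bound ?B (3 - \<epsilon>) k q) \<le> ?C * cost_bound ?A (3 - \<delta>) (k + 1) x"
        unfolding xG lgraph_cost_bound
        using ys tb qb G unfolding xG R_def n_def M_def
        by (intro exI[of _ ys] exI[of _ t] exI[of _ "[G]"]) (simp add: APSP_def lgraph_cost_bound)
    qed
  qed
qed

section \<open>Asymptotic cost of the reduction from APSP\<close>

lemma phase_count_bound:
  assumes "1 \<le> n" "1 \<le> M" "2 ^ B \<le> 2 * (n * M + 1)"
  shows "real B \<le> 2 * (lg n * lg M)"
proof -
  have l: "1 \<le> lg n" "1 \<le> lg M" using assms by (simp_all add: lg_ge_1)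
  have "1 * 1 \<le> n * M" using assms by (intro mult_le_mono) auto
  moreover have "2 * (n * M + 1) = 2 * (n * M) + 2" by simp
  ultimately have "2 ^ B \<le> 4 * (n * M)" using assms(3) by linarith
  then have "real (2 ^ B) \<le> real (4 * (n * M))" by (simp only: of_nat_le_iff)
  then have "log 2 (2 ^ B) \<le> log 2 (4 * (real n * real M))"
    using assms by (subst log_le_cancel_iff) auto
  also have "log 2 (2 ^ B) = real B" by (simp add: log_nat_power)
  also have "log 2 (4 * (real n * real M)) = log 2 (2 ^ 2) + log 2 (real n) + log 2 (real M)"
    using assms by (simp add: log_mult)
  also have "log 2 (2 ^ 2) = (2 :: real)" by (subst log_nat_power) simp_all
  finally have "real B \<le> lg n + lg M" by (simp add: lg_def)
  moreover have "lg n * 1 \<le> lg n * lg M" "1 * lg M \<le> lg n * lg M" using l by (intro mult_mono; simp)+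
  ultimately show ?thesis by simp
qed

lemma squaring_count_bound:
  assumes "1 \<le> n" "c = 0 \<or> 2 ^ (c - 1) < n" shows "real c \<le> lg n"
proof (cases "c = 0")
  case True then show ?thesis using lg_ge_1[OF assms(1)] by simp
next
  case False
  then have "real (2 ^ (c - 1)) \<le> real n" using assms(2) by (simp only: of_nat_le_iff) simp
  then have "log 2 (2 ^ (c - 1)) \<le> log 2 (real n)" using assms by (subst log_le_cancel_iff) auto
  also have "log 2 (2 ^ (c - 1)) = real (c - 1)" by (simp add: log_nat_power)
  finally show ?thesis using False by (simp add: lg_def of_nat_diff)
qed

text \<open>Everything is measured in the exact cube root \<open>x\<close>, which the integer
  \<open>s\<close> approximates up to a factor of 2. Then \<open>n = x ^ 3\<close>, and the target
  \<open>n powr (8 / 3)\<close> is the natural power \<open>x ^ 8\<close>.\<close>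

locale cube_root =
  fixes n s g :: nat and x :: real
  assumes n: "1 \<le> n" and s: "1 \<le> s" "s ^ 3 \<le> n" "n < (s + 1) ^ 3" and g: "g = n div s + 1"
    and x: "x = real n powr (1 / 3)"
begin

lemma x_cube: "x ^ 3 = real n"
  using n by (simp add: x powr_realpow[symmetric] powr_powr)

lemma x_ge_1: "1 \<le> x"
  using n by (simp add: x ge_one_powr_ge_zero)

lemma s_le_x: "real s \<le> x"
proof -
  have "real s ^ 3 \<le> x ^ 3" using s(2) unfolding x_cube by (simp flip: of_nat_power)
  then show ?thesis using x_ge_1 by (simp add: power_mono_iff)
qed

lemma x_le_2s: "x \<le> 2 * real s"
proof -
  have "(s + 1) ^ 3 \<le> (2 * s) ^ 3" using s(1) by (intro power_mono) auto
  then have "real n \<le> real ((2 * s) ^ 3)" using s(3) by (simp only: of_nat_le_iff)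
  then have "x ^ 3 \<le> (2 * real s) ^ 3" unfolding x_cube by simp
  then show ?thesis using x_ge_1 power_mono_iff[of x "2 * real s" 3] by simp
qed

lemma gs_le: "real (g * s) \<le> 2 * x ^ 3"
proof -
  have "g * s \<le> 2 * n" unfolding g by (rule block_count_bounds[OF s(1,2)])
  then have "real (g * s) \<le> real (2 * n)" by (simp only: of_nat_le_iff)
  then show ?thesis by (simp add: x_cube)
qed

lemma gs_square_le: "real (g * s) ^ 2 \<le> 4 * x ^ 6"
proof -
  have "real (g * s) ^ 2 \<le> (2 * x ^ 3) ^ 2" by (intro power_mono gs_le) simp
  then show ?thesis by (simp add: power_mult_distrib flip: power_mult)
qed

lemma gs_cube_le: "real (g * s) ^ 3 \<le> 8 * x ^ 9"
proof -
  have "real (g * s) ^ 3 \<le> (2 * x ^ 3) ^ 3" by (intro power_mono gs_le) simp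
  then show ?thesis by (simp add: power_mult_distrib flip: power_mult)
qed

text \<open>The product is \<open>(g * s) ^ 3 / s\<close>, of order \<open>n ^ 3 / x\<close>; one
  power of \<open>x\<close> is gained because the size of a query is quadratic in \<open>s\<close>
  while there are cubically many.\<close>

lemma blocks_times_square_le: "real s ^ 2 * real g ^ 3 \<le> 16 * x ^ 8"
proof -
  have "(real s ^ 2 * real g ^ 3) * x \<le> (real s ^ 2 * real g ^ 3) * (2 * real s)"
    by (intro mult_left_mono x_le_2s) simp
  also have "\<dots> = 2 * real (g * s) ^ 3"
    by (simp add: power2_eq_square power3_eq_cube)
  also have "\<dots> \<le> 2 * (8 * x ^ 9)" by (intro mult_left_mono gs_cube_le) simp
  also have "\<dots> = 16 * x ^ 8 * x" by (simp add: eval_nat_numeral)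
  finally show ?thesis using x_ge_1 by simp
qed

text \<open>Here the cube root pays off: the searches cost \<open>s ^ 2 * N ^ 2\<close> and the
  queries \<open>s ^ 2 * g ^ 3\<close>, and for this \<open>s\<close> both are of order
  \<open>x ^ 8\<close>. The constants sum to \<open>64 + 16800 + 7\<close>.\<close>

lemma sweep_units_le: "real (sweep_units g s) \<le> 17000 * x ^ 8"
proof -
  have sx: "real s ^ 2 \<le> x ^ 2" by (intro power_mono s_le_x) simp
  have one: "1 \<le> x ^ 2" "1 \<le> x ^ 8" using x_ge_1 by (simp_all add: one_le_power)
  have "(6 * real s ^ 2 + 10) * real (g * s) ^ 2 \<le> (16 * x ^ 2) * (4 * x ^ 6)"
    using sx one by (intro mult_mono gs_square_le) auto
  also have "\<dots> = 64 * x ^ 8" by (simp flip: power_add)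
  finally have 1: "(6 * real s ^ 2 + 10) * real (g * s) ^ 2 \<le> 64 * x ^ 8" .
  have "(4 * real s + 1) ^ 2 \<le> (5 * real s) ^ 2" using s(1) by (intro power_mono) auto
  then have "42 * (4 * real s + 1) ^ 2 * real g ^ 3 \<le> 42 * (5 * real s) ^ 2 * real g ^ 3"
    by (intro mult_right_mono) auto
  also have "\<dots> = 1050 * (real s ^ 2 * real g ^ 3)" by (simp add: power_mult_distrib)
  also have "\<dots> \<le> 16800 * x ^ 8" using blocks_times_square_le by linarith
  finally have 2: "42 * (4 * real s + 1) ^ 2 * real g ^ 3 \<le> 16800 * x ^ 8" .
  have "real (sweep_units g s) = (6 * real s ^ 2 + 10) * real (g * s) ^ 2 + 42 * (4 * real s + 1) ^ 2 * real g ^ 3 + 7"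
    by (simp add: sweep_units_def power2_eq_square power3_eq_cube algebra_simps)
  with 1 2 one(2) show ?thesis by linarith
qed

lemma total_units_le:
  assumes B: "real B \<le> 2 * L" and c: "real c \<le> l" and "1 \<le> l" "1 \<le> L"
  shows "real (total_units n s B c) \<le> 35000 * (x ^ 8 * l * L)"
proof -
  define p where "p = x ^ 8"
  have p1: "1 \<le> p" and x6: "x ^ 6 \<le> p" using x_ge_1 by (simp_all add: p_def one_le_power power_increasing)
  have n2: "real n ^ 2 \<le> p" using x6 unfolding x_cube[symmetric] by (simp flip: power_mult)
  have "real n * 1 \<le> real n * real n" using n by (intro mult_left_mono) auto
  then have n1: "real n \<le> p" using n2 by (simp add: power2_eq_square)
  have gs: "real (g * s) ^ 2 \<le> 4 * p" using gs_square_le x6 by linarith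
  have sw: "real (sweep_units g s) + 1 \<le> 17001 * p" using sweep_units_le p1 by (simp add: p_def)
  have "(real (sweep_units g s) + 1) * real B \<le> (17001 * p) * (2 * L)"
    using sw B p1 by (intro mult_mono) auto
  moreover have "1 * 1 \<le> p * L" "p * 1 \<le> p * L" "1 * L \<le> p * L" using p1 assms(4) by (intro mult_mono; simp)+
  \<comment> \<open>\<open>34034 = 6 * 4 + 2 * 17001 + 8\<close>.\<close>
  ultimately have sq: "6 * real (g * s) ^ 2 + (real (sweep_units g s) + 1) * real B + 6 + 2 \<le> 34034 * (p * L)"
    using gs by simp
  have "(6 * real (g * s) ^ 2 + (real (sweep_units g s) + 1) * real B + 6 + 2) * real c \<le> (34034 * (p * L)) * l"
    using sq c p1 assms(4) by (intro mult_mono) auto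
  moreover have "p * L * 1 \<le> p * L * l" using p1 assms by (intro mult_left_mono) auto
  ultimately have Z: "1 \<le> p * L * l" "p \<le> p * L * l" "L \<le> p * L * l"
    and W: "(6 * real (g * s) ^ 2 + (real (sweep_units g s) + 1) * real B + 6 + 2) * real c \<le> 34034 * (p * L * l)"
    using \<open>1 * 1 \<le> p * L\<close> \<open>p * 1 \<le> p * L\<close> \<open>1 * L \<le> p * L\<close> by linarith+
  have "real (total_units n s B c) = 4 * real n ^ 2 + 2 * real n + 2 * real B + 30 + 7 * real (g * s) ^ 2 + 7 * real n ^ 2 +
     (6 * real (g * s) ^ 2 + (real (sweep_units g s) + 1) * real B + 6 + 2) * real c + 10"
    by (simp add: total_units_def Let_def g power2_eq_square algebra_simps)
  \<comment> \<open>The terms outside the squarings give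
    \<open>85 = 4 + 2 + 4 + 30 + 28 + 7 + 10\<close>.\<close>
  also have "\<dots> \<le> 34034 * (p * L * l) + 85 * (p * L * l)"
    using n1 n2 gs B Z W by linarith
  also have "\<dots> \<le> 35000 * (x ^ 8 * l * L)" using Z(1) by (simp add: p_def ac_simps)
  finally show ?thesis .
qed

text \<open>The cubes combine to \<open>(g * s) ^ 3\<close>, of order \<open>n ^ 3\<close>. The
  remaining factor \<open>s powr (- \<eta>)\<close> is the saving of the oracle; as
  \<open>s \<ge> x / 2\<close>, it is at most \<open>2 * x powr (- \<eta>)\<close>, that is, twice
  \<open>n powr (- \<eta> / 3)\<close>. The constant is \<open>125 * 2 * 8\<close>.\<close>

lemma query_cost_le:
  assumes "0 \<le> \<eta>" "\<eta> \<le> 1"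
  shows "real (g ^ 3) * real (4 * s + 1) powr (3 - \<eta>) \<le> 2000 * real n powr (3 - \<eta> / 3)"
proof -
  have s0: "0 < real s" using s(1) by simp
  have x0: "0 < x" using x_ge_1 by simp
  have "real s powr (- \<eta>) \<le> (x / 2) powr (- \<eta>)"
    using x_le_2s x0 assms by (intro powr_mono2') auto
  also have "\<dots> = x powr (- \<eta>) / 2 powr (- \<eta>)" by (rule powr_divide)
  also have "\<dots> = x powr (- \<eta>) * 2 powr \<eta>" by (simp add: powr_minus_divide)
  also have "\<dots> \<le> x powr (- \<eta>) * 2 powr 1" using assms by (intro mult_left_mono powr_mono) auto
  finally have s_powr: "real s powr (- \<eta>) \<le> x powr (- \<eta>) * 2" by simp
  have "(5::real) powr (3 - \<eta>) \<le> 5 powr 3" using assms by (intro powr_mono) auto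
  then have five: "(5::real) powr (3 - \<eta>) \<le> 125" by simp
  have "real (4 * s + 1) powr (3 - \<eta>) \<le> (5 * real s) powr (3 - \<eta>)"
    using assms s(1) by (intro powr_mono2) auto
  also have "\<dots> = 5 powr (3 - \<eta>) * real s powr (3 - \<eta>)" by (simp add: powr_mult)
  also have "real s powr (3 - \<eta>) = real s powr 3 * real s powr (- \<eta>)"
    using powr_add[of "real s" 3 "- \<eta>"] by simp
  also have "real s powr 3 = real s ^ 3" using s0 by simp
  also have "5 powr (3 - \<eta>) * (real s ^ 3 * real s powr (- \<eta>)) \<le> 125 * (real s ^ 3 * (x powr (- \<eta>) * 2))"
    using five s_powr by (intro mult_mono) auto
  finally have "real (4 * s + 1) powr (3 - \<eta>) \<le> 125 * (real s ^ 3 * (x powr (- \<eta>) * 2))" .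
  then have "real (g ^ 3) * real (4 * s + 1) powr (3 - \<eta>) \<le> real (g ^ 3) * (125 * (real s ^ 3 * (x powr (- \<eta>) * 2)))"
    by (intro mult_left_mono) auto
  also have "\<dots> = 250 * real (g * s) ^ 3 * x powr (- \<eta>)" by (simp add: power_mult_distrib)
  also have "\<dots> \<le> 250 * (8 * x ^ 9) * x powr (- \<eta>)"
    using gs_cube_le by (intro mult_right_mono mult_left_mono) auto
  also have "\<dots> = 2000 * (x ^ 9 * x powr (- \<eta>))" by simp
  also have "x ^ 9 = x powr 9" using x0 by simp
  also have "x powr 9 * x powr (- \<eta>) = x powr (9 - \<eta>)" using powr_add[of x 9 "- \<eta>"] by simp
  also have "\<dots> = real n powr (3 - \<eta> / 3)"
    by (simp add: x powr_powr field_simps)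
  finally show ?thesis .
qed

end

theorem APSP_reducible_to_reverse_rank:
  "subcubic_reducible (APSP \<kappa>) (reverse_rank_single_source \<kappa>)"
  unfolding subcubic_reducible_def
proof (rule exI[of _ apsp_prog], intro allI impI)
  let ?A = "APSP \<kappa>" and ?B = "reverse_rank_single_source \<kappa>"
  fix \<epsilon> :: real assume "0 < \<epsilon>"
  \<comment> \<open>A saving above 1 is cut down to 1, the range of \<open>query_cost_le\<close>;
    smaller savings only make the bounds larger.\<close>
  define \<eta> where "\<eta> = min \<epsilon> 1"
  \<comment> \<open>The queries save \<open>\<eta> / 3\<close> in the exponent. One half is kept as
    \<open>\<delta>\<close>, the other half pays for \<open>lg n ^ (k + 2)\<close>. Moreover
    \<open>\<delta> \<le> 1 / 6\<close> leaves room for the running time,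
    \<open>n powr (8 / 3)\<close> times \<open>lg n ^ 3\<close>, since
    \<open>8 / 3 + 1 / 6 = 3 - 1 / 6\<close>.\<close>
  define \<delta> where "\<delta> = \<eta> / 6"
  have \<eta>: "0 < \<eta>" "\<eta> \<le> \<epsilon>" "\<eta> \<le> 1" and \<delta>: "0 < \<delta>" "\<delta> \<le> 1 / 6"
    using \<open>0 < \<epsilon>\<close> by (auto simp: \<eta>_def \<delta>_def)
  show "\<exists>\<delta>>0. \<forall>k. \<exists>C k'. \<forall>Q. oracle_for ?B Q \<longrightarrow>
        (\<forall>x\<in>instances ?A. \<exists>ys t qs. set qs \<subseteq> instances ?B \<and>
           computes Q apsp_prog (encode ?A x) ys t (map (encode ?B) qs) \<and> solution ?A x ys \<and>
           real t \<le> C * cost_bound ?A (3 - \<delta>) k' x \<and>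
           (\<Sum>q\<leftarrow>qs. cost_bound ?B (3 - \<epsilon>) k q) \<le> C * cost_bound ?A (3 - \<delta>) k' x)"
  proof (rule exI[of _ \<delta>], rule conjI, rule \<delta>(1), rule allI)
    fix k :: nat
    obtain C1 where C1: "0 \<le> C1" "\<And>n. 1 \<le> n \<Longrightarrow> lg n ^ 3 \<le> C1 * real n powr (1 / 6)"
      using lg_power_bound[of "1 / 6" 3] by auto
    obtain C2 where C2: "0 \<le> C2" "\<And>n. 1 \<le> n \<Longrightarrow> lg n ^ (k + 2) \<le> C2 * real n powr \<delta>"
      using lg_power_bound[OF \<delta>(1), of "k + 2"] by blast
    \<comment> \<open>\<open>2800000000 = 80000 * 35000\<close> from the unit cost and the number of
      steps; \<open>4000 = 2000 * 2\<close> from the sizes of the queries and the bound on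
      \<open>B\<close>; \<open>14 ^ k\<close> from the logarithm of the lengths in the
      queries.\<close>
    define C where "C = 2800000000 * C1 + 4000 * 14 ^ k * C2"
    have CC: "2800000000 * C1 \<le> C" "4000 * 14 ^ k * C2 \<le> C" "0 \<le> C" using C1(1) C2(1) by (simp_all add: C_def)
    show "\<exists>C k'. \<forall>Q. oracle_for ?B Q \<longrightarrow>
        (\<forall>x\<in>instances ?A. \<exists>ys t qs. set qs \<subseteq> instances ?B \<and>
           computes Q apsp_prog (encode ?A x) ys t (map (encode ?B) qs) \<and> solution ?A x ys \<and>
           real t \<le> C * cost_bound ?A (3 - \<delta>) k' x \<and>
           (\<Sum>q\<leftarrow>qs. cost_bound ?B (3 - \<epsilon>) k q) \<le> C * cost_bound ?A (3 - \<delta>) k' x)"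
    \<comment> \<open>The running time needs \<open>lg M ^ 2\<close>, the queries need
      \<open>lg M ^ (k + 1)\<close>: one factor from \<open>B\<close> and \<open>k\<close> from
      their own length bounds.\<close>
    proof (rule exI[of _ C], rule exI[of _ "k + 2"], intro allI impI ballI)
      fix Q and G :: lgraph
      assume orac: "oracle_for ?B Q" and "G \<in> instances ?A"
      then have G: "G \<in> lgraphs \<kappa>" by (simp add: APSP_def)
      define n where "n = node_count G"
      define M where "M = length_bound G"
      have nM: "1 \<le> n" "1 \<le> M" using node_count_pos[OF G] length_bound_pos[OF G] by (simp_all add: n_def M_def)
      obtain ys t qs s B c where qs: "set qs \<subseteq> instances ?B"
        and comp: "computes Q apsp_prog (encode ?A G) ys t (map (encode ?B) qs)" and sol: "solution ?A G ys"
        and s: "1 \<le> s" "s ^ 3 \<le> n" "n < (s + 1) ^ 3" and B: "2 ^ B \<le> 2 * (n * M + 1)"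
        and c: "c = 0 \<or> 2 ^ (c - 1) < n" and len: "length qs = (n div s + 1) ^ 3 * B * c"
        and q: "\<And>q. q \<in> set qs \<Longrightarrow> nodes ?B q = 4 * s + 1 \<and> max_len ?B q \<le> nat (magnitude n M)"
        and t: "t \<le> unit_cost (magnitude n M) * total_units n s B c"
        using apsp_prog_correct[OF G orac] unfolding n_def M_def by blast
      define g where "g = n div s + 1"
      define x where "x = real n powr (1 / 3)"
      interpret cube_root n s g x
        using nM s by unfold_locales (simp_all add: g_def x_def)
      define l where "l = lg n"
      define m where "m = lg M"
      have l1: "1 \<le> l" and m1: "1 \<le> m" using nM by (simp_all add: l_def m_def lg_ge_1)
      have L1: "1 \<le> l * m" using mult_mono[OF l1 m1] l1 by simp
      have B': "real B \<le> 2 * (l * m)" and c': "real c \<le> l"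
        using phase_count_bound[OF nM B] squaring_count_bound[OF nM(1) c] by (simp_all add: l_def m_def)
      have n1: "1 \<le> real n" using nM by simp
      define R where "R = real n powr (3 - \<delta>)"
      have R0: "0 \<le> R" by (simp add: R_def)
      have mk: "m ^ 2 \<le> m ^ (k + 2)" "m ^ (k + 1) \<le> m ^ (k + 2)" using m1 by (intro power_increasing; simp)+

      have "real t \<le> real (unit_cost (magnitude n M)) * real (total_units n s B c)"
        using of_nat_mono[OF t, where 'a = real] by simp
      also have "\<dots> \<le> (80000 * (l * m)) * (35000 * (x ^ 8 * l * (l * m)))"
        using log_magnitude(2)[OF nM] total_units_le[OF B' c' l1 L1] L1
        by (intro mult_mono) (auto simp: l_def m_def)
      also have "\<dots> = 2800000000 * (x ^ 8 * l ^ 3) * m ^ 2"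
        by (simp add: power2_eq_square power3_eq_cube)
      also have "\<dots> \<le> 2800000000 * (C1 * R) * m ^ 2"
      proof (intro mult_right_mono mult_left_mono)
        have x8: "x ^ 8 = real n powr (8 / 3)" using n1 by (simp add: x_def powr_realpow[symmetric] powr_powr)
        have "x ^ 8 * l ^ 3 \<le> real n powr (8 / 3) * (C1 * real n powr (1 / 6))"
          unfolding l_def x8 using C1(2)[OF nM(1)] by (intro mult_left_mono) auto
        also have "real n powr (8 / 3) * (C1 * real n powr (1 / 6)) = C1 * real n powr (17 / 6)"
          using n1 by (simp flip: powr_add)
        also have "\<dots> \<le> C1 * R"
          unfolding R_def using n1 \<delta>(2) C1(1) by (intro mult_left_mono powr_mono) auto
        finally show "x ^ 8 * l ^ 3 \<le> C1 * R" .
      qed simp_all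
      also have "\<dots> = (2800000000 * C1) * (R * m ^ 2)" by simp
      also have "\<dots> \<le> C * (R * m ^ (k + 2))"
        using CC mk R0 m1 C1(1) by (intro mult_mono) auto
      finally have tb: "real t \<le> C * (R * m ^ (k + 2))" .

      \<comment> \<open>The lengths in a query are bounded by \<open>magnitude n M\<close>, so that
        their logarithm also brings in factors \<open>lg n\<close>. This is why the power of
        \<open>lg n\<close> to be absorbed depends on \<open>k\<close>.\<close>
      have each: "cost_bound ?B (3 - \<epsilon>) k q \<le> real (4 * s + 1) powr (3 - \<eta>) * (14 * (l * m)) ^ k" if "q \<in> set qs" for q
      proof -
        obtain G' U u where q': "q = (G', U, u)" by (cases q)
        have G': "G' \<in> lgraphs \<kappa>" using qs that by (auto simp: q' reverse_rank_single_source_def)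
        have sz: "node_count G' = 4 * s + 1" "length_bound G' \<le> nat (magnitude n M)"
          using q[OF that] by (simp_all add: q' reverse_rank_single_source_def)
        have M': "1 \<le> length_bound G'" by (rule length_bound_pos[OF G'])
        have "real (length_bound G') \<le> real_of_int (magnitude n M)"
          using sz(2) M' by linarith
        then have "lg (length_bound G') \<le> 1 + log 2 (real_of_int (magnitude n M))"
          unfolding lg_def using M' by simp
        also have "\<dots> \<le> 14 * (l * m)" unfolding l_def m_def by (rule log_magnitude(1)[OF nM])
        finally have "lg (length_bound G') ^ k \<le> (14 * (l * m)) ^ k"
          using lg_ge_1[OF M'] by (intro power_mono) auto
        moreover have "real (4 * s + 1) powr (3 - \<epsilon>) \<le> real (4 * s + 1) powr (3 - \<eta>)"
          using \<eta>(2) by (intro powr_mono) auto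
        ultimately show ?thesis
          unfolding q' lgraph_cost_bound sz(1) using lg_ge_1[OF M'] by (intro mult_mono) auto
      qed
      have "(\<Sum>q\<leftarrow>qs. cost_bound ?B (3 - \<epsilon>) k q) \<le> (\<Sum>q\<leftarrow>qs. real (4 * s + 1) powr (3 - \<eta>) * (14 * (l * m)) ^ k)"
        by (intro sum_list_mono each)
      also have "\<dots> = real (length qs) * (real (4 * s + 1) powr (3 - \<eta>) * (14 * (l * m)) ^ k)"
        by (simp add: sum_list_triv)
      also have "real (length qs) = real (g ^ 3) * (real B * real c)"
        unfolding len g_def by simp
      also have "real (g ^ 3) * (real B * real c) * (real (4 * s + 1) powr (3 - \<eta>) * (14 * (l * m)) ^ k) =
          (real (g ^ 3) * real (4 * s + 1) powr (3 - \<eta>)) * (real B * real c) * (14 * (l * m)) ^ k"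
        by (simp only: ac_simps)
      also have "\<dots> \<le> (2000 * real n powr (3 - \<eta> / 3)) * (2 * (l * m) * l) * (14 * (l * m)) ^ k"
        using \<eta> L1 l1 by (intro mult_mono mult_right_mono query_cost_le B' c') auto
      also have "\<dots> = 4000 * 14 ^ k * (real n powr (3 - \<eta> / 3) * l ^ (k + 2)) * m ^ (k + 1)"
        by (simp add: power_mult_distrib power_add power2_eq_square)
      also have "\<dots> \<le> 4000 * 14 ^ k * (C2 * R) * m ^ (k + 1)"
      proof (intro mult_right_mono mult_left_mono)
        have "real n powr (3 - \<eta> / 3) * l ^ (k + 2) \<le> real n powr (3 - \<eta> / 3) * (C2 * real n powr \<delta>)"
          unfolding l_def using C2(2)[OF nM(1)] by (intro mult_left_mono) auto
        also have "\<dots> = C2 * R"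
          by (simp add: R_def \<delta>_def field_simps flip: powr_add)
        finally show "real n powr (3 - \<eta> / 3) * l ^ (k + 2) \<le> C2 * R" .
      qed (use m1 in simp_all)
      also have "\<dots> = (4000 * 14 ^ k * C2) * (R * m ^ (k + 1))" by simp
      also have "\<dots> \<le> C * (R * m ^ (k + 2))"
        using CC mk R0 m1 C2(1) by (intro mult_mono) auto
      finally have qb: "(\<Sum>q\<leftarrow>qs. cost_bound ?B (3 - \<epsilon>) k q) \<le> C * (R * m ^ (k + 2))" .
      have "cost_bound ?A (3 - \<delta>) (k + 2) G = R * m ^ (k + 2)"
        unfolding lgraph_cost_bound R_def m_def n_def M_def ..
      then show "\<exists>ys t qs. set qs \<subseteq> instances ?B \<and>
           computes Q apsp_prog (encode ?A G) ys t (map (encode ?B) qs) \<and> solution ?A G ys \<and>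
           real t \<le> C * cost_bound ?A (3 - \<delta>) (k + 2) G \<and>
           (\<Sum>q\<leftarrow>qs. cost_bound ?B (3 - \<epsilon>) k q) \<le> C * cost_bound ?A (3 - \<delta>) (k + 2) G"
        using qs comp sol tb qb by metis
    qed
  qed
qed

theorem theorem6p1:
  fixes \<kappa> :: kind
  shows "subcubic_equivalent (reverse_rank_single_source \<kappa>) (APSP \<kappa>) \<and>
    (has_truly_subcubic_algorithm (reverse_rank_single_source \<kappa>) \<longleftrightarrow>
     has_truly_subcubic_algorithm (APSP \<kappa>))"
  using reverse_rank_reducible_to_APSP[of \<kappa>] APSP_reducible_to_reverse_rank[of \<kappa>]
    truly_subcubic_transfer[OF reverse_rank_reducible_to_APSP[of \<kappa>]]
    truly_subcubic_transfer[OF APSP_reducible_to_reverse_rank[of \<kappa>]]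
  unfolding subcubic_equivalent_def by (intro conjI iffI)

end
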